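(* Let $R=\bigoplus_{d\ge 0}R_d$ be a positively graded commutative Noetherian ring which is standard, i.e. $R=R_0[R_1]$, with $R_0$ a local ring with maximal ideal $\mathfrak m_0$ and infinite residue field $R_0/\mathfrak m_0$. Let $R_+=\bigoplus_{i>0}R_i$ and let $M$ be a finitely generated graded $R$-module. If $J$ is an ideal of $R$ generated by elements of degree zero, then for all $i\ge 1$, $H^{i}_{R_+,J}(M)_n$ is a finitely generated $R_0$-module for all $n\in\mathbb Z$.
   Context: For ideals $I,J$ of $R$ and an $R$-module $M$, $\Gamma_{I,J}(M)=\{x\in M : I^{n}x\subseteq Jx \text{ for some integer } n\ge 1\}$, and $H^i_{I,J}$ denotes the $i$-th right derived functor of $\Gamma_{I,J}$. For $I$ and $M$ graded, $H^i_{I,J}(M)$ carries the grading obtained by taking right derived functors of $\Gamma_{I,J}$ on the category of graded $R$-modules, and $H^i_{I,J}(M)_n$ denotes its component of degree $n$. *)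

theory Defs
  imports
    "HOL-Algebra.Module"
    "HOL-Algebra.QuotRing"
    "HOL-Algebra.Ideal_Product"
    "HOL-Algebra.Generated_Rings"
    "HOL-Algebra.Ring_Divisibility"
begin

section \<open>Graded rings and modules\<close>

definition internal_direct_sum :: "('b, 'z) ring_scheme \<Rightarrow> ('i \<Rightarrow> 'b set) \<Rightarrow> bool" where
  "internal_direct_sum M \<M> \<longleftrightarrow>
     (\<forall>n. additive_subgroup (\<M> n) M) \<and>
     (\<forall>x \<in> carrier M. \<exists>!c. (\<forall>n. c n \<in> \<M> n) \<and> finite {n. c n \<noteq> \<zero>\<^bsub>M\<^esub>} \<and>
        x = (\<Oplus>\<^bsub>M\<^esub> n \<in> {n. c n \<noteq> \<zero>\<^bsub>M\<^esub>}. c n))"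

locale graded_ring = cring R for R :: "('a, 'r) ring_scheme" (structure) and \<A> :: "nat \<Rightarrow> 'a set" +
  assumes ring_direct_sum: "internal_direct_sum R \<A>"
    and one_degree_zero: "\<one> \<in> \<A> 0"
    and mult_degree: "\<lbrakk>a \<in> \<A> d; b \<in> \<A> e\<rbrakk> \<Longrightarrow> a \<otimes> b \<in> \<A> (d + e)"

locale graded_module = graded_ring R \<A> + module R M
  for R :: "('a, 'r) ring_scheme" (structure) and \<A> :: "nat \<Rightarrow> 'a set"
    and M :: "('a, 'm) module" (structure) and \<M> :: "int \<Rightarrow> 'm set" +
  assumes module_direct_sum: "internal_direct_sum M \<M>"
    and smult_degree: "\<lbrakk>a \<in> \<A> d; x \<in> \<M> n\<rbrakk> \<Longrightarrow> a \<odot>\<^bsub>M\<^esub> x \<in> \<M> (int d + n)"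

definition degree_zero_ring :: "('a, 'r) ring_scheme \<Rightarrow> (nat \<Rightarrow> 'a set) \<Rightarrow> ('a, 'r) ring_scheme" where
  "degree_zero_ring R \<A> = R\<lparr>carrier := \<A> 0\<rparr>"

definition standard_graded :: "('a, 'r) ring_scheme \<Rightarrow> (nat \<Rightarrow> 'a set) \<Rightarrow> bool" where
  "standard_graded R \<A> \<longleftrightarrow> carrier R = generate_ring R (\<A> 0 \<union> \<A> 1)"

definition irrelevant_ideal :: "('a, 'r) ring_scheme \<Rightarrow> (nat \<Rightarrow> 'a set) \<Rightarrow> 'a set" where
  "irrelevant_ideal R \<A> =
     {(\<Oplus>\<^bsub>R\<^esub> i \<in> D. c i) | D c. finite D \<and> D \<subseteq> {0<..} \<and> (\<forall>i \<in> D. c i \<in> \<A> i)}"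

definition is_local_ring :: "('a, 'r) ring_scheme \<Rightarrow> 'a set \<Rightarrow> bool" where
  "is_local_ring R \<mm> \<longleftrightarrow> cring R \<and> maximalideal \<mm> R \<and> (\<forall>\<nn>. maximalideal \<nn> R \<longrightarrow> \<nn> = \<mm>)"

definition finitely_generated_module :: "('a, 'r) ring_scheme \<Rightarrow> ('a, 'm) module \<Rightarrow> bool" where
  "finitely_generated_module R M \<longleftrightarrow> module R M \<and>
     (\<exists>S. finite S \<and> S \<subseteq> carrier M \<and>
        (\<forall>x \<in> carrier M. \<exists>a \<in> S \<rightarrow> carrier R. x = (\<Oplus>\<^bsub>M\<^esub> s \<in> S. a s \<odot>\<^bsub>M\<^esub> s)))"

definition linear_maps ::
    "('a, 'r) ring_scheme \<Rightarrow> ('a, 'm) module \<Rightarrow> ('a, 'n) module \<Rightarrow> ('m \<Rightarrow> 'n) set" where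
  "linear_maps R M N =
     {h \<in> carrier M \<rightarrow> carrier N.
        (\<forall>x \<in> carrier M. \<forall>y \<in> carrier M. h (x \<oplus>\<^bsub>M\<^esub> y) = h x \<oplus>\<^bsub>N\<^esub> h y) \<and>
        (\<forall>a \<in> carrier R. \<forall>x \<in> carrier M. h (a \<odot>\<^bsub>M\<^esub> x) = a \<odot>\<^bsub>N\<^esub> h x)}"

text \<open>Morphisms of the category of graded modules have degree zero.\<close>

definition graded_linear_maps ::
    "('a, 'r) ring_scheme \<Rightarrow> ('a, 'm) module \<Rightarrow> (int \<Rightarrow> 'm set) \<Rightarrow>
     ('a, 'n) module \<Rightarrow> (int \<Rightarrow> 'n set) \<Rightarrow> ('m \<Rightarrow> 'n) set" where
  "graded_linear_maps R M \<M> N \<N> = {h \<in> linear_maps R M N. \<forall>n. h ` \<M> n \<subseteq> \<N> n}"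

text \<open>Quotient of a module by a submodule. The record of modules extends that of rings;
  the ring multiplication and its unit play no role for modules.\<close>

definition quotient_module :: "('a, 'm) module \<Rightarrow> 'm set \<Rightarrow> ('a, 'm set) module" where
  "quotient_module M N =
     \<lparr>carrier = a_rcosets\<^bsub>M\<^esub> N, monoid.mult = undefined, one = undefined,
      zero = N, add = set_add M, smult = (\<lambda>a C. \<Union>x\<in>C. N +>\<^bsub>M\<^esub> (a \<odot>\<^bsub>M\<^esub> x))\<rparr>"


section \<open>Injective resolutions in the category of graded modules\<close>

text \<open>Injective objects of the category of graded modules: graded maps into E extend along
  graded monomorphisms A \<open>\<rightarrow>\<close> B. As HOL cannot quantify over types inside a formula, the
  carriers of A and B live in the type \<open>'a + 'e\<close>. This type contains a copy of every shift of
  R and of every homogeneous ideal, so by the graded form of Baer's criterion the extension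
  property for modules A and B over any other type follows.\<close>

definition graded_injective ::
    "('a, 'r) ring_scheme \<Rightarrow> (nat \<Rightarrow> 'a set) \<Rightarrow> ('a, 'e) module \<Rightarrow> (int \<Rightarrow> 'e set) \<Rightarrow> bool" where
  "graded_injective R \<A> E \<E> \<longleftrightarrow> graded_module R \<A> E \<E> \<and>
     (\<forall>(A :: ('a, 'a + 'e) module) \<G> (B :: ('a, 'a + 'e) module) \<H> f g.
        graded_module R \<A> A \<G> \<longrightarrow> graded_module R \<A> B \<H> \<longrightarrow>
        f \<in> graded_linear_maps R A \<G> B \<H> \<longrightarrow> inj_on f (carrier A) \<longrightarrow>
        g \<in> graded_linear_maps R A \<G> E \<E> \<longrightarrow>
        (\<exists>h \<in> graded_linear_maps R B \<H> E \<E>. \<forall>x \<in> carrier A. h (f x) = g x))"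

text \<open>An exact sequence \<open>0 \<rightarrow> M \<rightarrow> E 0 \<rightarrow> E 1 \<rightarrow> \<dots>\<close> of graded modules with every \<open>E k\<close> injective;
  \<open>\<epsilon>\<close> is the augmentation and \<open>\<delta> k\<close> the differential from \<open>E k\<close> to \<open>E (Suc k)\<close>.\<close>

definition graded_injective_resolution ::
    "('a, 'r) ring_scheme \<Rightarrow> (nat \<Rightarrow> 'a set) \<Rightarrow> ('a, 'm) module \<Rightarrow> (int \<Rightarrow> 'm set) \<Rightarrow>
     (nat \<Rightarrow> ('a, 'e) module) \<Rightarrow> (nat \<Rightarrow> int \<Rightarrow> 'e set) \<Rightarrow>
     ('m \<Rightarrow> 'e) \<Rightarrow> (nat \<Rightarrow> 'e \<Rightarrow> 'e) \<Rightarrow> bool" where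
  "graded_injective_resolution R \<A> M \<M> E \<E> \<epsilon> \<delta> \<longleftrightarrow>
     (\<forall>k. graded_injective R \<A> (E k) (\<E> k)) \<and>
     \<epsilon> \<in> graded_linear_maps R M \<M> (E 0) (\<E> 0) \<and>
     (\<forall>k. \<delta> k \<in> graded_linear_maps R (E k) (\<E> k) (E (Suc k)) (\<E> (Suc k))) \<and>
     inj_on \<epsilon> (carrier M) \<and>
     \<epsilon> ` carrier M = a_kernel (E 0) (E 1) (\<delta> 0) \<and>
     (\<forall>k. \<delta> k ` carrier (E k) = a_kernel (E (Suc k)) (E (Suc (Suc k))) (\<delta> (Suc k)))"


section \<open>Local cohomology with respect to a pair of ideals\<close>

definition pair_torsion ::
    "('a, 'r) ring_scheme \<Rightarrow> 'a set \<Rightarrow> 'a set \<Rightarrow> ('a, 'm) module \<Rightarrow> 'm set" where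
  "pair_torsion R I J M =
     {x \<in> carrier M. \<exists>n \<ge> (1 :: nat).
        (\<lambda>a. a \<odot>\<^bsub>M\<^esub> x) ` (I [^]\<^bsub>ideals_set R\<^esub> n) \<subseteq> (\<lambda>b. b \<odot>\<^bsub>M\<^esub> x) ` J}"

definition pair_cocycles ::
    "('a, 'r) ring_scheme \<Rightarrow> 'a set \<Rightarrow> 'a set \<Rightarrow>
     (nat \<Rightarrow> ('a, 'e) module) \<Rightarrow> (nat \<Rightarrow> 'e \<Rightarrow> 'e) \<Rightarrow> nat \<Rightarrow> 'e set" where
  "pair_cocycles R I J E \<delta> i = {x \<in> pair_torsion R I J (E i). \<delta> i x = \<zero>\<^bsub>E (Suc i)\<^esub>}"

definition pair_coboundaries ::
    "('a, 'r) ring_scheme \<Rightarrow> 'a set \<Rightarrow> 'a set \<Rightarrow>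
     (nat \<Rightarrow> ('a, 'e) module) \<Rightarrow> (nat \<Rightarrow> 'e \<Rightarrow> 'e) \<Rightarrow> nat \<Rightarrow> 'e set" where
  "pair_coboundaries R I J E \<delta> i =
     (case i of 0 \<Rightarrow> {\<zero>\<^bsub>E 0\<^esub>} | Suc j \<Rightarrow> \<delta> j ` pair_torsion R I J (E j))"

text \<open>The \<open>i\<close>-th right derived functor of \<open>\<Gamma>\<^sub>I\<^sub>,\<^sub>J\<close> at M, computed from an injective resolution
  \<open>(E, \<delta>)\<close> of M: the \<open>i\<close>-th cohomology module of the complex \<open>\<Gamma>\<^sub>I\<^sub>,\<^sub>J (E)\<close>.\<close>

definition pair_local_cohomology ::
    "('a, 'r) ring_scheme \<Rightarrow> 'a set \<Rightarrow> 'a set \<Rightarrow>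
     (nat \<Rightarrow> ('a, 'e) module) \<Rightarrow> (nat \<Rightarrow> 'e \<Rightarrow> 'e) \<Rightarrow> nat \<Rightarrow> ('a, 'e set) module" where
  "pair_local_cohomology R I J E \<delta> i =
     quotient_module ((E i)\<lparr>carrier := pair_cocycles R I J E \<delta> i\<rparr>)
       (pair_coboundaries R I J E \<delta> i)"

text \<open>Its component of degree \<open>n\<close>, consisting of the classes of the cocycles of degree \<open>n\<close>;
  to be regarded as a module over the degree-zero subring.\<close>

definition pair_local_cohomology_component ::
    "('a, 'r) ring_scheme \<Rightarrow> 'a set \<Rightarrow> 'a set \<Rightarrow>
     (nat \<Rightarrow> ('a, 'e) module) \<Rightarrow> (nat \<Rightarrow> int \<Rightarrow> 'e set) \<Rightarrow> (nat \<Rightarrow> 'e \<Rightarrow> 'e) \<Rightarrow>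
     nat \<Rightarrow> int \<Rightarrow> ('a, 'e set) module" where
  "pair_local_cohomology_component R I J E \<E> \<delta> i n =
     (pair_local_cohomology R I J E \<delta> i)
       \<lparr>carrier := (\<lambda>x. pair_coboundaries R I J E \<delta> i +>\<^bsub>E i\<^esub> x) `
                    (pair_cocycles R I J E \<delta> i \<inter> \<E> i n)\<rparr>"

end

theory Submission
  imports "HOL-Library.Function_Algebras" Defs "HOL-Algebra.Free_Abelian_Groups"
begin

text \<open>If a generator of J is a unit of the local ring in degree zero, then J = R, torsion is the identity
  functor and the higher cohomology vanishes. Otherwise J is generated by elements of the maximal ideal in degree
  zero, and Nakayama's lemma shows that a homogeneous element is torsion with respect to the pair
  exactly if it is killed by powers of generators \<open>f\<^sub>0, \<dots>, f\<^bsub>r-1\<^esub>\<close> of \<open>R\<^sub>1\<close>; so it suffices to treat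
  ordinary local cohomology with support in the irrelevant ideal.

  Call a complex X Noetherian if its cohomology satisfies the ascending chain condition for graded
  submodules. The injective resolution E of M is Noetherian, and so is every mapping cone of
  multiplication by some \<open>f\<^sub>j\<close> on a Noetherian complex. An injective module is \<open>f\<^sub>j\<close>-divisible modulo its
  \<open>f\<^sub>j\<close>-torsion, hence the cone of \<open>f\<^sub>j\<close> on the \<open>f\<^sub>j\<close>-torsion subcomplex is still Noetherian. After
  taking the cones of \<open>f\<^sub>0, \<dots>, f\<^bsub>r-1\<^esub>\<close> one after the other, the cohomology is Noetherian and all
  \<open>f\<^sub>j\<close> act locally nilpotently on it, so it vanishes in large degrees and is Noetherian over \<open>R\<^sub>0\<close> in
  every degree. This descends to the torsion complex one cone at a time: the kernel of \<open>f\<^sub>j\<close> on the cohomology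
  is an image of the cohomology of the cone, and one argues by descending induction on the degree.\<close>

section \<open>Ascending chains of graded families\<close>

text \<open>The obstacle is that the torsion complex need not have Noetherian cohomology: for k[x],
  the module H^1 with support in (x) is nonzero in every negative degree and has infinite ascending
  chains. So finiteness cannot be pushed through the torsion functor; it survives in the cones and
  has to be recovered from them one operator at a time. The cone of f_j keeps it because, modulo the
  f_j-torsion, f_j is injective by the definition of torsion and surjective by the divisibility of
  injectives, so that the cone of the quotient is acyclic. Chain conditions replace finite
  generation until the very end, because they pass to subquotients and extensions without any choice
  of generators. The Noetherian hypothesis concerns R, and statements over R_0 are reached through
  it: a chain of R_0-submodules in one degree is extended to a graded chain, and ideals of R_0 are
  pulled back to R.\<close>

definition subgp :: "'b::ab_group_add set \<Rightarrow> bool" where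
  "subgp N \<longleftrightarrow> 0 \<in> N \<and> (\<forall>x\<in>N. \<forall>y\<in>N. x - y \<in> N)"

lemma subgpI: "0 \<in> N \<Longrightarrow> (\<And>x y. x \<in> N \<Longrightarrow> y \<in> N \<Longrightarrow> x - y \<in> N) \<Longrightarrow> subgp N"
  by (auto simp: subgp_def)

lemma subgp_zero: "subgp N \<Longrightarrow> 0 \<in> N"
  by (auto simp: subgp_def)

lemma subgp_diff: "subgp N \<Longrightarrow> x \<in> N \<Longrightarrow> y \<in> N \<Longrightarrow> x - y \<in> N"
  by (auto simp: subgp_def)

lemma subgp_minus: "subgp N \<Longrightarrow> x \<in> N \<Longrightarrow> - x \<in> N"
  using subgp_diff[of N 0 x] by (simp add: subgp_zero)

lemma subgp_add: "subgp N \<Longrightarrow> x \<in> N \<Longrightarrow> y \<in> N \<Longrightarrow> x + y \<in> N"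
  using subgp_diff[of N x "- y"] by (simp add: subgp_minus)

lemma subgp_add_cancel: "subgp N \<Longrightarrow> x - y \<in> N \<Longrightarrow> y \<in> N \<Longrightarrow> x \<in> N"
  using subgp_add[of N "x - y" y] by simp

lemma subgp_diff_cancel: "subgp N \<Longrightarrow> x - y \<in> N \<Longrightarrow> x \<in> N \<Longrightarrow> y \<in> N"
  using subgp_diff[of N x "x - y"] by simp

definition addv :: "('b::ab_group_add \<Rightarrow> 'c::ab_group_add) \<Rightarrow> bool" where
  "addv h \<longleftrightarrow> (\<forall>x y. h (x - y) = h x - h y)"

lemma addv_diff: "addv h \<Longrightarrow> h (x - y) = h x - h y"
  by (simp add: addv_def)

lemma addv_zero: "addv h \<Longrightarrow> h 0 = 0"
  using addv_diff[of h 0 0] by simp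

lemma addv_minus: "addv h \<Longrightarrow> h (- x) = - h x"
  using addv_diff[of h 0 x] by (simp add: addv_zero)

lemma addv_add: "addv h \<Longrightarrow> h (x + y) = h x + h y"
  using addv_diff[of h x "- y"] by (simp add: addv_minus)

lemmas addv_simps = addv_diff addv_zero addv_minus addv_add

lemma addv_funpow: "addv (h :: 'b \<Rightarrow> 'b::ab_group_add) \<Longrightarrow> addv (h ^^ m)"
  by (induction m) (auto simp: addv_def)

text \<open>The stopping index \<open>q\<close> does not depend on the degree \<open>i\<close>. This
  uniformity makes it the chain condition for graded submodules, and it later forces vanishing in
  all large degrees.\<close>

definition acc_chain :: "('i \<Rightarrow> 'b set) set \<Rightarrow> bool" where
  "acc_chain L \<longleftrightarrow> (\<forall>N. (\<forall>p::nat. N p \<in> L) \<and> (\<forall>p i. N p i \<subseteq> N (Suc p) i)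
     \<longrightarrow> (\<exists>q. \<forall>p\<ge>q. \<forall>i. N p i \<subseteq> N q i))"

lemma acc_chainI:
  assumes "\<And>N. (\<And>p::nat. N p \<in> L) \<Longrightarrow> (\<And>p i. N p i \<subseteq> N (Suc p) i) \<Longrightarrow> \<exists>q. \<forall>p\<ge>q. \<forall>i. N p i \<subseteq> N q i"
  shows "acc_chain L"
  using assms by (auto simp: acc_chain_def)

lemma acc_chainD:
  assumes "acc_chain L" "\<And>p::nat. N p \<in> L" "\<And>p i. N p i \<subseteq> N (Suc p) i"
  obtains q where "\<And>p i. p \<ge> q \<Longrightarrow> N p i \<subseteq> N q i"
  using assms unfolding acc_chain_def by meson

text \<open>Submodules of a subquotient \<open>Z/I\<close>, given by their preimages in Z: graded ones for indices in \<open>int\<close> with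
  \<open>sh n = n + 1\<close>, and submodules over the degree-zero ring in a single degree for indices in \<open>unit\<close> with
  \<open>r = 0\<close>.\<close>

definition stable_families :: "('i \<Rightarrow> 'i) \<Rightarrow> nat \<Rightarrow> (nat \<Rightarrow> 'b::ab_group_add \<Rightarrow> 'b) \<Rightarrow> ('s \<Rightarrow> 'b \<Rightarrow> 'b) \<Rightarrow> 's set \<Rightarrow>
    ('i \<Rightarrow> 'b set) \<Rightarrow> ('i \<Rightarrow> 'b set) \<Rightarrow> ('i \<Rightarrow> 'b set) set" where
  "stable_families sh r t sc S I Z = {N. \<forall>i. subgp (N i) \<and> I i \<subseteq> N i \<and> N i \<subseteq> Z i \<and>
     (\<forall>s\<in>S. \<forall>x\<in>N i. sc s x \<in> N i) \<and> (\<forall>j<r. \<forall>x\<in>N i. t j x \<in> N (sh i))}"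

lemma stable_familiesI:
  assumes "\<And>i. subgp (N i)" "\<And>i x. x \<in> I i \<Longrightarrow> x \<in> N i" "\<And>i x. x \<in> N i \<Longrightarrow> x \<in> Z i"
    "\<And>i s x. s \<in> S \<Longrightarrow> x \<in> N i \<Longrightarrow> sc s x \<in> N i"
    "\<And>i j x. j < r \<Longrightarrow> x \<in> N i \<Longrightarrow> t j x \<in> N (sh i)"
  shows "N \<in> stable_families sh r t sc S I Z"
  using assms by (auto simp: stable_families_def)

lemma stable_familiesD:
  assumes "N \<in> stable_families sh r t sc S I Z"
  shows "subgp (N i)" "x \<in> I i \<Longrightarrow> x \<in> N i" "x \<in> N i \<Longrightarrow> x \<in> Z i"
    "s \<in> S \<Longrightarrow> x \<in> N i \<Longrightarrow> sc s x \<in> N i"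
    "j < r \<Longrightarrow> x \<in> N i \<Longrightarrow> t j x \<in> N (sh i)"
  using assms by (auto simp: stable_families_def)

text \<open>In an exact sequence Z'/I' -> Z/I -> Z''/I'', with exactness asked for in the middle
  only, two comparable submodules of the middle term agree as soon as their preimages on the left
  and their images on the right agree. Injections, cones and the descent from a cone are all
  instances.\<close>

lemma acc_chain_exact:
  fixes \<phi> :: "'b'::ab_group_add \<Rightarrow> 'b::ab_group_add" and \<psi> :: "'b \<Rightarrow> 'b''::ab_group_add"
  assumes acc': "acc_chain (stable_families sh r t' sc' S I' Z')"
    and acc'': "acc_chain (stable_families sh r t'' sc'' S I'' Z'')"
    and add: "addv \<phi>" "addv \<psi>" "\<And>j. addv (t'' j)" "\<And>s. addv (sc'' s)"
    and comm_phi: "\<And>s x. \<phi> (sc' s x) = sc s (\<phi> x)" "\<And>j x. \<phi> (t' j x) = t j (\<phi> x)"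
    and comm_psi: "\<And>s x. \<psi> (sc s x) = sc'' s (\<psi> x)" "\<And>j x. \<psi> (t j x) = t'' j (\<psi> x)"
    and Z'_sub: "\<And>i. subgp (Z' i)"
    and Z'_stable: "\<And>i s x. s \<in> S \<Longrightarrow> x \<in> Z' i \<Longrightarrow> sc' s x \<in> Z' i" "\<And>i j x. j < r \<Longrightarrow> x \<in> Z' i \<Longrightarrow> t' j x \<in> Z' (sh i)"
    and I''_sub: "\<And>i. subgp (I'' i)"
    and I''_stable: "\<And>i s x. s \<in> S \<Longrightarrow> x \<in> I'' i \<Longrightarrow> sc'' s x \<in> I'' i" "\<And>i j x. j < r \<Longrightarrow> x \<in> I'' i \<Longrightarrow> t'' j x \<in> I'' (sh i)"
    and phi: "\<And>i x. x \<in> I' i \<Longrightarrow> \<phi> x \<in> I i" "\<And>i x. x \<in> I' i \<Longrightarrow> x \<in> Z' i"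
    and psi: "\<And>i x. x \<in> Z i \<Longrightarrow> \<psi> x \<in> Z'' i" "\<And>i x. x \<in> I'' i \<Longrightarrow> x \<in> Z'' i"
    and Z''_sub: "\<And>i. subgp (Z'' i)"
    and exact: "\<And>i x. x \<in> Z i \<Longrightarrow> \<psi> x \<in> I'' i \<Longrightarrow> \<exists>y\<in>Z' i. x - \<phi> y \<in> I i"
  shows "acc_chain (stable_families sh r t sc S I Z)"
proof (rule acc_chainI)
  fix N :: "nat \<Rightarrow> 'a \<Rightarrow> 'b set"
  assume N: "\<And>p. N p \<in> stable_families sh r t sc S I Z" and mono: "\<And>p i. N p i \<subseteq> N (Suc p) i"
  note ND = stable_familiesD[OF N]
  define N' where "N' p i = {y \<in> Z' i. \<phi> y \<in> N p i}" for p i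
  \<comment> \<open>The image is enlarged by \<open>I''\<close>, which it need not contain, to
    become the preimage of a submodule of Z''/I''.\<close>
  define N'' where "N'' p i = {\<psi> x + w |x w. x \<in> N p i \<and> w \<in> I'' i}" for p i
  have N': "N' p \<in> stable_families sh r t' sc' S I' Z'" for p
  proof (rule stable_familiesI)
    show "subgp (N' p i)" for i
      using Z'_sub[of i] ND(1)[of p i]
      by (auto simp: N'_def subgp_def addv_simps[OF add(1)])
  qed (auto simp: N'_def ND phi comm_phi Z'_stable)
  have N'': "N'' p \<in> stable_families sh r t'' sc'' S I'' Z''" for p
  proof (rule stable_familiesI)
    show "subgp (N'' p i)" for i
    proof (rule subgpI)
      have "\<psi> 0 + 0 \<in> N'' p i"
        unfolding N''_def using subgp_zero[OF ND(1)] subgp_zero[OF I''_sub] by blast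
      then show "0 \<in> N'' p i" by (simp add: addv_simps[OF add(2)])
      fix x y assume "x \<in> N'' p i" "y \<in> N'' p i"
      then obtain a b c e where *: "x = \<psi> a + b" "y = \<psi> c + e" "a \<in> N p i" "c \<in> N p i" "b \<in> I'' i" "e \<in> I'' i"
        unfolding N''_def by blast
      then have "x - y = \<psi> (a - c) + (b - e)" by (simp add: addv_simps[OF add(2)])
      then show "x - y \<in> N'' p i"
        unfolding N''_def using * subgp_diff[OF ND(1)] subgp_diff[OF I''_sub] by blast
    qed
  next
    fix i x assume "x \<in> I'' i"
    then have "\<psi> 0 + x \<in> N'' p i"
      unfolding N''_def using subgp_zero[OF ND(1)] by blast
    then show "x \<in> N'' p i" by (simp add: addv_simps[OF add(2)])
  next
    fix i x assume "x \<in> N'' p i"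
    then show "x \<in> Z'' i"
      unfolding N''_def using psi ND(3) subgp_add[OF Z''_sub] by blast
  next
    fix i s x assume s: "s \<in> S" "x \<in> N'' p i"
    then obtain a b where *: "x = \<psi> a + b" "a \<in> N p i" "b \<in> I'' i" unfolding N''_def by blast
    then have "sc'' s x = \<psi> (sc s a) + sc'' s b" by (simp add: addv_simps[OF add(4)] comm_psi)
    then show "sc'' s x \<in> N'' p i" unfolding N''_def using * ND(4)[OF s(1)] I''_stable(1)[OF s(1)] by blast
  next
    fix i j x assume s: "j < r" "x \<in> N'' p i"
    then obtain a b where *: "x = \<psi> a + b" "a \<in> N p i" "b \<in> I'' i" unfolding N''_def by blast
    then have "t'' j x = \<psi> (t j a) + t'' j b" by (simp add: addv_simps[OF add(3)] comm_psi)
    then show "t'' j x \<in> N'' p (sh i)" unfolding N''_def using * ND(5)[OF s(1)] I''_stable(2)[OF s(1)] by blast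
  qed
  have "N' p i \<subseteq> N' (Suc p) i" for p i
    unfolding N'_def using mono[of p i] by auto
  then obtain q' where q': "\<And>p i. p \<ge> q' \<Longrightarrow> N' p i \<subseteq> N' q' i"
    using acc_chainD[OF acc', of N'] N' by metis
  have "N'' p i \<subseteq> N'' (Suc p) i" for p i
    unfolding N''_def using mono[of p i] by auto
  then obtain q'' where q'': "\<And>p i. p \<ge> q'' \<Longrightarrow> N'' p i \<subseteq> N'' q'' i"
    using acc_chainD[OF acc'', of N''] N'' by metis
  have mono2: "N p i \<subseteq> N q i" if "p \<le> q" for p q i
    using lift_Suc_mono_le[of "\<lambda>p. N p i"] mono that by blast
  define q where "q = max q' q''"
  have "N p i \<subseteq> N q i" if p: "p \<ge> q" for p i
  proof
    fix x assume x: "x \<in> N p i"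
    have "\<psi> x + 0 \<in> N'' p i" unfolding N''_def using x subgp_zero[OF I''_sub] by blast
    then have "\<psi> x + 0 \<in> N'' q'' i" using q''[of p i] p unfolding q_def by auto
    \<comment> \<open>The chain of images has already stopped, so an element \<open>a\<close> of an
      earlier member has the same image modulo \<open>I''\<close>. By exactness \<open>x - a\<close>
      comes from Z', where the chain of preimages has stopped as well.\<close>
    then obtain a w where a: "\<psi> x + 0 = \<psi> a + w" "a \<in> N q'' i" "w \<in> I'' i" unfolding N''_def by auto
    have aq: "a \<in> N q i" and ap: "a \<in> N p i"
      using a(2) mono2[of q'' q i] mono2[of q'' p i] p unfolding q_def by auto
    have xa: "x - a \<in> N p i" using subgp_diff[OF ND(1) x ap] .
    have "\<psi> (x - a) \<in> I'' i" using a by (simp add: addv_simps[OF add(2)])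
    from exact[OF ND(3)[OF xa] this] obtain y where y: "y \<in> Z' i" "x - a - \<phi> y \<in> I i" by blast
    have "\<phi> y \<in> N p i"
      using subgp_diff_cancel[OF ND(1) ND(2)[OF y(2)] xa] .
    then have "y \<in> N' p i" using y unfolding N'_def by auto
    then have "y \<in> N' q' i" using q'[of p i] p unfolding q_def by auto
    then have "\<phi> y \<in> N q i" using mono2[of q' q i] unfolding q_def N'_def by auto
    then have "x - a \<in> N q i" using subgp_add_cancel[OF ND(1) ND(2)[OF y(2)]] by blast
    then show "x \<in> N q i" using subgp_add_cancel[OF ND(1) _ aq] by blast
  qed
  then show "\<exists>q. \<forall>p\<ge>q. \<forall>i. N p i \<subseteq> N q i" by blast
qed

lemma acc_chain_trivial:
  assumes "\<And>i x. x \<in> Z i \<Longrightarrow> x \<in> I i"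
  shows "acc_chain (stable_families sh r t sc S I Z)"
proof (rule acc_chainI)
  fix N :: "nat \<Rightarrow> 'a \<Rightarrow> 'b set"
  assume N: "\<And>p. N p \<in> stable_families sh r t sc S I Z"
  then have "N p i \<subseteq> N 0 i" for p i
    using stable_familiesD(2,3)[OF N] assms by blast
  then show "\<exists>q. \<forall>p\<ge>q. \<forall>i. N p i \<subseteq> N q i" by blast
qed

text \<open>All groups are understood modulo the fixed subgroup \<open>B\<close>, so that the terms of a complex, whose carriers
  are arbitrary sets, can be presented as quotients of subgroups of one type of class \<open>ab_group_add\<close>.\<close>

locale graded_complex =
  fixes d :: "'b::ab_group_add \<Rightarrow> 'b" and r :: nat and t :: "nat \<Rightarrow> 'b \<Rightarrow> 'b"
    and sc :: "'s \<Rightarrow> 'b \<Rightarrow> 'b" and S :: "'s set" and B :: "'b set" and A :: "int \<Rightarrow> int \<Rightarrow> 'b set"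
  assumes add_d: "addv d" and add_t: "\<And>j. addv (t j)" and add_sc: "\<And>s. addv (sc s)"
    and comm: "\<And>j x. d (t j x) = t j (d x)" "\<And>s x. d (sc s x) = sc s (d x)"
      "\<And>i j x. t i (t j x) = t j (t i x)" "\<And>s j x. t j (sc s x) = sc s (t j x)"
    and B_sub: "subgp B" and A_sub: "\<And>k n. subgp (A k n)" and B_A: "\<And>k n x. x \<in> B \<Longrightarrow> x \<in> A k n"
    and B_stable: "\<And>x. x \<in> B \<Longrightarrow> d x \<in> B" "\<And>j x. j < r \<Longrightarrow> x \<in> B \<Longrightarrow> t j x \<in> B"
      "\<And>s x. s \<in> S \<Longrightarrow> x \<in> B \<Longrightarrow> sc s x \<in> B"
    and A_stable: "\<And>k n x. x \<in> A k n \<Longrightarrow> d x \<in> A (k + 1) n"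
      "\<And>j k n x. j < r \<Longrightarrow> x \<in> A k n \<Longrightarrow> t j x \<in> A k (n + 1)"
      "\<And>s k n x. s \<in> S \<Longrightarrow> x \<in> A k n \<Longrightarrow> sc s x \<in> A k n"
    and dd: "\<And>k n x. x \<in> A k n \<Longrightarrow> d (d x) \<in> B"
begin

lemmas ops_simps = addv_simps[OF add_d] addv_simps[OF add_t] addv_simps[OF add_sc] comm

text \<open>Here \<open>k\<close> is the cohomological and \<open>n\<close> the internal degree;
  \<open>cyc\<close> and \<open>bnd\<close> are the full preimages of the cocycles and coboundaries
  of the complex A/B.\<close>

definition cyc :: "int \<Rightarrow> int \<Rightarrow> 'b set" where
  "cyc k n = {x \<in> A k n. d x \<in> B}"

definition bnd :: "int \<Rightarrow> int \<Rightarrow> 'b set" where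
  "bnd k n = {d y + b |y b. y \<in> A (k - 1) n \<and> b \<in> B}"

text \<open>Stability is asked for under the scalars in \<open>S\<close> and the operators
  \<open>t j\<close>. With R_0 as scalars and generators of R_1 as operators this amounts to
  stability under the whole standard graded ring.\<close>

definition noeth :: bool where
  "noeth \<longleftrightarrow> (\<forall>k. acc_chain (stable_families (\<lambda>n. n + 1) r t sc S (bnd k) (cyc k)))"

text \<open>The property wanted of the torsion complex. Vanishing in large degrees is carried along
  as the starting point of the descending induction in
  \<open>degreewise_fin_descend\<close>.\<close>

definition degreewise_fin :: bool where
  "degreewise_fin \<longleftrightarrow> (\<forall>k. (\<exists>n0. \<forall>n\<ge>n0. cyc k n \<subseteq> bnd k n) \<and>
     (\<forall>n. acc_chain (stable_families (\<lambda>u::unit. u) 0 t sc S (\<lambda>_. bnd k n) (\<lambda>_. cyc k n))))"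

lemma cyc_sub: "subgp (cyc k n)"
  using A_sub[of k n] B_sub by (auto simp: cyc_def subgp_def ops_simps)

lemma bndI: "y \<in> A (k - 1) n \<Longrightarrow> b \<in> B \<Longrightarrow> d y + b \<in> bnd k n"
  by (auto simp: bnd_def)

lemma bndI': "y \<in> A (k - 1) n \<Longrightarrow> x - d y \<in> B \<Longrightarrow> x \<in> bnd k n"
  using bndI[of y k n "x - d y"] by simp

lemma bndE: "x \<in> bnd k n \<Longrightarrow> (\<And>y. y \<in> A (k - 1) n \<Longrightarrow> x - d y \<in> B \<Longrightarrow> P) \<Longrightarrow> P"
  by (auto simp: bnd_def)

lemma bnd_sub: "subgp (bnd k n)"
proof (rule subgpI)
  show "0 \<in> bnd k n"
    by (rule bndI'[of 0]) (auto simp: ops_simps subgp_zero[OF A_sub] subgp_zero[OF B_sub])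
  fix x y assume "x \<in> bnd k n" "y \<in> bnd k n"
  then obtain a b where *: "a \<in> A (k - 1) n" "b \<in> A (k - 1) n" "x - d a \<in> B" "y - d b \<in> B"
    by (metis bndE)
  have "x - y - d (a - b) = (x - d a) - (y - d b)" by (simp add: ops_simps)
  with subgp_diff[OF B_sub *(3,4)] have "x - y - d (a - b) \<in> B" by metis
  then show "x - y \<in> bnd k n"
    by (rule bndI'[OF subgp_diff[OF A_sub *(1,2)]])
qed

lemma B_bnd: "b \<in> B \<Longrightarrow> b \<in> bnd k n"
  by (rule bndI'[of 0]) (auto simp: ops_simps subgp_zero[OF A_sub])

lemma bnd_cyc: "x \<in> bnd k n \<Longrightarrow> x \<in> cyc k n"
proof (erule bndE)
  fix y assume y: "y \<in> A (k - 1) n" "x - d y \<in> B"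
  have "x \<in> A k n"
    using subgp_add_cancel[OF A_sub B_A[OF y(2), of k n]] A_stable(1)[OF y(1)] by simp
  moreover have "d x - d (d y) \<in> B" using B_stable(1)[OF y(2)] by (simp add: ops_simps)
  then have "d x \<in> B" using subgp_add_cancel[OF B_sub] dd[OF y(1)] by blast
  ultimately show "x \<in> cyc k n" by (simp add: cyc_def)
qed

lemma cyc_stable: "j < r \<Longrightarrow> x \<in> cyc k n \<Longrightarrow> t j x \<in> cyc k (n + 1)" "s \<in> S \<Longrightarrow> x \<in> cyc k n \<Longrightarrow> sc s x \<in> cyc k n"
  by (auto simp: cyc_def A_stable B_stable ops_simps)

lemma bnd_stable: "j < r \<Longrightarrow> x \<in> bnd k n \<Longrightarrow> t j x \<in> bnd k (n + 1)" "s \<in> S \<Longrightarrow> x \<in> bnd k n \<Longrightarrow> sc s x \<in> bnd k n"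
proof -
  assume j: "j < r" and "x \<in> bnd k n"
  then obtain y where y: "y \<in> A (k - 1) n" "x - d y \<in> B" by (metis bndE)
  have "t j x - d (t j y) \<in> B" using B_stable(2)[OF j y(2)] by (simp add: ops_simps)
  then show "t j x \<in> bnd k (n + 1)" by (rule bndI'[OF A_stable(2)[OF j y(1)]])
next
  assume j: "s \<in> S" and "x \<in> bnd k n"
  then obtain y where y: "y \<in> A (k - 1) n" "x - d y \<in> B" by (metis bndE)
  have "sc s x - d (sc s y) \<in> B" using B_stable(3)[OF j y(2)] by (simp add: ops_simps)
  then show "sc s x \<in> bnd k n" by (rule bndI'[OF A_stable(3)[OF j y(1)]])
qed

text \<open>For \<open>J = {..<r}\<close> this is ordinary torsion with respect to all operators;
  smaller sets occur because the operators are imposed one at a time.\<close>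

definition tor :: "nat set \<Rightarrow> int \<Rightarrow> int \<Rightarrow> 'b set" where
  "tor J k n = {x \<in> A k n. \<forall>j\<in>J. \<exists>m. (t j ^^ m) x \<in> B}"

lemma pow_comm: "d ((t j ^^ m) x) = (t j ^^ m) (d x)" "(t j ^^ m) (sc s x) = sc s ((t j ^^ m) x)"
    "(t j ^^ m) (t i x) = t i ((t j ^^ m) x)"
  by (induction m) (auto simp: ops_simps)

lemma pow_B: "j < r \<Longrightarrow> x \<in> B \<Longrightarrow> (t j ^^ m) x \<in> B"
  by (induction m) (auto simp: B_stable)

lemma pow_B_mono: "j < r \<Longrightarrow> (t j ^^ m) x \<in> B \<Longrightarrow> m \<le> m' \<Longrightarrow> (t j ^^ m') x \<in> B"
  using pow_B[of j "(t j ^^ m) x" "m' - m"] funpow_add[of "m' - m" m "t j"] by simp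

lemma tor_sub: "J \<subseteq> {..<r} \<Longrightarrow> subgp (tor J k n)"
proof (rule subgpI)
  show "0 \<in> tor J k n"
    using subgp_zero[OF A_sub] subgp_zero[OF B_sub] unfolding tor_def
    by (auto intro!: exI[of _ 0])
  fix x y assume J: "J \<subseteq> {..<r}" and x: "x \<in> tor J k n" and y: "y \<in> tor J k n"
  have "\<exists>m. (t j ^^ m) (x - y) \<in> B" if j: "j \<in> J" for j
  proof -
    obtain m m' where "(t j ^^ m) x \<in> B" "(t j ^^ m') y \<in> B" using x y j unfolding tor_def by blast
    then have "(t j ^^ max m m') x \<in> B" "(t j ^^ max m m') y \<in> B"
      using pow_B_mono J j by (meson lessThan_iff max.cobounded1 max.cobounded2 subsetD)+
    then have "(t j ^^ max m m') (x - y) \<in> B"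
      using subgp_diff[OF B_sub] by (simp add: addv_diff[OF addv_funpow[OF add_t]])
    then show ?thesis by blast
  qed
  then show "x - y \<in> tor J k n" using x y subgp_diff[OF A_sub] unfolding tor_def by auto
qed

lemma tor_complex:
  assumes J: "J \<subseteq> {..<r}"
  shows "graded_complex d r t sc S B (tor J)"
proof
  show "x \<in> tor J k n \<Longrightarrow> d x \<in> tor J (k + 1) n" for k n x
    using B_stable(1) unfolding tor_def by (auto simp: A_stable pow_comm[symmetric]) blast
  show "j < r \<Longrightarrow> x \<in> tor J k n \<Longrightarrow> t j x \<in> tor J k (n + 1)" for j k n x
    using B_stable(2)[of j] unfolding tor_def by (auto simp: A_stable pow_comm) blast
  show "s \<in> S \<Longrightarrow> x \<in> tor J k n \<Longrightarrow> sc s x \<in> tor J k n" for s k n x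
    using B_stable(3)[of s] unfolding tor_def by (auto simp: A_stable pow_comm) blast
  show "x \<in> B \<Longrightarrow> x \<in> tor J k n" for x k n
    unfolding tor_def by (auto simp: B_A intro!: exI[of _ 0])
  show "x \<in> tor J k n \<Longrightarrow> d (d x) \<in> B" for x k n
    unfolding tor_def using dd by auto
qed (auto simp: add_d add_t add_sc comm B_sub B_stable tor_sub[OF J])

end

section \<open>Mapping cones\<close>

text \<open>Pairs are interleaved into one sequence: the mapping cone of a complex then lives in the type of
  the complex itself, and the induction on the number of operators can iterate the construction.\<close>

definition lft :: "(nat \<Rightarrow> 'c) \<Rightarrow> nat \<Rightarrow> 'c" where "lft w = (\<lambda>i. w (2 * i))"
definition rgt :: "(nat \<Rightarrow> 'c) \<Rightarrow> nat \<Rightarrow> 'c" where "rgt w = (\<lambda>i. w (2 * i + 1))"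
definition jn :: "(nat \<Rightarrow> 'c) \<Rightarrow> (nat \<Rightarrow> 'c) \<Rightarrow> nat \<Rightarrow> 'c" where
  "jn u v = (\<lambda>i. if even i then u (i div 2) else v (i div 2))"

lemma lft_jn [simp]: "lft (jn u v) = u" and rgt_jn [simp]: "rgt (jn u v) = v"
  by (auto simp: lft_def rgt_def jn_def)

lemma jn_eqI:
  assumes "lft w = lft w'" "rgt w = rgt w'"
  shows "w = w'"
proof
  fix i
  have "w (2 * (i div 2)) = w' (2 * (i div 2))" "w (2 * (i div 2) + 1) = w' (2 * (i div 2) + 1)"
    using assms unfolding lft_def rgt_def fun_eq_iff by blast+
  then show "w i = w' i"
    by (cases "even i") auto
qed

lemma lft_simps [simp]:
  fixes w w' :: "nat \<Rightarrow> 'c::ab_group_add"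
  shows "lft (w - w') = lft w - lft w'" "lft 0 = (0 :: nat \<Rightarrow> 'c)" "rgt (w - w') = rgt w - rgt w'" "rgt 0 = (0 :: nat \<Rightarrow> 'c)"
    "lft (w + w') = lft w + lft w'" "rgt (w + w') = rgt w + rgt w'"
  by (auto simp: lft_def rgt_def fun_eq_iff)

definition pairwise_op :: "((nat \<Rightarrow> 'c) \<Rightarrow> nat \<Rightarrow> 'c) \<Rightarrow> (nat \<Rightarrow> 'c) \<Rightarrow> nat \<Rightarrow> 'c" where
  "pairwise_op g w = jn (g (lft w)) (g (rgt w))"

text \<open>The mapping cone of \<open>f\<close>: a pair \<open>(u, v)\<close> goes to
  \<open>(d u, f u - d v)\<close>. Modulo the base subgroup its square vanishes because
  \<open>f\<close> commutes with \<open>d\<close>.\<close>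

definition cone_d :: "((nat \<Rightarrow> 'c::ab_group_add) \<Rightarrow> nat \<Rightarrow> 'c) \<Rightarrow> ((nat \<Rightarrow> 'c) \<Rightarrow> nat \<Rightarrow> 'c) \<Rightarrow> (nat \<Rightarrow> 'c) \<Rightarrow> nat \<Rightarrow> 'c" where
  "cone_d d f w = jn (d (lft w)) (f (lft w) - d (rgt w))"

definition cone_B :: "(nat \<Rightarrow> 'c) set \<Rightarrow> (nat \<Rightarrow> 'c) set" where
  "cone_B B = {w. lft w \<in> B \<and> rgt w \<in> B}"

text \<open>The second entry has cohomological degree lower by one, as usual for cones up to a
  shift, and internal degree higher by one, since the operator is a map from X to X(1).\<close>

definition cone_A :: "(int \<Rightarrow> int \<Rightarrow> (nat \<Rightarrow> 'c) set) \<Rightarrow> int \<Rightarrow> int \<Rightarrow> (nat \<Rightarrow> 'c) set" where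
  "cone_A A k n = {w. lft w \<in> A k n \<and> rgt w \<in> A (k - 1) (n + 1)}"

lemma pairwise_op_proj [simp]: "lft (pairwise_op g w) = g (lft w)" "rgt (pairwise_op g w) = g (rgt w)"
  by (auto simp: pairwise_op_def)

lemma cone_d_proj [simp]: "lft (cone_d d f w) = d (lft w)" "rgt (cone_d d f w) = f (lft w) - d (rgt w)"
  by (auto simp: cone_d_def)

lemma pairwise_op_pow [simp]: "lft ((pairwise_op g ^^ m) w) = (g ^^ m) (lft w)" "rgt ((pairwise_op g ^^ m) w) = (g ^^ m) (rgt w)"
  by (induction m) auto

lemma addv_pairwise_op: "addv g \<Longrightarrow> addv (pairwise_op g)"
  unfolding addv_def by (intro allI, rule jn_eqI) auto

lemma diff_diff_swap: "(a - b) - (c - e) = (a - c) - (b - (e :: 'b::ab_group_add))"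
  by (simp add: algebra_simps)

lemma cone_complex:
  fixes d :: "(nat \<Rightarrow> 'c::ab_group_add) \<Rightarrow> nat \<Rightarrow> 'c"
  assumes "graded_complex d r t sc S B A" "j < r"
  shows "graded_complex (cone_d d (t j)) r (\<lambda>i. pairwise_op (t i)) (\<lambda>s. pairwise_op (sc s)) S (cone_B B) (cone_A A)"
proof -
  interpret graded_complex d r t sc S B A by fact
  show ?thesis
  proof
    show "addv (cone_d d (t j))"
      unfolding addv_def by (intro allI, rule jn_eqI) (simp_all only: cone_d_proj lft_simps ops_simps diff_diff_swap)
    show "cone_d d (t j) (pairwise_op (t i) x) = pairwise_op (t i) (cone_d d (t j) x)" for i x
      by (rule jn_eqI) (auto simp: ops_simps)
    show "cone_d d (t j) (pairwise_op (sc i) x) = pairwise_op (sc i) (cone_d d (t j) x)" for i x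
      by (rule jn_eqI) (auto simp: ops_simps)
    show "pairwise_op (t i) (pairwise_op (t i') x) = pairwise_op (t i') (pairwise_op (t i) x)" for i i' x
      by (rule jn_eqI) (simp_all only: pairwise_op_proj comm(3)[of i i'])
    show "pairwise_op (t i) (pairwise_op (sc i') x) = pairwise_op (sc i') (pairwise_op (t i) x)" for i i' x
      by (rule jn_eqI) (auto simp: ops_simps)
    show "subgp (cone_B B)" "subgp (cone_A A k n)" for k n
      using B_sub A_sub unfolding cone_B_def cone_A_def subgp_def by auto
    show "x \<in> cone_A A k n \<Longrightarrow> cone_d d (t j) x \<in> cone_A A (k + 1) n" for k n x
      using A_stable(1)[of "rgt x" "k - 1" "n + 1"] A_stable(1)[of "lft x" k n] A_stable(2)[OF assms(2), of "lft x" k n]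
      by (auto simp: cone_A_def intro!: subgp_diff[OF A_sub])
    show "x \<in> cone_A A k n \<Longrightarrow> cone_d d (t j) (cone_d d (t j) x) \<in> cone_B B" for k n x
    proof -
      assume x: "x \<in> cone_A A k n"
      have "t j (d (lft x)) - d (t j (lft x) - d (rgt x)) = d (d (rgt x))"
        by (simp add: ops_simps)
      then show ?thesis using dd x unfolding cone_A_def cone_B_def by auto
    qed
    show "i < r \<Longrightarrow> x \<in> cone_A A k n \<Longrightarrow> pairwise_op (t i) x \<in> cone_A A k (n + 1)" for i k n x
      using A_stable(2)[of i "rgt x" "k - 1" "n + 1"] A_stable(2)[of i "lft x" k n]
      by (auto simp: cone_A_def)
  qed (auto simp: cone_B_def cone_A_def addv_pairwise_op add_t add_sc B_A B_stable A_stable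
        intro!: subgp_diff[OF B_sub] B_stable(2)[OF assms(2)])
qed

section \<open>Noetherian cohomology with nilpotent operators\<close>

context graded_complex
begin

text \<open>The operators move degrees upwards only, so a chain in a single degree extends to a
  graded chain. Vanishing in large degrees holds because the Noetherian property bounds the degrees
  of the socle and nilpotence leads from any nonzero class to a nonzero socle element.\<close>

lemma degreewise_fin_if_noeth:
  assumes noeth: noeth and tors: "\<And>j k n x. j < r \<Longrightarrow> x \<in> A k n \<Longrightarrow> \<exists>m. (t j ^^ m) x \<in> B"
  shows degreewise_fin
  unfolding degreewise_fin_def
proof (intro allI conjI)
  fix k n
  show "acc_chain (stable_families (\<lambda>u::unit. u) 0 t sc S (\<lambda>_. bnd k n) (\<lambda>_. cyc k n))"
  proof (rule acc_chainI)
    fix N :: "nat \<Rightarrow> unit \<Rightarrow> 'b set"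
    assume N: "\<And>p. N p \<in> stable_families (\<lambda>u::unit. u) 0 t sc S (\<lambda>_. bnd k n) (\<lambda>_. cyc k n)"
      and mono: "\<And>p i. N p i \<subseteq> N (Suc p) i"
    note ND = stable_familiesD[OF N]
    \<comment> \<open>Zero below degree \<open>n\<close> and everything above it: this completes any
      \<open>S\<close>-submodule in degree \<open>n\<close> to a graded submodule stable under the
      operators.\<close>
    define N' where "N' p m = (if m < n then bnd k m else if m = n then N p () else cyc k m)" for p m
    have bN: "x \<in> N p u \<Longrightarrow> x \<in> cyc k n" for p u x using ND(3) by blast
    have "N' p \<in> stable_families (\<lambda>n. n + 1) r t sc S (bnd k) (cyc k)" for p
    proof (rule stable_familiesI)
      fix i j x assume "j < r" "x \<in> N' p i"
      moreover from this have "i < n \<Longrightarrow> t j x \<in> bnd k (i + 1)" unfolding N'_def by (auto simp: bnd_stable)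
      moreover from this have "i < n \<Longrightarrow> i + 1 = n \<Longrightarrow> t j x \<in> N p ()" using ND(2) by auto
      ultimately show "t j x \<in> N' p (i + 1)"
        unfolding N'_def using bN cyc_stable(1) by (auto split: if_splits)
    qed (auto simp: N'_def bnd_sub cyc_sub ND bnd_cyc bnd_stable cyc_stable dest: bN split: if_splits)
    moreover have "N' p i \<subseteq> N' (Suc p) i" for p i
      unfolding N'_def using mono by auto
    ultimately obtain q where q: "\<And>p i. p \<ge> q \<Longrightarrow> N' p i \<subseteq> N' q i"
      using acc_chainD noeth unfolding noeth_def by metis
    have "N p i \<subseteq> N q i" if "p \<ge> q" for p i
      using q[OF that, of n] unfolding N'_def by simp
    then show "\<exists>q. \<forall>p\<ge>q. \<forall>i. N p i \<subseteq> N q i" by blast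
  qed
next
  fix k
  \<comment> \<open>All operators vanish on the socle, so its part in degrees up to p is a submodule; hence the socle is
    zero in large degrees, and every nonzero class has a nonzero multiple in the socle.\<close>
  define soc where "soc n = {x \<in> cyc k n. \<forall>j<r. t j x \<in> bnd k (n + 1)}" for n
  define N where "N p n = (if n \<le> int p then soc n else bnd k n)" for p n
  have soc_sub: "subgp (soc n)" for n
    using cyc_sub[of k n] bnd_sub[of k "n + 1"] unfolding subgp_def soc_def by (auto simp: ops_simps)
  have bnd_soc: "x \<in> bnd k n \<Longrightarrow> x \<in> soc n" for x n
    unfolding soc_def by (auto simp: bnd_cyc bnd_stable)
  have soc_sc: "s \<in> S \<Longrightarrow> x \<in> soc n \<Longrightarrow> sc s x \<in> soc n" for s x n
    unfolding soc_def by (auto simp: cyc_stable ops_simps bnd_stable)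
  have "N p \<in> stable_families (\<lambda>n. n + 1) r t sc S (bnd k) (cyc k)" for p
  proof (rule stable_familiesI)
    fix i j x assume "j < r" "x \<in> N p i"
    then have "t j x \<in> bnd k (i + 1)"
      unfolding N_def soc_def by (auto simp: bnd_stable split: if_splits)
    then show "t j x \<in> N p (i + 1)" unfolding N_def using bnd_soc by auto
  next
    fix i x assume "x \<in> N p i" then show "x \<in> cyc k i"
      unfolding N_def soc_def by (auto simp: bnd_cyc split: if_splits)
  qed (auto simp: N_def soc_sub bnd_sub bnd_soc soc_sc bnd_stable)
  moreover have "N p i \<subseteq> N (Suc p) i" for p i
    unfolding N_def using bnd_soc by auto
  ultimately obtain q where q: "\<And>p i. p \<ge> q \<Longrightarrow> N p i \<subseteq> N q i"
    using acc_chainD noeth unfolding noeth_def by metis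
  have soc0: "soc n \<subseteq> bnd k n" if "n > int q" for n
    using q[of "nat n" n] that unfolding N_def by auto
  \<comment> \<open>\<open>J\<close> counts the operators that may still act nontrivially on the
    class; for \<open>J = 0\<close> the class lies in the socle. Multiplying by operators only
    raises the degree, so the bound \<open>int q\<close> stays in force.\<close>
  have kill: "x \<in> bnd k n" if "x \<in> cyc k n" "n > int q" "J \<le> r" "\<forall>j. J \<le> j \<longrightarrow> j < r \<longrightarrow> t j x \<in> bnd k (n + 1)" for J n x
    using that
  proof (induction J arbitrary: n x)
    case 0
    then show ?case using soc0[of n] unfolding soc_def by auto
  next
    case (Suc J)
    have J: "J < r" using Suc by auto
    have tm: "(t J ^^ m) x \<in> cyc k (n + int m)" for m
    proof (induction m)
      case 0 then show ?case using Suc.prems(1) by simp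
    next
      case (Suc m)
      then show ?case using cyc_stable(1)[OF J Suc] by (simp add: algebra_simps)
    qed
    have tb: "t j ((t J ^^ m) x) \<in> bnd k (n + int m + 1)" if "Suc J \<le> j" "j < r" for m j
    proof (induction m)
      case 0 then show ?case using Suc.prems that by auto
    next
      case (Suc m)
      then show ?case
        using bnd_stable(1)[OF J Suc] by (simp add: comm(3)[of j J] algebra_simps)
    qed
    show ?case
    proof (rule ccontr)
      assume x: "x \<notin> bnd k n"
      \<comment> \<open>By nilpotence some power of \<open>t J\<close> maps the class of
        \<open>x\<close> to zero. The last nonzero multiple is killed by \<open>t J\<close>, and by
        the operators beyond \<open>J\<close> because these commute with \<open>t J\<close>.\<close>
      define P where "P m \<longleftrightarrow> (t J ^^ m) x \<in> bnd k (n + int m)" for m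
      obtain m0 where "(t J ^^ m0) x \<in> B" using tors[OF J] Suc.prems(1) unfolding cyc_def by blast
      then have "P m0" unfolding P_def by (rule B_bnd)
      moreover have "\<not> P 0" using x unfolding P_def by simp
      ultimately obtain m where m: "\<not> P m" "P (Suc m)"
        using inc_induct[of 0 m0 "\<lambda>m. P m"] by blast
      have "t j ((t J ^^ m) x) \<in> bnd k (n + int m + 1)" if "J \<le> j" "j < r" for j
        using tb[of j m] m(2) that unfolding P_def
        by (cases "j = J") (auto simp: algebra_simps)
      then have "(t J ^^ m) x \<in> bnd k (n + int m)"
        using Suc.IH[OF tm[of m]] Suc.prems J by auto
      then show False using m unfolding P_def by simp
    qed
  qed
  have "cyc k n \<subseteq> bnd k n" if "n \<ge> int q + 1" for n
    using kill[of _ n r] that by auto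
  then show "\<exists>n0. \<forall>n\<ge>n0. cyc k n \<subseteq> bnd k n" by blast
qed

end

section \<open>Noetherian cohomology of cones and the descent from them\<close>

lemma fold_zero_fun [simp]: "(\<lambda>_. 0) = (0 :: 'i \<Rightarrow> 'c::zero)"
  by (simp add: zero_fun_def)

lemma in_cone_A: "w \<in> cone_A A k n \<longleftrightarrow> lft w \<in> A k n \<and> rgt w \<in> A (k - 1) (n + 1)"
  by (simp add: cone_A_def)

lemma in_cone_B: "w \<in> cone_B B \<longleftrightarrow> lft w \<in> B \<and> rgt w \<in> B"
  by (simp add: cone_B_def)

text \<open>Needed because the second entries of a cone sit one internal degree higher; a chain
  condition does not depend on the numbering of the degrees.\<close>

lemma acc_chain_shift:
  assumes acc: "acc_chain (stable_families (\<lambda>n. n + 1) r t sc S I Z)"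
  shows "acc_chain (stable_families (\<lambda>n. n + 1) r t sc S (\<lambda>n. I (n + 1)) (\<lambda>n :: int. Z (n + 1)))"
proof (rule acc_chainI)
  fix N :: "nat \<Rightarrow> int \<Rightarrow> 'a set"
  assume N: "\<And>p. N p \<in> stable_families (\<lambda>n. n + 1) r t sc S (\<lambda>n. I (n + 1)) (\<lambda>n. Z (n + 1))"
    and mono: "\<And>p i. N p i \<subseteq> N (Suc p) i"
  note ND = stable_familiesD[OF N]
  have "(\<lambda>n. N p (n - 1)) \<in> stable_families (\<lambda>n. n + 1) r t sc S I Z" for p
  proof (rule stable_familiesI)
    show "x \<in> I i \<Longrightarrow> x \<in> N p (i - 1)" for i x using ND(2)[where i = "i - 1"] by simp
    show "x \<in> N p (i - 1) \<Longrightarrow> x \<in> Z i" for i x using ND(3)[where i = "i - 1"] by simp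
    show "j < r \<Longrightarrow> x \<in> N p (i - 1) \<Longrightarrow> t j x \<in> N p (i + 1 - 1)" for i j x using ND(5)[where i = "i - 1"] by simp
  qed (use ND(1,4) in auto)
  moreover have "N p (i - 1) \<subseteq> N (Suc p) (i - 1)" for p i
    using mono by blast
  ultimately obtain q where q: "\<And>p i. p \<ge> q \<Longrightarrow> N p (i - 1) \<subseteq> N q (i - 1)"
    using acc_chainD[OF acc, of "\<lambda>p n. N p (n - 1)"] by metis
  have "N p i \<subseteq> N q i" if "p \<ge> q" for p i
    using q[OF that, of "i + 1"] by simp
  then show "\<exists>q. \<forall>p\<ge>q. \<forall>i. N p i \<subseteq> N q i" by blast
qed

text \<open>The exact sequence with zero as its left-hand term: a subquotient that embeds into a
  Noetherian one is Noetherian.\<close>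

lemma acc_chain_inj:
  fixes I'' Z'' :: "'i \<Rightarrow> 'b::ab_group_add set"
  assumes acc: "acc_chain (stable_families sh r t sc S I'' Z'')"
    and add: "\<And>j. addv (t j)" "\<And>s. addv (sc s)"
    and I''_sub: "\<And>i. subgp (I'' i)" and Z''_sub: "\<And>i. subgp (Z'' i)" and I_sub: "\<And>i. subgp (I i)"
    and I''_stable: "\<And>i s x. s \<in> S \<Longrightarrow> x \<in> I'' i \<Longrightarrow> sc s x \<in> I'' i" "\<And>i j x. j < r \<Longrightarrow> x \<in> I'' i \<Longrightarrow> t j x \<in> I'' (sh i)"
    and psi: "\<And>i x. x \<in> Z i \<Longrightarrow> x \<in> Z'' i" "\<And>i x. x \<in> I'' i \<Longrightarrow> x \<in> Z'' i"
    and exact: "\<And>i x. x \<in> Z i \<Longrightarrow> x \<in> I'' i \<Longrightarrow> x \<in> I i"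
  shows "acc_chain (stable_families sh r t sc S I Z)"
proof (rule acc_chain_exact[where \<phi> = "\<lambda>x. x" and \<psi> = "\<lambda>x. x" and I' = "\<lambda>_. {0}" and Z' = "\<lambda>_. {0}"
      and t' = t and sc' = sc,
      OF acc_chain_trivial acc])
  show "\<exists>y\<in>{0}. x - y \<in> I i" if "x \<in> Z i" "x \<in> I'' i" for x i
    using exact[OF that] by simp
  show "t j x \<in> {0}" if "x \<in> {0}" for j x using that addv_zero[OF add(1)] by simp
  show "sc s x \<in> {0}" if "x \<in> {0}" for s x using that addv_zero[OF add(2)] by simp
  show "addv (\<lambda>x :: 'b. x)" by (simp add: addv_def)
  show "subgp {0 :: 'b}" by (simp add: subgp_def)
  show "x \<in> I i" if "x \<in> {0}" for x i using that subgp_zero[OF I_sub] by simp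
  show "addv (\<lambda>x :: 'b. x)" by (simp add: addv_def)
qed (auto simp: assms(2-10))

text \<open>A piece of the long exact sequence of the cone, H^(k-1)(X)(1) -> H^k(cone) -> H^k(X),
  where \<open>v\<close> goes to \<open>(0, v)\<close> and \<open>(u, v)\<close> to
  \<open>u\<close>, places the cohomology of the cone between two Noetherian modules.\<close>

lemma noeth_cone:
  fixes d :: "(nat \<Rightarrow> 'c::ab_group_add) \<Rightarrow> nat \<Rightarrow> 'c"
  assumes X: "graded_complex d r t sc S B A" and j: "j < r"
    and noeth: "graded_complex.noeth d r t sc S B A"
  shows "graded_complex.noeth (cone_d d (t j)) r (\<lambda>i. pairwise_op (t i)) (\<lambda>s. pairwise_op (sc s)) S (cone_B B) (cone_A A)"
proof -
  interpret graded_complex d r t sc S B A by fact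
  interpret C: graded_complex "cone_d d (t j)" r "\<lambda>i. pairwise_op (t i)" "\<lambda>s. pairwise_op (sc s)" S "cone_B B" "cone_A A"
    by (rule cone_complex[OF X j])
  have acc: "acc_chain (stable_families (\<lambda>n. n + 1) r t sc S (bnd k) (cyc k))" for k
    using noeth unfolding noeth_def by blast
  have "acc_chain (stable_families (\<lambda>n. n + 1) r (\<lambda>i. pairwise_op (t i)) (\<lambda>s. pairwise_op (sc s)) S (C.bnd k) (C.cyc k))" for k
  proof (rule acc_chain_exact[where \<phi> = "jn 0" and \<psi> = lft, OF acc_chain_shift[OF acc[of "k - 1"]] acc[of k]])
    show "addv (jn (0 :: nat \<Rightarrow> 'c))"
      unfolding addv_def by (intro allI, rule jn_eqI) auto
    show "jn 0 (sc s x) = pairwise_op (sc s) (jn 0 x)" for s x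
      by (rule jn_eqI) (simp_all add: addv_zero[OF add_sc] zero_fun_def[symmetric])
    show "jn 0 (t i x) = pairwise_op (t i) (jn 0 x)" for i x
      by (rule jn_eqI) (simp_all only: lft_jn rgt_jn pairwise_op_proj addv_zero[OF add_t])
    show "addv (lft :: (nat \<Rightarrow> 'c) \<Rightarrow> _)" by (simp add: addv_def)
    show "jn 0 x \<in> C.bnd k i" if x: "x \<in> bnd (k - 1) (i + 1)" for i x
    proof -
      obtain y where y: "y \<in> A (k - 1 - 1) (i + 1)" "x - d y \<in> B" using x by (rule bndE)
      show ?thesis
        \<comment> \<open>The sign compensates for the one in front of \<open>d\<close> in the
          second entry of \<open>cone_d\<close>.\<close>
        by (rule C.bndI'[of "jn 0 (- y)"])
          (use y subgp_minus[OF A_sub y(1)] subgp_zero[OF A_sub] subgp_zero[OF B_sub] in \<open>auto simp: in_cone_A in_cone_B ops_simps\<close>)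
    qed
    show "lft x \<in> cyc k i" if "x \<in> C.cyc k i" for i x
      using that unfolding C.cyc_def cyc_def in_cone_A in_cone_B by auto
    show "\<exists>y\<in>cyc (k - 1) (i + 1). x - jn 0 y \<in> C.bnd k i" if x: "x \<in> C.cyc k i" "lft x \<in> bnd k i" for i x
    proof -
      obtain y where y: "y \<in> A (k - 1) i" "lft x - d y \<in> B" using x(2) by (rule bndE)
      have x': "rgt x \<in> A (k - 1) (i + 1)" "t j (lft x) - d (rgt x) \<in> B"
        using x(1) unfolding C.cyc_def in_cone_A in_cone_B by auto
      \<comment> \<open>Subtracting the differential of \<open>(y, 0)\<close> turns the cocycle
        \<open>x\<close> into \<open>(0, v)\<close> modulo the base subgroup.\<close>
      define v where "v = rgt x - t j y"
      have "d v = (t j (lft x - d y)) - (t j (lft x) - d (rgt x))"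
        unfolding v_def by (simp add: ops_simps)
      then have "v \<in> cyc (k - 1) (i + 1)"
        unfolding cyc_def using x' subgp_diff[OF A_sub x'(1) A_stable(2)[OF j y(1)]]
          subgp_diff[OF B_sub B_stable(2)[OF j y(2)] x'(2)]
        by (simp add: v_def)
      moreover have "x - jn 0 v \<in> C.bnd k i"
        by (rule C.bndI'[of "jn y 0"])
          (use y subgp_zero[OF A_sub] subgp_zero[OF B_sub] in \<open>auto simp: v_def in_cone_A in_cone_B ops_simps\<close>)
      ultimately show ?thesis by blast
    qed
    show "j' < r \<Longrightarrow> x \<in> cyc (k - 1) (i + 1) \<Longrightarrow> t j' x \<in> cyc (k - 1) (i + 1 + 1)" for j' i x
      by (rule cyc_stable)
  qed (auto simp: add_t add_sc cyc_sub bnd_sub cyc_stable bnd_stable bnd_cyc)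
  then show ?thesis unfolding C.noeth_def by blast
qed

text \<open>On the quotient by the \<open>t j\<close>-torsion, \<open>t j\<close> is injective, and
  surjective by \<open>div\<close>; the cone of this quotient is acyclic. Hence the cone over the
  torsion subcomplex has its cohomology embedded in that of the whole cone, and this embedding is
  what the proof verifies.\<close>

lemma noeth_cone_tor:
  fixes d :: "(nat \<Rightarrow> 'c::ab_group_add) \<Rightarrow> nat \<Rightarrow> 'c"
  assumes X: "graded_complex d r t sc S B A" and j: "j < r"
    and div: "\<And>k n x. x \<in> A k n \<Longrightarrow> \<exists>y\<in>A k (n - 1). \<exists>m. (t j ^^ m) (x - t j y) \<in> B"
    and noeth: "graded_complex.noeth (cone_d d (t j)) r (\<lambda>i. pairwise_op (t i)) (\<lambda>s. pairwise_op (sc s)) S (cone_B B) (cone_A A)"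
  shows "graded_complex.noeth (cone_d d (t j)) r (\<lambda>i. pairwise_op (t i)) (\<lambda>s. pairwise_op (sc s)) S (cone_B B)
    (cone_A (graded_complex.tor t B A {j}))"
proof -
  interpret graded_complex d r t sc S B A by fact
  interpret C: graded_complex "cone_d d (t j)" r "\<lambda>i. pairwise_op (t i)" "\<lambda>s. pairwise_op (sc s)" S "cone_B B" "cone_A A"
    by (rule cone_complex[OF X j])
  have "{j} \<subseteq> {..<r}" using j by simp
  note T' = tor_complex[OF this]
  interpret T: graded_complex d r t sc S B "tor {j}" by (rule T')
  interpret D: graded_complex "cone_d d (t j)" r "\<lambda>i. pairwise_op (t i)" "\<lambda>s. pairwise_op (sc s)" S "cone_B B" "cone_A (tor {j})"
    by (rule cone_complex[OF T' j])
  have tor_A: "x \<in> tor {j} k n \<Longrightarrow> x \<in> A k n" for x k n unfolding tor_def by auto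
  \<comment> \<open>The quotient by the torsion is torsion-free: one more factor \<open>t j\<close>
    is absorbed in the exponent.\<close>
  have tor_tj: "x \<in> tor {j} k n" if "t j x \<in> tor {j} k' n'" "x \<in> A k n" for x k n k' n'
  proof -
    from that obtain m where "(t j ^^ m) (t j x) \<in> B" unfolding tor_def by auto
    then have "(t j ^^ Suc m) x \<in> B" by (simp add: funpow_Suc_right del: funpow.simps)
    then show ?thesis using that(2) unfolding tor_def by blast
  qed
  have "acc_chain (stable_families (\<lambda>n. n + 1) r (\<lambda>i. pairwise_op (t i)) (\<lambda>s. pairwise_op (sc s)) S (D.bnd k) (D.cyc k))" for k
  proof (rule acc_chain_inj)
    show "acc_chain (stable_families (\<lambda>n. n + 1) r (\<lambda>i. pairwise_op (t i)) (\<lambda>s. pairwise_op (sc s)) S (C.bnd k) (C.cyc k))"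
      using noeth unfolding C.noeth_def by blast
    show "x \<in> C.cyc k i" if "x \<in> D.cyc k i" for x i
      using that tor_A unfolding C.cyc_def D.cyc_def in_cone_A by auto
    show "w \<in> D.bnd k i" if w: "w \<in> D.cyc k i" "w \<in> C.bnd k i" for w i
    proof -
      obtain w' where w': "w' \<in> cone_A A (k - 1) i" "w - cone_d d (t j) w' \<in> cone_B B"
        using w(2) by (rule C.bndE)
      define u v where "u = lft w'" "v = rgt w'"
      have uv: "u \<in> A (k - 1) i" "v \<in> A (k - 2) (i + 1)" "lft w - d u \<in> B" "rgt w - (t j u - d v) \<in> B"
        using w' unfolding u_v_def in_cone_A in_cone_B by auto
      \<comment> \<open>Subtracting the differential of \<open>(y, 0)\<close> from \<open>(u, v)\<close> makes the second entry, and then also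
        the first one, torsion.\<close>
      obtain y m where y: "y \<in> A (k - 2) i" "(t j ^^ m) (v - t j y) \<in> B"
        using div[OF uv(2)] by auto
      define v1 u1 where "v1 = v - t j y" "u1 = u - d y"
      have v1: "v1 \<in> tor {j} (k - 2) (i + 1)"
        using y uv subgp_diff[OF A_sub uv(2) A_stable(2)[OF j y(1)]] unfolding tor_def v1_u1_def by auto
      have u1A: "u1 \<in> A (k - 1) i"
        using subgp_diff[OF A_sub uv(1)] A_stable(1)[OF y(1)] unfolding v1_u1_def by simp
      have e1: "rgt w - (t j u1 - d v1) = rgt w - (t j u - d v)"
        unfolding v1_u1_def by (simp add: ops_simps)
      have e2: "lft w - d u1 = (lft w - d u) + d (d y)"
        unfolding v1_u1_def by (simp add: ops_simps)
      have b1: "rgt w - (t j u1 - d v1) \<in> B" unfolding e1 by (rule uv(4))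
      have b2: "lft w - d u1 \<in> B"
        unfolding e2 using subgp_add[OF B_sub uv(3) dd[OF y(1)]] .
      have wr: "rgt w \<in> tor {j} (k - 1) (i + 1)"
        using w(1) unfolding D.cyc_def in_cone_A by auto
      have dv1: "d v1 \<in> tor {j} (k - 1) (i + 1)"
        using T.A_stable(1)[OF v1] by simp
      \<comment> \<open>All terms on the right are torsion by now, the last one because it lies in
        \<open>B\<close>; so \<open>u1\<close> is torsion by \<open>tor_tj\<close>.\<close>
      have "t j u1 = rgt w + d v1 - (rgt w - (t j u1 - d v1))" by simp
      also have "\<dots> \<in> tor {j} (k - 1) (i + 1)"
        by (intro subgp_diff[OF T.A_sub] subgp_add[OF T.A_sub] wr dv1 T.B_A b1)
      finally have "u1 \<in> tor {j} (k - 1) i" using tor_tj u1A by blast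
      then show ?thesis
        by (intro D.bndI'[of "jn u1 v1"]) (use v1 b1 b2 in \<open>auto simp: in_cone_A in_cone_B\<close>)
    qed
  qed (auto simp: C.add_t C.add_sc D.bnd_sub C.bnd_sub C.cyc_sub C.bnd_stable C.bnd_cyc)
  then show ?thesis unfolding D.noeth_def by blast
qed

text \<open>The kernel of \<open>t j\<close> on H(X) is the image of H(cone). Where the cone has no
  cohomology, the nilpotent \<open>t j\<close> is thus injective and H(X) vanishes. In lower degrees
  H(X)_n is an extension of a submodule of H(X)_(n+1) by a quotient of H(cone)_n.\<close>

lemma degreewise_fin_descend:
  fixes d :: "(nat \<Rightarrow> 'c::ab_group_add) \<Rightarrow> nat \<Rightarrow> 'c"
  assumes X: "graded_complex d r t sc S B A" and j: "j < r"
    and tors: "\<And>k n x. x \<in> A k n \<Longrightarrow> \<exists>m. (t j ^^ m) x \<in> B"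
    and fin: "graded_complex.degreewise_fin (cone_d d (t j)) (\<lambda>i. pairwise_op (t i)) (\<lambda>s. pairwise_op (sc s)) S (cone_B B) (cone_A A)"
  shows "graded_complex.degreewise_fin d t sc S B A"
proof -
  interpret graded_complex d r t sc S B A by fact
  interpret C: graded_complex "cone_d d (t j)" r "\<lambda>i. pairwise_op (t i)" "\<lambda>s. pairwise_op (sc s)" S "cone_B B" "cone_A A"
    by (rule cone_complex[OF X j])
  \<comment> \<open>Pairing \<open>x\<close> with a witness that \<open>t j x\<close> is a
    coboundary gives a cocycle of the cone.\<close>
  have lift: "\<exists>w\<in>C.cyc k n. lft w = x" if x: "x \<in> cyc k n" "t j x \<in> bnd k (n + 1)" for k n x
  proof -
    obtain y where "y \<in> A (k - 1) (n + 1)" "t j x - d y \<in> B" using x(2) by (rule bndE)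
    then have "jn x y \<in> C.cyc k n"
      using x(1) unfolding C.cyc_def cyc_def in_cone_A in_cone_B by auto
    then show ?thesis by (metis lft_jn)
  qed
  have proj: "lft w \<in> cyc k n" if "w \<in> C.cyc k n" for w k n
    using that unfolding C.cyc_def cyc_def in_cone_A in_cone_B by auto
  have projb: "lft w \<in> bnd k n" if w: "w \<in> C.bnd k n" for w k n
  proof -
    obtain y where "y \<in> cone_A A (k - 1) n" "w - cone_d d (t j) y \<in> cone_B B" using w by (rule C.bndE)
    then show ?thesis by (intro bndI'[of "lft y"]) (auto simp: in_cone_A in_cone_B)
  qed
  show ?thesis unfolding degreewise_fin_def
  proof
    fix k
    obtain n0 where n0: "\<And>n. n \<ge> n0 \<Longrightarrow> C.cyc k n \<subseteq> C.bnd k n"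
      using fin unfolding C.degreewise_fin_def by blast
    \<comment> \<open>From degree \<open>n0\<close> on, \<open>t j\<close> is injective on
      cohomology, while some power of it kills \<open>x\<close>.\<close>
    have kill: "(t j ^^ m) x \<in> B \<Longrightarrow> x \<in> cyc k n \<Longrightarrow> n \<ge> n0 \<Longrightarrow> x \<in> bnd k n" for m x n
    proof (induction m arbitrary: x n)
      case 0 then show ?case using B_bnd by simp
    next
      case (Suc m)
      have "t j x \<in> bnd k (n + 1)"
        using Suc.IH[of "t j x" "n + 1"] Suc.prems cyc_stable(1)[OF j]
        by (simp add: funpow_Suc_right del: funpow.simps)
      then show ?case using lift[OF Suc.prems(2)] n0[OF Suc.prems(3)] projb by blast
    qed
    have van: "cyc k n \<subseteq> bnd k n" if "n \<ge> n0" for n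
      using kill that tors unfolding cyc_def by blast
    have acc: "acc_chain (stable_families (\<lambda>u::unit. u) 0 t sc S (\<lambda>_. bnd k n) (\<lambda>_. cyc k n))" if "n \<le> n0" for n
      using that
    proof (induction rule: int_le_induct)
      case base show ?case by (rule acc_chain_trivial) (use van in auto)
    next
      case (step n)
      have accC: "acc_chain (stable_families (\<lambda>u::unit. u) 0 (\<lambda>i. pairwise_op (t i)) (\<lambda>s. pairwise_op (sc s)) S
         (\<lambda>_. C.bnd k (n - 1)) (\<lambda>_. C.cyc k (n - 1)))"
        using fin unfolding C.degreewise_fin_def by blast
      show ?case
      \<comment> \<open>Here \<open>t j\<close> leads from degree \<open>n - 1\<close> to degree
        \<open>n\<close>. The shift is invisible to \<open>acc_chain_exact\<close> because both
        degrees are treated as families over \<open>unit\<close>.\<close>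
      proof (rule acc_chain_exact[where \<phi> = lft and \<psi> = "t j", OF accC step.IH])
        show "\<exists>w\<in>C.cyc k (n - 1). x - lft w \<in> bnd k (n - 1)" if "x \<in> cyc k (n - 1)" "t j x \<in> bnd k n" for x
        proof -
          obtain w where "w \<in> C.cyc k (n - 1)" "lft w = x" using lift[of x k "n - 1"] \<open>x \<in> cyc k (n - 1)\<close> \<open>t j x \<in> bnd k n\<close> by auto
          then show ?thesis using subgp_zero[OF bnd_sub] by (intro bexI[of _ w]) auto
        qed
        show "t j x \<in> cyc k n" if "x \<in> cyc k (n - 1)" for x
          using cyc_stable(1)[OF j that] by simp
      qed (auto simp: add_t add_sc cyc_sub bnd_sub cyc_stable bnd_stable bnd_cyc ops_simps proj projb
            C.cyc_sub C.cyc_stable C.bnd_cyc addv_def[of lft])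
    qed
    have "acc_chain (stable_families (\<lambda>u::unit. u) 0 t sc S (\<lambda>_. bnd k n) (\<lambda>_. cyc k n))" for n
    proof (cases "n \<le> n0")
      case False show ?thesis by (rule acc_chain_trivial) (use van[of n] False in auto)
    qed (rule acc)
    then show "(\<exists>n0. \<forall>n\<ge>n0. cyc k n \<subseteq> bnd k n) \<and>
      (\<forall>n. acc_chain (stable_families (\<lambda>u::unit. u) 0 t sc S (\<lambda>_. bnd k n) (\<lambda>_. cyc k n)))"
      using van by blast
  qed
qed

section \<open>Induction on the number of operators\<close>

context graded_complex
begin

text \<open>The divisor \<open>y\<close> has to be torsion for the operators before \<open>i\<close>
  too: it must stay inside the subcomplex to which \<open>noeth_cone_tor\<close> is applied at stage
  \<open>i\<close>.\<close>

definition divisible :: "nat \<Rightarrow> bool" where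
  "divisible i \<longleftrightarrow> (\<forall>k n. \<forall>x\<in>tor {..<i} k n. \<exists>y\<in>tor {..<i} k (n - 1). \<exists>m. (t i ^^ m) (x - t i y) \<in> B)"

lemma tor_Suc: "graded_complex.tor t B (tor {..<j}) {j} = tor {..<Suc j}" if "j \<le> r"
proof -
  interpret T: graded_complex d r t sc S B "tor {..<j}"
    by (rule tor_complex) (use that in auto)
  show ?thesis
    by (intro ext) (auto simp: T.tor_def tor_def lessThan_Suc)
qed

end

text \<open>The larger of two exponents serves both entries. Since torsion commutes with cones, the
  next stage again concerns a torsion subcomplex of a full complex, and the induction can go
  on.\<close>

lemma tor_cone:
  fixes d :: "(nat \<Rightarrow> 'c::ab_group_add) \<Rightarrow> nat \<Rightarrow> 'c"
  assumes X: "graded_complex d r t sc S B A" and j: "j < r" and J: "J \<subseteq> {..<r}"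
  shows "graded_complex.tor (\<lambda>i. pairwise_op (t i)) (cone_B B) (cone_A A) J = cone_A (graded_complex.tor t B A J)"
proof (intro ext)
  interpret graded_complex d r t sc S B A by fact
  interpret C: graded_complex "cone_d d (t j)" r "\<lambda>i. pairwise_op (t i)" "\<lambda>s. pairwise_op (sc s)" S "cone_B B" "cone_A A"
    by (rule cone_complex[OF X j])
  fix k n
  have "(\<exists>m. (t i ^^ m) (lft x) \<in> B \<and> (t i ^^ m) (rgt x) \<in> B) \<longleftrightarrow> (\<exists>m. (t i ^^ m) (lft x) \<in> B) \<and> (\<exists>m. (t i ^^ m) (rgt x) \<in> B)"
    if "i \<in> J" for i x
    using pow_B_mono[of i] that J by (meson lessThan_iff max.cobounded1 max.cobounded2 subsetD)
  then show "C.tor J k n = cone_A (tor J) k n"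
    by (auto simp: C.tor_def tor_def in_cone_A in_cone_B)
qed

text \<open>Induction on the number of operators for which no cone has been taken. The complex
  varies with the stage: stage \<open>j\<close> for X calls the next stage for the cone of
  \<open>t j\<close> on X, and its result is brought back by \<open>degreewise_fin_descend\<close>.
  \<open>A\<close> remains the full complex; only the Noetherian assumption is about its
  torsion.\<close>

theorem degreewise_fin_tor:
  fixes d :: "(nat \<Rightarrow> 'c::ab_group_add) \<Rightarrow> nat \<Rightarrow> 'c"
  assumes X: "graded_complex d r t sc S B A" and j: "j \<le> r"
    and div: "\<And>i. j \<le> i \<Longrightarrow> i < r \<Longrightarrow> graded_complex.divisible t B A i"
    and noeth: "graded_complex.noeth d r t sc S B (graded_complex.tor t B A {..<j})"
  shows "graded_complex.degreewise_fin d t sc S B (graded_complex.tor t B A {..<r})"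
  using assms
proof (induction "r - j" arbitrary: j d t sc B A)
  case 0
  interpret graded_complex d r t sc S B A by fact
  interpret T: graded_complex d r t sc S B "tor {..<r}" by (rule tor_complex) auto
  show ?case
  proof (rule T.degreewise_fin_if_noeth)
    have "j = r" using 0 by simp
    with 0 show T.noeth by simp
    show "\<exists>m. (t j ^^ m) x \<in> B" if "j < r" "x \<in> tor {..<r} k n" for j k n x
      using that unfolding tor_def by auto
  qed
next
  case (Suc e)
  have j: "j < r" using Suc.hyps(2) by simp
  interpret graded_complex d r t sc S B A by fact
  note C = cone_complex[OF Suc.prems(1) j]
  interpret C: graded_complex "cone_d d (t j)" r "\<lambda>i. pairwise_op (t i)" "\<lambda>s. pairwise_op (sc s)" S "cone_B B" "cone_A A"
    by (rule C)
  have le: "{..<i} \<subseteq> {..<r}" if "i \<le> r" for i using that by auto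
  note Tj = tor_complex[OF le[OF less_imp_le[OF j]]]
  note Tr = tor_complex[OF le[OF order_refl]]
  have 1: "graded_complex.noeth (cone_d d (t j)) r (\<lambda>i. pairwise_op (t i)) (\<lambda>s. pairwise_op (sc s)) S (cone_B B) (cone_A (tor {..<j}))"
    by (rule noeth_cone[OF Tj j Suc.prems(4)])
  have 2: "\<exists>y\<in>tor {..<j} k (n - 1). \<exists>m. (t j ^^ m) (x - t j y) \<in> B" if "x \<in> tor {..<j} k n" for k n x
    using Suc.prems(3)[OF order_refl j] that unfolding divisible_def by blast
  have 3: "graded_complex.noeth (cone_d d (t j)) r (\<lambda>i. pairwise_op (t i)) (\<lambda>s. pairwise_op (sc s)) S (cone_B B) (C.tor {..<Suc j})"
    using noeth_cone_tor[OF Tj j 2 1] j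
    unfolding tor_Suc[OF less_imp_le[OF j]] tor_cone[OF Suc.prems(1) j le[OF Suc_leI[OF j]]] by blast
  \<comment> \<open>Operators act entrywise on a cone, so the two entries are divided separately and
    the larger exponent is used for both.\<close>
  have 4: "C.divisible i" if i: "Suc j \<le> i" "i < r" for i
    unfolding C.divisible_def tor_cone[OF Suc.prems(1) j le[OF less_imp_le[OF i(2)]]]
  proof (intro allI ballI)
    fix k n w assume "w \<in> cone_A (tor {..<i}) k n"
    then have w: "lft w \<in> tor {..<i} k n" "rgt w \<in> tor {..<i} (k - 1) (n + 1)" by (auto simp: in_cone_A)
    have D: "divisible i" using Suc.prems(3) i by auto
    obtain u m where u: "u \<in> tor {..<i} k (n - 1)" "(t i ^^ m) (lft w - t i u) \<in> B"
      using D w(1) unfolding divisible_def by blast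
    obtain v m' where v: "v \<in> tor {..<i} (k - 1) n" "(t i ^^ m') (rgt w - t i v) \<in> B"
      using D w(2) unfolding divisible_def by fastforce
    have "jn u v \<in> cone_A (tor {..<i}) k (n - 1)" using u v by (auto simp: in_cone_A)
    moreover have "(pairwise_op (t i) ^^ (max m m')) (w - pairwise_op (t i) (jn u v)) \<in> cone_B B"
      using pow_B_mono[OF i(2) u(2), of "max m m'"] pow_B_mono[OF i(2) v(2), of "max m m'"]
      by (auto simp: in_cone_B)
    ultimately show "\<exists>y\<in>cone_A (tor {..<i}) k (n - 1). \<exists>m. (pairwise_op (t i) ^^ m) (w - pairwise_op (t i) y) \<in> cone_B B"
      by blast
  qed
  have 5: "graded_complex.degreewise_fin (cone_d d (t j)) (\<lambda>i. pairwise_op (t i)) (\<lambda>s. pairwise_op (sc s)) S (cone_B B) (cone_A (tor {..<r}))"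
    using Suc.hyps(1)[OF _ C _ 4 3] Suc.hyps(2) j
    unfolding tor_cone[OF Suc.prems(1) j le[OF order_refl]] by fastforce
  show ?case
    by (rule degreewise_fin_descend[OF Tr j _ 5]) (use j in \<open>auto simp: tor_def\<close>)
qed

section \<open>Internal direct sums\<close>

locale graded_group = abelian_group G for G :: "('b, 'z) ring_scheme" (structure) +
  fixes \<G> :: "'i \<Rightarrow> 'b set"
  assumes direct_sum: "internal_direct_sum G \<G>"
begin

definition comp :: "'b \<Rightarrow> 'i \<Rightarrow> 'b" where
  "comp x = (THE c. (\<forall>n. c n \<in> \<G> n) \<and> finite {n. c n \<noteq> \<zero>} \<and> x = (\<Oplus> n \<in> {n. c n \<noteq> \<zero>}. c n))"

lemma piece_subgroup: "additive_subgroup (\<G> n) G"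
  using direct_sum by (auto simp: internal_direct_sum_def)

lemma piece_carrier: "x \<in> \<G> n \<Longrightarrow> x \<in> carrier G"
  by (rule additive_subgroup.a_Hcarr[OF piece_subgroup])

lemma piece_zero: "\<zero> \<in> \<G> n"
  by (rule additive_subgroup.zero_closed[OF piece_subgroup])

lemma piece_add: "x \<in> \<G> n \<Longrightarrow> y \<in> \<G> n \<Longrightarrow> x \<oplus> y \<in> \<G> n"
  by (rule additive_subgroup.a_closed[OF piece_subgroup])

lemma piece_inv: "x \<in> \<G> n \<Longrightarrow> \<ominus> x \<in> \<G> n"
  by (rule additive_subgroup.a_inv_closed[OF piece_subgroup])

lemma comp_props:
  assumes "x \<in> carrier G"
  shows "comp x n \<in> \<G> n" "finite {n. comp x n \<noteq> \<zero>}" "x = (\<Oplus> n \<in> {n. comp x n \<noteq> \<zero>}. comp x n)"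
proof -
  have "\<exists>!c. (\<forall>n. c n \<in> \<G> n) \<and> finite {n. c n \<noteq> \<zero>} \<and> x = (\<Oplus> n \<in> {n. c n \<noteq> \<zero>}. c n)"
    using direct_sum assms by (auto simp: internal_direct_sum_def)
  from theI'[OF this] show "comp x n \<in> \<G> n" "finite {n. comp x n \<noteq> \<zero>}" "x = (\<Oplus> n \<in> {n. comp x n \<noteq> \<zero>}. comp x n)"
    unfolding comp_def by blast+
qed

lemma comp_carrier: "x \<in> carrier G \<Longrightarrow> comp x n \<in> carrier G"
  using comp_props(1) piece_carrier by blast

lemma finsum_support:
  assumes "finite F" "\<And>n. c n \<in> carrier G" "{n. c n \<noteq> \<zero>} \<subseteq> F"
  shows "(\<Oplus> n \<in> {n. c n \<noteq> \<zero>}. c n) = (\<Oplus> n \<in> F. c n)"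
  by (rule add.finprod_mono_neutral_cong_left) (use assms in auto)

lemma comp_unique:
  assumes "finite F" "\<And>n. c n \<in> \<G> n" "{n. c n \<noteq> \<zero>} \<subseteq> F" "x = (\<Oplus> n \<in> F. c n)"
  shows "comp x = c"
proof -
  have c: "c n \<in> carrier G" for n using assms(2) piece_carrier by blast
  then have x: "x \<in> carrier G" using assms(4) by simp
  have "x = (\<Oplus> n \<in> {n. c n \<noteq> \<zero>}. c n)"
    using finsum_support[OF assms(1) c assms(3)] assms(4) by simp
  moreover have "finite {n. c n \<noteq> \<zero>}" using assms(1,3) finite_subset by blast
  moreover have "\<exists>!c. (\<forall>n. c n \<in> \<G> n) \<and> finite {n. c n \<noteq> \<zero>} \<and> x = (\<Oplus> n \<in> {n. c n \<noteq> \<zero>}. c n)"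
    using direct_sum x by (auto simp: internal_direct_sum_def)
  ultimately show ?thesis unfolding comp_def using assms(2) by (intro the1_equality) auto
qed

lemma expand:
  assumes "x \<in> carrier G" "finite F" "{n. comp x n \<noteq> \<zero>} \<subseteq> F"
  shows "x = (\<Oplus> n \<in> F. comp x n)"
  using finsum_support[OF assms(2) comp_carrier[OF assms(1)] assms(3)] comp_props(3)[OF assms(1)] by simp

lemma comp_homogeneous: "x \<in> \<G> m \<Longrightarrow> comp x = (\<lambda>n. if n = m then x else \<zero>)"
  by (rule comp_unique[of "{m}"]) (auto simp: piece_zero piece_carrier)

lemma comp_add:
  assumes "x \<in> carrier G" "y \<in> carrier G"
  shows "comp (x \<oplus> y) n = comp x n \<oplus> comp y n"
proof -
  define F where "F = {n. comp x n \<noteq> \<zero>} \<union> {n. comp y n \<noteq> \<zero>}"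
  have F: "finite F" unfolding F_def using comp_props(2) assms by auto
  have "comp (x \<oplus> y) = (\<lambda>n. comp x n \<oplus> comp y n)"
  proof (rule comp_unique[OF F])
    show "{n. comp x n \<oplus> comp y n \<noteq> \<zero>} \<subseteq> F" unfolding F_def by auto
    have "x = (\<Oplus> n \<in> F. comp x n)" "y = (\<Oplus> n \<in> F. comp y n)"
      by (rule expand[OF _ F]; use assms in \<open>auto simp: F_def\<close>)+
    then show "x \<oplus> y = (\<Oplus> n \<in> F. comp x n \<oplus> comp y n)"
      using finsum_addf[of "comp x" F "comp y"] comp_carrier assms by (auto simp: Pi_def)
  qed (use piece_add comp_props(1) assms in auto)
  then show ?thesis by simp
qed

lemma comp_zero: "comp \<zero> n = \<zero>"
  using comp_homogeneous[OF piece_zero[of n]] by auto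

lemma comp_inv:
  assumes "x \<in> carrier G"
  shows "comp (\<ominus> x) n = \<ominus> comp x n"
proof -
  have "comp x n \<oplus> comp (\<ominus> x) n = \<zero>"
    using comp_add[of x "\<ominus> x" n] assms by (simp add: r_neg comp_zero)
  then show ?thesis using comp_carrier assms by (metis a_inv_closed minus_equality a_comm)
qed

lemma homogeneousI:
  assumes "x \<in> carrier G" "\<And>n. n \<noteq> m \<Longrightarrow> comp x n = \<zero>"
  shows "x = comp x m" "x \<in> \<G> m"
proof -
  show "x = comp x m"
    using expand[of x "{m}"] assms comp_carrier[OF assms(1)] by auto
  then show "x \<in> \<G> m" using comp_props(1)[OF assms(1), of m] by simp
qed

text \<open>Follows from the uniqueness of decompositions. The shift \<sigma> covers multiplication
  by homogeneous elements as well as maps of degree zero; degrees outside its range, such as those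
  below the degree of a multiplier in a grading by natural numbers, receive zero.\<close>

lemma comp_hom:
  assumes H: "graded_group H \<H>" and phi: "\<phi> \<in> carrier G \<rightarrow> carrier H"
    and add: "\<And>x y. x \<in> carrier G \<Longrightarrow> y \<in> carrier G \<Longrightarrow> \<phi> (x \<oplus> y) = \<phi> x \<oplus>\<^bsub>H\<^esub> \<phi> y"
    and deg: "\<And>n x. x \<in> \<G> n \<Longrightarrow> \<phi> x \<in> \<H> (\<sigma> n)" and inj: "inj \<sigma>" and x: "x \<in> carrier G"
  shows "graded_group.comp H \<H> (\<phi> x) (\<sigma> n) = \<phi> (comp x n)"
    and "j \<notin> range \<sigma> \<Longrightarrow> graded_group.comp H \<H> (\<phi> x) j = \<zero>\<^bsub>H\<^esub>"
proof -
  interpret H: graded_group H \<H> by fact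
  have zero: "\<phi> \<zero> = \<zero>\<^bsub>H\<^esub>"
    using add[of \<zero> \<zero>] phi by (metis H.add.l_cancel_one' PiE l_zero zero_closed)
  have sum: "\<phi> (\<Oplus> n \<in> F. c n) = (\<Oplus>\<^bsub>H\<^esub> n \<in> F. \<phi> (c n))" if "finite F" "c \<in> F \<rightarrow> carrier G" for F c
    using that
  proof (induction F)
    case empty show ?case using zero by simp
  next
    case (insert a F)
    then show ?case using phi by (subst H.finsum_insert) (auto simp: add Pi_def)
  qed
  define F where "F = {n. comp x n \<noteq> \<zero>}"
  have F: "finite F" unfolding F_def by (rule comp_props(2)[OF x])
  define c where "c j = (if j \<in> range \<sigma> then \<phi> (comp x (the_inv \<sigma> j)) else \<zero>\<^bsub>H\<^esub>)" for j
  have c\<sigma>: "c (\<sigma> n) = \<phi> (comp x n)" for n unfolding c_def using inj by (simp add: the_inv_f_f)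
  have "H.comp (\<phi> x) = c"
  proof (rule H.comp_unique[of "\<sigma> ` F"])
    show "finite (\<sigma> ` F)" using F by simp
    show "c n \<in> \<H> n" for n
      unfolding c_def using H.piece_zero deg comp_props(1)[OF x] inj by (auto simp: the_inv_f_f)
    show "{n. c n \<noteq> \<zero>\<^bsub>H\<^esub>} \<subseteq> \<sigma> ` F"
    proof
      fix j assume "j \<in> {n. c n \<noteq> \<zero>\<^bsub>H\<^esub>}"
      then obtain n where j: "j = \<sigma> n" "c (\<sigma> n) \<noteq> \<zero>\<^bsub>H\<^esub>" unfolding c_def by (auto split: if_splits)
      then have "n \<in> F" using zero unfolding c\<sigma> F_def by auto
      then show "j \<in> \<sigma> ` F" using j by simp
    qed
    have "\<phi> x = \<phi> (\<Oplus> n \<in> F. comp x n)"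
      using comp_props(3)[OF x] unfolding F_def by simp
    also have "\<dots> = (\<Oplus>\<^bsub>H\<^esub> n \<in> F. \<phi> (comp x n))"
      by (rule sum[OF F]) (use comp_carrier[OF x] in auto)
    also have "\<dots> = (\<Oplus>\<^bsub>H\<^esub> n \<in> F. c (\<sigma> n))" by (simp add: c\<sigma>)
    also have "\<dots> = (\<Oplus>\<^bsub>H\<^esub> n \<in> \<sigma> ` F. c n)"
      using phi comp_carrier[OF x] inj_on_subset[OF inj]
      by (subst H.finsum_reindex) (auto simp: c\<sigma> Pi_def)
    finally show "\<phi> x = (\<Oplus>\<^bsub>H\<^esub> n \<in> \<sigma> ` F. c n)" .
  qed
  then show "H.comp (\<phi> x) (\<sigma> n) = \<phi> (comp x n)" "j \<notin> range \<sigma> \<Longrightarrow> H.comp (\<phi> x) j = \<zero>\<^bsub>H\<^esub>"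
    by (simp_all add: c\<sigma>) (simp add: c_def)
qed

end

sublocale graded_ring \<subseteq> deg: graded_group R \<A>
  by unfold_locales (rule ring_direct_sum)

context graded_ring
begin

lemma comp_mult:
  assumes "a \<in> \<A> e" "x \<in> carrier R"
  shows "deg.comp (a \<otimes> x) (e + n) = a \<otimes> deg.comp x n"
    and "m < e \<Longrightarrow> deg.comp (a \<otimes> x) m = \<zero>"
proof -
  have a: "a \<in> carrier R" using deg.piece_carrier assms by blast
  note * = deg.comp_hom[OF deg.graded_group_axioms, of "\<lambda>x. a \<otimes> x" "\<lambda>n. e + n" x]
  show "deg.comp (a \<otimes> x) (e + n) = a \<otimes> deg.comp x n"
    using *(1) a mult_degree[OF assms(1)] assms(2) by (simp add: r_distr)
  show "m < e \<Longrightarrow> deg.comp (a \<otimes> x) m = \<zero>"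
    using *(2)[of m] a mult_degree[OF assms(1)] assms(2) by (auto simp: r_distr)
qed

text \<open>The case names \<open>zero\<close> and \<open>one\<close> refer to the degrees of the
  generators, not to the elements 0 and 1; the unit is covered by degree zero.\<close>

lemma standard_induct [consumes 2, case_names zero one add inv mult]:
  assumes "standard_graded R \<A>" "a \<in> carrier R"
    and "\<And>a. a \<in> \<A> 0 \<Longrightarrow> P a" "\<And>a. a \<in> \<A> 1 \<Longrightarrow> P a"
    and "\<And>a b. a \<in> carrier R \<Longrightarrow> b \<in> carrier R \<Longrightarrow> P a \<Longrightarrow> P b \<Longrightarrow> P (a \<oplus> b)"
    and "\<And>a. a \<in> carrier R \<Longrightarrow> P a \<Longrightarrow> P (\<ominus> a)"
    and "\<And>a b. a \<in> carrier R \<Longrightarrow> b \<in> carrier R \<Longrightarrow> P a \<Longrightarrow> P b \<Longrightarrow> P (a \<otimes> b)"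
  shows "P a"
proof -
  have sub: "\<A> 0 \<union> \<A> 1 \<subseteq> carrier R" using deg.piece_carrier by blast
  note carr = generate_ring_in_carrier[OF sub]
  have "a \<in> generate_ring R (\<A> 0 \<union> \<A> 1)" using assms(1,2) unfolding standard_graded_def by simp
  then show ?thesis
    by induction (use assms(3-) one_degree_zero carr in auto)
qed

lemma comp0_mult:
  assumes st: "standard_graded R \<A>" and "a \<in> carrier R" "x \<in> carrier R"
  shows "deg.comp (a \<otimes> x) 0 = deg.comp a 0 \<otimes> deg.comp x 0"
  using st assms(2,3)
proof (induction arbitrary: x rule: standard_induct)
  case (zero a) then show ?case using comp_mult(1)[OF zero(1), of x 0] by (simp add: deg.comp_homogeneous)
next
  case (one a) then show ?case using comp_mult(2)[OF one(1), of x 0] by (simp add: deg.comp_homogeneous deg.comp_carrier)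
next
  case (add a b) then show ?case by (simp add: l_distr deg.comp_add deg.comp_carrier)
next
  case (inv a) then show ?case by (simp add: l_minus deg.comp_inv deg.comp_carrier)
next
  case (mult a b) then show ?case by (simp add: m_assoc deg.comp_carrier)
qed

text \<open>Since R = R_0[R_1], multipliers of degree zero and one suffice. For these the components
  of a product are explicit, so the lemma suits ideals defined by conditions on components.\<close>

lemma subset_ideal_if:
  assumes st: "standard_graded R \<A>" and K: "additive_subgroup K R" "\<And>a x. a \<in> \<A> 0 \<union> \<A> 1 \<Longrightarrow> x \<in> K \<Longrightarrow> a \<otimes> x \<in> K"
  shows "ideal K R"
proof -
  interpret K: additive_subgroup K R by fact
  have *: "a \<otimes> x \<in> K" if "x \<in> K" "a \<in> carrier R" for x a
    using st that(2,1)
  proof (induction arbitrary: x rule: standard_induct)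
    case (add a b) then show ?case by (simp add: l_distr K.a_Hcarr)
  next
    case (inv a) then show ?case by (simp add: l_minus K.a_Hcarr)
  next
    case (mult a b) then show ?case by (simp add: m_assoc K.a_Hcarr)
  qed (use K in auto)
  show ?thesis
    by (rule idealI) (use * m_comm K.a_Hcarr K.a_subgroup in \<open>auto intro: ring_axioms\<close>)
qed

end

section \<open>Standard graded Noetherian rings\<close>

lemma (in noetherian_ring) ideal_sequence_stable:
  assumes "\<And>p::nat. ideal (I p) R" "\<And>p. I p \<subseteq> I (Suc p)"
  obtains q where "\<And>p. p \<ge> q \<Longrightarrow> I p = I q"
proof -
  have mono: "I p \<subseteq> I q" if "p \<le> q" for p q
    by (rule lift_Suc_mono_le[of I, OF assms(2) that])
  have "subset.chain {I. ideal I R} (range I)"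
    unfolding subset_chain_def
  proof (intro conjI ballI)
    show "range I \<subseteq> {I. ideal I R}" using assms(1) by auto
    fix X Y assume "X \<in> range I" "Y \<in> range I"
    then obtain p q where "X = I p" "Y = I q" by auto
    then show "X \<subseteq> Y \<or> Y \<subseteq> X" using mono[of p q] mono[of q p] nat_le_linear[of p q] by auto
  qed
  then obtain q where q: "\<Union>(range I) = I q"
    using ideal_chain_is_trivial[of "range I"] by auto
  have "I p = I q" if "p \<ge> q" for p using q mono[OF that] by blast
  then show ?thesis using that by blast
qed

lemma (in noetherian_ring) exists_maximal_ideal_in:
  assumes "\<F> \<subseteq> {I. ideal I R}" "\<F> \<noteq> {}"
  obtains I where "I \<in> \<F>" "\<And>J. J \<in> \<F> \<Longrightarrow> I \<subseteq> J \<Longrightarrow> J = I"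
proof -
  have "\<exists>M\<in>\<F>. \<forall>X\<in>\<F>. M \<subseteq> X \<longrightarrow> X = M"
  proof (rule subset_Zorn_nonempty[OF assms(2)])
    fix C assume C: "C \<noteq> {}" "subset.chain \<F> C"
    then have "subset.chain {I. ideal I R} C" using assms(1) unfolding subset_chain_def by blast
    then have "\<Union>C \<in> C" by (rule ideal_chain_is_trivial[OF C(1)])
    then show "\<Union>C \<in> \<F>" using C(2) unfolding subset_chain_def by blast
  qed
  then show ?thesis using that by blast
qed

locale std_graded_ring = graded_ring R \<A> + noetherian_ring R
  for R :: "('a, 'r) ring_scheme" (structure) and \<A> +
  assumes std: "standard_graded R \<A>"
begin

lemma additive_subgroupI:
  assumes "H \<subseteq> carrier R" "\<zero> \<in> H" "\<And>x y. x \<in> H \<Longrightarrow> y \<in> H \<Longrightarrow> x \<oplus> y \<in> H" "\<And>x. x \<in> H \<Longrightarrow> \<ominus> x \<in> H"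
  shows "additive_subgroup H R"
  using assms by (intro additive_subgroup.intro add.subgroupI) (auto simp: a_inv_def)

lemma comp_mult_zero: "a \<in> \<A> 0 \<Longrightarrow> x \<in> carrier R \<Longrightarrow> deg.comp (a \<otimes> x) n = a \<otimes> deg.comp x n"
  using comp_mult(1)[of a 0 x n] by simp

lemma comp_mult_one:
  assumes "a \<in> \<A> 1" "x \<in> carrier R"
  shows "deg.comp (a \<otimes> x) (Suc n) = a \<otimes> deg.comp x n" "deg.comp (a \<otimes> x) 0 = \<zero>"
  using comp_mult(1)[of a 1 x n] comp_mult(2)[of a 1 x 0] assms by auto

lemma irrelevant_ideal_eq: "irrelevant_ideal R \<A> = {a \<in> carrier R. deg.comp a 0 = \<zero>}"
proof (intro equalityI subsetI)
  fix a assume "a \<in> irrelevant_ideal R \<A>"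
  then obtain D c where D: "finite D" "D \<subseteq> {0<..}" "\<And>i. i \<in> D \<Longrightarrow> c i \<in> \<A> i" "a = (\<Oplus>i\<in>D. c i)"
    unfolding irrelevant_ideal_def by auto
  define c' where "c' i = (if i \<in> D then c i else \<zero>)" for i
  have cc: "c \<in> D \<rightarrow> carrier R" using D deg.piece_carrier by auto
  have "(\<Oplus>i\<in>D. c i) = (\<Oplus>i\<in>D. c' i)"
    by (rule add.finprod_cong') (use cc D deg.piece_carrier in \<open>auto simp: c'_def\<close>)
  then have "deg.comp a = c'"
    by (intro deg.comp_unique[of D]) (use D deg.piece_zero in \<open>auto simp: c'_def\<close>)
  then show "a \<in> {a \<in> carrier R. deg.comp a 0 = \<zero>}"
    using D cc by (auto simp: c'_def)
next
  fix a assume a: "a \<in> {a \<in> carrier R. deg.comp a 0 = \<zero>}"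
  then have "a \<in> carrier R" by auto
  note deg.comp_props[OF this]
  moreover have "{n. deg.comp a n \<noteq> \<zero>} \<subseteq> {0<..}" using a by (auto intro: Nat.gr0I)
  ultimately show "a \<in> irrelevant_ideal R \<A>"
    unfolding irrelevant_ideal_def by blast
qed

lemma ideal_irrelevant: "ideal (irrelevant_ideal R \<A>) R"
  unfolding irrelevant_ideal_eq
proof (rule subset_ideal_if[OF std])
  show "additive_subgroup {a \<in> carrier R. deg.comp a 0 = \<zero>} R"
    by (rule additive_subgroupI) (auto simp: deg.comp_zero deg.comp_add deg.comp_inv)
qed (auto simp: comp_mult_zero comp_mult_one deg.piece_carrier[of _ 0] deg.piece_carrier[of _ 1] dest: deg.piece_carrier)

text \<open>Generation of R_1 over R_0, phrased through R_0-stable subgroups instead of linear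
  combinations. Degree one is asked for at every index, also from \<open>r\<close> on, so that
  \<open>f\<close> is a total family of operators.\<close>

definition generates_degree_one :: "(nat \<Rightarrow> 'a) \<Rightarrow> nat \<Rightarrow> bool" where
  "generates_degree_one f r \<longleftrightarrow> (\<forall>i. f i \<in> \<A> 1) \<and>
     (\<forall>W. additive_subgroup W R \<longrightarrow> (\<forall>a\<in>\<A> 0. \<forall>x\<in>W. a \<otimes> x \<in> W) \<longrightarrow> (\<forall>i<r. f i \<in> W) \<longrightarrow> \<A> 1 \<subseteq> W)"

text \<open>R_+ has nothing in degree zero, so only the degree-zero parts of coefficients contribute
  to degree one of a combination: the degree-one components of ideal generators of R_+ generate R_1
  over R_0.\<close>

lemma exists_generators: "\<exists>f r. generates_degree_one f r"
proof -
  obtain F where F: "F \<subseteq> carrier R" "finite F" "irrelevant_ideal R \<A> = Idl F"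
    using finetely_gen[OF ideal_irrelevant] by blast
  obtain fs where fs: "set fs = F" using F(2) finite_list by blast
  have F0: "deg.comp x 0 = \<zero>" if "x \<in> F" for x
    using genideal_self[OF F(1)] that F(3) unfolding irrelevant_ideal_eq by blast
  define f where "f i = (if i < length fs then deg.comp (fs ! i) 1 else \<zero>)" for i
  have "generates_degree_one f (length fs)"
    unfolding generates_degree_one_def
  proof (intro conjI allI impI)
    fix i show "f i \<in> \<A> 1"
      using F fs unfolding f_def by (auto simp: deg.piece_zero intro!: deg.comp_props(1))
  next
    fix W assume W: "additive_subgroup W R" "\<forall>a\<in>\<A> 0. \<forall>x\<in>W. a \<otimes> x \<in> W" "\<forall>i<length fs. f i \<in> W"
    interpret W: additive_subgroup W R by fact
    \<comment> \<open>Closed under multipliers of degree one because these move the vanishing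
      component of degree zero into degree one.\<close>
    define K where "K = {b \<in> carrier R. deg.comp b 0 = \<zero> \<and> deg.comp b 1 \<in> W}"
    have "ideal K R"
    proof (rule subset_ideal_if[OF std])
      show "additive_subgroup K R"
        by (rule additive_subgroupI) (auto simp: K_def deg.comp_zero deg.comp_add deg.comp_inv)
      show "a \<otimes> x \<in> K" if "a \<in> \<A> 0 \<union> \<A> 1" "x \<in> K" for a x
        using that W(2) comp_mult_one(1)[of a x 0] deg.piece_carrier[of a]
        by (auto simp: K_def comp_mult_zero comp_mult_one)
    qed
    moreover have "F \<subseteq> K"
    proof
      fix x assume x: "x \<in> F"
      then obtain i where "i < length fs" "x = fs ! i" using fs by (metis in_set_conv_nth)
      then have "deg.comp x 1 \<in> W" using W(3) unfolding f_def by auto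
      then show "x \<in> K" unfolding K_def using F0[OF x] x F(1) by auto
    qed
    ultimately have K: "irrelevant_ideal R \<A> \<subseteq> K" using F(3) genideal_minimal by metis
    show "\<A> 1 \<subseteq> W"
    proof
      fix x assume x: "x \<in> \<A> 1"
      then have "x \<in> irrelevant_ideal R \<A>"
        unfolding irrelevant_ideal_eq by (auto simp: deg.comp_homogeneous deg.piece_carrier)
      then have "deg.comp x 1 \<in> W" using K unfolding K_def by blast
      then show "x \<in> W" using x by (simp add: deg.comp_homogeneous)
    qed
  qed
  then show ?thesis by blast
qed

text \<open>The f_i generate R_+ as an ideal: once \<open>K\<close> contains R_1, induction over the
  generation of R shows that every element differs from its degree-zero component by an element of
  \<open>K\<close>.\<close>

lemma irrelevant_ideal_subset:
  assumes gen: "generates_degree_one f r" and K: "ideal K R" and f: "\<And>i. i < r \<Longrightarrow> f i \<in> K"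
  shows "irrelevant_ideal R \<A> \<subseteq> K"
proof -
  interpret K: ideal K R by fact
  have A1: "\<A> 1 \<subseteq> K"
    using gen f K.additive_subgroup_axioms K.I_l_closed deg.piece_carrier unfolding generates_degree_one_def by blast
  have *: "a \<ominus> deg.comp a 0 \<in> K" if "a \<in> carrier R" for a
    using std that
  proof (induction rule: standard_induct)
    case (zero a)
    then show ?case by (simp add: deg.comp_homogeneous deg.piece_carrier minus_eq r_neg)
  next
    case (one a)
    then show ?case using A1 by (auto simp: deg.comp_homogeneous deg.piece_carrier minus_eq)
  next
    case (add a b)
    have "a \<oplus> b \<ominus> deg.comp (a \<oplus> b) 0 = (a \<ominus> deg.comp a 0) \<oplus> (b \<ominus> deg.comp b 0)"
      using add deg.comp_carrier by (simp add: deg.comp_add) algebra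
    then show ?case using add by simp
  next
    case (inv a)
    have "\<ominus> a \<ominus> deg.comp (\<ominus> a) 0 = \<ominus> (a \<ominus> deg.comp a 0)"
      using inv deg.comp_carrier by (simp add: deg.comp_inv) algebra
    then show ?case using inv by simp
  next
    case (mult a b)
    have "a \<otimes> b \<ominus> deg.comp (a \<otimes> b) 0 = a \<otimes> (b \<ominus> deg.comp b 0) \<oplus> (a \<ominus> deg.comp a 0) \<otimes> deg.comp b 0"
      using mult deg.comp_carrier by (simp add: comp0_mult[OF std]) algebra
    then show ?case using mult deg.comp_carrier by (simp add: K.I_l_closed K.I_r_closed)
  qed
  show ?thesis
  proof
    fix a assume "a \<in> irrelevant_ideal R \<A>"
    then show "a \<in> K" using *[of a] unfolding irrelevant_ideal_eq by (simp add: minus_eq)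
  qed
qed

text \<open>The chain condition is available for R rather than R_0, so a maximal ideal of R_0 above
  \<open>a\<close> is found inside R: the ideal of R_0 generated by \<open>a\<close> is pulled back
  along the projection to degree zero, enlarged to a maximal proper ideal of R and contracted to
  R_0.\<close>

lemma unit_if_not_in_maximal:
  assumes loc: "is_local_ring (degree_zero_ring R \<A>) \<mm>" and a: "a \<in> \<A> 0" "a \<notin> \<mm>"
  obtains b where "b \<in> \<A> 0" "b \<otimes> a = \<one>"
proof (rule ccontr)
  assume no: "\<not> thesis"
  let ?R0 = "degree_zero_ring R \<A>"
  have R0: "carrier ?R0 = \<A> 0" "add ?R0 = add R" "monoid.mult ?R0 = monoid.mult R" "\<one>\<^bsub>?R0\<^esub> = \<one>" "\<zero>\<^bsub>?R0\<^esub> = \<zero>"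
    by (auto simp: degree_zero_ring_def)
  interpret R0: cring ?R0 using loc by (auto simp: is_local_ring_def)
  have inv0: "\<ominus>\<^bsub>?R0\<^esub> x = \<ominus> x" if "x \<in> \<A> 0" for x
  proof -
    have "\<ominus> x \<oplus> x = \<zero>" "\<ominus> x \<in> \<A> 0" using that deg.piece_carrier deg.piece_inv by (auto simp: l_neg)
    then show ?thesis using R0.minus_equality[of "\<ominus> x" x] that by (simp add: R0)
  qed
  have Acar: "x \<in> \<A> 0 \<Longrightarrow> x \<in> carrier R" for x by (rule deg.piece_carrier)
  have A0m: "x \<in> \<A> 0 \<Longrightarrow> y \<in> \<A> 0 \<Longrightarrow> x \<otimes> y \<in> \<A> 0" for x y using mult_degree[of x 0 y 0] by simp
  \<comment> \<open>The preimage of an ideal of R_0 under the projection; products with elements of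
    degree one have no component in degree zero.\<close>
  have ext: "ideal {x \<in> carrier R. deg.comp x 0 \<in> W} R"
    if W: "additive_subgroup W R" "\<And>b x. b \<in> \<A> 0 \<Longrightarrow> x \<in> W \<Longrightarrow> b \<otimes> x \<in> W" for W
  proof -
    interpret W: additive_subgroup W R by fact
    show ?thesis
    proof (rule subset_ideal_if[OF std])
      show "additive_subgroup {x \<in> carrier R. deg.comp x 0 \<in> W} R"
        by (rule additive_subgroupI) (auto simp: deg.comp_zero deg.comp_add deg.comp_inv)
    qed (use W in \<open>auto simp: comp_mult_zero comp_mult_one Acar deg.piece_carrier\<close>)
  qed
  define W where "W = {b \<otimes> a |b. b \<in> \<A> 0}"
  have WI: "b \<otimes> a \<in> W" if "b \<in> \<A> 0" for b using that unfolding W_def by blast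
  have W: "additive_subgroup W R"
  proof (rule additive_subgroupI)
    show "\<zero> \<in> W" using WI[OF deg.piece_zero] Acar[OF a(1)] by simp
    show "x \<oplus> y \<in> W" if xy: "x \<in> W" "y \<in> W" for x y
    proof -
      obtain b c where *: "x = b \<otimes> a" "y = c \<otimes> a" "b \<in> \<A> 0" "c \<in> \<A> 0" using xy unfolding W_def by blast
      then show ?thesis using WI[OF deg.piece_add[OF *(3,4)]] by (simp add: l_distr Acar a(1))
    qed
    show "\<ominus> x \<in> W" if xy: "x \<in> W" for x
    proof -
      obtain b where *: "x = b \<otimes> a" "b \<in> \<A> 0" using xy unfolding W_def by blast
      then show ?thesis using WI[OF deg.piece_inv[OF *(2)]] by (simp add: l_minus Acar a(1))
    qed
  qed (use Acar a in \<open>auto simp: W_def\<close>)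
  have W2: "b \<otimes> x \<in> W" if bx: "b \<in> \<A> 0" "x \<in> W" for b x
  proof -
    obtain c where *: "x = c \<otimes> a" "c \<in> \<A> 0" using bx unfolding W_def by blast
    then show ?thesis using WI[OF A0m[OF bx(1) *(2)]] bx by (simp add: m_assoc Acar a(1))
  qed
  define K where "K = {x \<in> carrier R. deg.comp x 0 \<in> W}"
  have K: "ideal K R" unfolding K_def by (rule ext[OF W W2])
  have aK: "a \<in> K"
    unfolding K_def using Acar[OF a(1)] WI[OF one_degree_zero] by (simp add: deg.comp_homogeneous[OF a(1)])
  have K1: "\<one> \<notin> K"
  proof
    assume "\<one> \<in> K"
    then have "\<one> \<in> W" unfolding K_def by (simp add: deg.comp_homogeneous[OF one_degree_zero])
    then obtain b where "b \<in> \<A> 0" "\<one> = b \<otimes> a" unfolding W_def by blast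
    then show False using no that[of b] by simp
  qed
  have Kirr: "irrelevant_ideal R \<A> \<subseteq> K"
    unfolding irrelevant_ideal_eq K_def using additive_subgroup.zero_closed[OF W] by auto
  define \<F> where "\<F> = {J. ideal J R \<and> K \<subseteq> J \<and> \<one> \<notin> J}"
  have F: "\<F> \<subseteq> {J. ideal J R}" "\<F> \<noteq> {}" using K K1 unfolding \<F>_def by auto
  obtain I where I': "I \<in> \<F>" "\<And>J. J \<in> \<F> \<Longrightarrow> I \<subseteq> J \<Longrightarrow> J = I"
    by (rule exists_maximal_ideal_in[OF F]) auto
  then have I: "ideal I R" "K \<subseteq> I" "\<one> \<notin> I"
    and Imax: "\<And>J. ideal J R \<Longrightarrow> K \<subseteq> J \<Longrightarrow> \<one> \<notin> J \<Longrightarrow> I \<subseteq> J \<Longrightarrow> J = I"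
    unfolding \<F>_def by auto
  interpret I: ideal I R by fact
  \<comment> \<open>\<open>I\<close> contains R_+, so it is determined by its contraction. An ideal
    \<open>J\<close> of R_0 above the contraction is compared with \<open>I\<close> through its
    preimage \<open>J'\<close>.\<close>
  have "maximalideal (I \<inter> \<A> 0) ?R0"
  proof (rule maximalidealI)
    show "ideal (I \<inter> \<A> 0) ?R0"
    proof (rule idealI)
      show "subgroup (I \<inter> \<A> 0) (add_monoid ?R0)"
      proof (rule R0.add.subgroupI)
        show "I \<inter> \<A> 0 \<noteq> {}" using I.zero_closed deg.piece_zero[of 0] by blast
      qed (use I.zero_closed deg.piece_zero inv0 I.a_inv_closed deg.piece_inv deg.piece_add in \<open>auto simp: R0 a_inv_def[symmetric]\<close>)
    qed (use R0.ring_axioms I.I_l_closed I.I_r_closed A0m Acar in \<open>auto simp: R0\<close>)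
    show "carrier ?R0 \<noteq> I \<inter> \<A> 0" using I(3) one_degree_zero by (auto simp: R0)
    fix J assume J: "ideal J ?R0" "I \<inter> \<A> 0 \<subseteq> J" "J \<subseteq> carrier ?R0"
    interpret J: ideal J ?R0 by fact
    have JA: "J \<subseteq> \<A> 0" using J(3) R0 by simp
    have Js: "additive_subgroup J R"
    proof (rule additive_subgroupI)
      show "J \<subseteq> carrier R" using JA Acar by auto
      show "\<zero> \<in> J" using J.zero_closed by (simp add: R0)
      show "x \<oplus> y \<in> J" if "x \<in> J" "y \<in> J" for x y using J.a_closed[OF that] by (simp add: R0)
      show "\<ominus> x \<in> J" if "x \<in> J" for x using additive_subgroup.a_inv_closed[OF J.additive_subgroup_axioms that] inv0[OF subsetD[OF JA that]] by (simp only:)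
    qed
    define J' where "J' = {x \<in> carrier R. deg.comp x 0 \<in> J}"
    have J': "ideal J' R" unfolding J'_def
      by (rule ext[OF Js]) (use J.I_l_closed in \<open>auto simp: R0\<close>)
    have IJ: "I \<subseteq> J'"
    proof
      fix x assume x: "x \<in> I"
      have xc: "x \<in> carrier R" using x I.Icarr by blast
      have "x \<ominus> deg.comp x 0 \<in> irrelevant_ideal R \<A>"
        unfolding irrelevant_ideal_eq using xc deg.comp_carrier deg.comp_props(1)[OF xc, of 0]
        by (simp add: minus_eq deg.comp_add deg.comp_inv deg.comp_homogeneous[of "deg.comp x 0" 0] r_neg)
      then have "x \<ominus> deg.comp x 0 \<in> I" using Kirr I(2) by blast
      then have "x \<ominus> (x \<ominus> deg.comp x 0) \<in> I" using x by (simp add: minus_eq)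
      moreover have "x \<ominus> (x \<ominus> deg.comp x 0) = deg.comp x 0" using xc deg.comp_carrier[OF xc, of 0] by algebra
      ultimately show "x \<in> J'" unfolding J'_def using xc deg.comp_props(1)[OF xc] J(2) by auto
    qed
    have JJ: "J = J' \<inter> \<A> 0"
      unfolding J'_def using JA Acar by (auto simp: deg.comp_homogeneous)
    show "J = I \<inter> \<A> 0 \<or> J = carrier ?R0"
    proof (cases "\<one> \<in> J'")
      case True
      then have "\<one> \<in> J" using JJ one_degree_zero by blast
      then show ?thesis using J.one_imp_carrier by (simp add: R0)
    next
      case False
      then have "J' = I" using Imax[OF J' _ False IJ] I(2) IJ by blast
      then show ?thesis using JJ by blast
    qed
  qed
  then have "I \<inter> \<A> 0 = \<mm>" using loc unfolding is_local_ring_def by blast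
  then show False using a aK I(2) by blast
qed

end

lemma (in cring) ideal_power:
  assumes "ideal I R"
  shows "ideal (I [^]\<^bsub>ideals_set R\<^esub> (m::nat)) R"
  by (induction m) (auto simp: nat_pow_def ideals_set_def oneideal intro: ideal_prod_is_ideal[OF _ assms])

section \<open>Powers of the irrelevant ideal and Nakayama's lemma\<close>

context std_graded_ring
begin

lemmas ring_minus_eq = minus_eq and ring_r_neg = r_neg and ring_minus_add = minus_add and ring_a_ac = add.m_ac

text \<open>The truncation of R to degrees at least \<open>n\<close>. The R_0-submodules of R_n
  correspond to the ideals of R between two consecutive truncations, which makes the chain condition
  of R applicable to them.\<close>

definition order_ge :: "nat \<Rightarrow> 'a set" where
  "order_ge n = {a \<in> carrier R. \<forall>m<n. deg.comp a m = \<zero>}"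

lemma order_ge_carrier: "a \<in> order_ge n \<Longrightarrow> a \<in> carrier R"
  by (auto simp: order_ge_def)

lemma order_ge_mult_one: "a \<in> \<A> 1 \<Longrightarrow> x \<in> order_ge n \<Longrightarrow> a \<otimes> x \<in> order_ge (Suc n)"
proof -
  assume a: "a \<in> \<A> 1" and x: "x \<in> order_ge n"
  have ac: "a \<in> carrier R" using a deg.piece_carrier by blast
  have "deg.comp (a \<otimes> x) m = \<zero>" if "m < Suc n" for m
    using that x a ac by (cases m) (auto simp: comp_mult_one order_ge_def)
  then show ?thesis using x ac by (auto simp: order_ge_def)
qed

lemma order_ge_mono: "m \<le> n \<Longrightarrow> order_ge n \<subseteq> order_ge m"
  by (auto simp: order_ge_def)

lemma order_ge_add: "additive_subgroup (order_ge n) R"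
  by (rule additive_subgroupI) (auto simp: order_ge_def deg.comp_zero deg.comp_add deg.comp_inv)

lemma ideal_order_ge: "ideal (order_ge n) R"
proof (rule subset_ideal_if[OF std order_ge_add])
  fix a x assume a: "a \<in> \<A> 0 \<union> \<A> 1" and x: "x \<in> order_ge n"
  then have ac: "a \<in> carrier R" using deg.piece_carrier by blast
  show "a \<otimes> x \<in> order_ge n"
    using a
  proof
    assume "a \<in> \<A> 0"
    then show ?thesis using x ac by (auto simp: order_ge_def comp_mult_zero)
  next
    assume "a \<in> \<A> 1"
    then show ?thesis using order_ge_mult_one[OF _ x] order_ge_mono[of n "Suc n"] by auto
  qed
qed

lemma degree_order_ge: "a \<in> \<A> n \<Longrightarrow> a \<in> order_ge n"
  by (auto simp: order_ge_def deg.piece_carrier deg.comp_homogeneous)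

lemma irrelevant_mult_order_ge:
  assumes y: "y \<in> irrelevant_ideal R \<A>" and a: "a \<in> order_ge n"
  shows "y \<otimes> a \<in> order_ge (Suc n)"
proof -
  obtain f r where gen: "generates_degree_one f r" using exists_generators by blast
  interpret O: ideal "order_ge (Suc n)" R by (rule ideal_order_ge)
  define K where "K = {y \<in> carrier R. y \<otimes> a \<in> order_ge (Suc n)}"
  have ac: "a \<in> carrier R" using a order_ge_carrier by blast
  have "additive_subgroup K R"
    by (rule additive_subgroupI)
      (use ac additive_subgroup.a_inv_closed[OF order_ge_add] in \<open>auto simp: K_def l_distr l_minus\<close>)
  then have "ideal K R"
  proof (rule subset_ideal_if[OF std])
    fix b x assume "b \<in> \<A> 0 \<union> \<A> 1" "x \<in> K"
    moreover from this have "b \<in> carrier R" using deg.piece_carrier by blast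
    ultimately show "b \<otimes> x \<in> K"
      using ac O.I_l_closed by (auto simp: K_def m_assoc)
  qed
  moreover have "f i \<in> K" for i
    using gen order_ge_mult_one[OF _ a] deg.piece_carrier unfolding generates_degree_one_def K_def by auto
  ultimately have "irrelevant_ideal R \<A> \<subseteq> K"
    by (intro irrelevant_ideal_subset[OF gen]) auto
  then show ?thesis using y unfolding K_def by blast
qed

lemmas ideal_irrelevant_power = ideal_power[OF ideal_irrelevant]

text \<open>R_n is spanned over R_0 by products of \<open>n\<close> elements of degree one. In place
  of such products, the elements whose component in each degree \<open>m\<close> lies in the
  \<open>m\<close>-th power are shown to form an ideal containing 1.\<close>

lemma degree_in_irrelevant_power: "\<A> n \<subseteq> irrelevant_ideal R \<A> [^]\<^bsub>ideals_set R\<^esub> n"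
proof -
  let ?I = "irrelevant_ideal R \<A>"
  have pow: "\<one>\<^bsub>ideals_set R\<^esub> = carrier R"
    "?I [^]\<^bsub>ideals_set R\<^esub> Suc m = (?I [^]\<^bsub>ideals_set R\<^esub> m) \<cdot> ?I" for m :: nat
    by (simp_all add: nat_pow_def ideals_set_def)
  note ideal = ideal_irrelevant_power
  define Q where "Q = {b \<in> carrier R. \<forall>m. deg.comp b m \<in> ?I [^]\<^bsub>ideals_set R\<^esub> m}"
  note as = ideal.axioms(1)[OF ideal]
  have "additive_subgroup Q R"
    by (rule additive_subgroupI)
      (auto simp: Q_def deg.comp_zero deg.comp_add deg.comp_inv additive_subgroup.zero_closed[OF as]
        additive_subgroup.a_closed[OF as] additive_subgroup.a_inv_closed[OF as])
  then have Q: "ideal Q R"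
  proof (rule subset_ideal_if[OF std])
    fix a x assume a: "a \<in> \<A> 0 \<union> \<A> 1" and x: "x \<in> Q"
    have ac: "a \<in> carrier R" using a deg.piece_carrier by blast
    have xc: "x \<in> carrier R" using x unfolding Q_def by blast
    have "deg.comp (a \<otimes> x) m \<in> ?I [^]\<^bsub>ideals_set R\<^esub> m" for m
    proof (cases "a \<in> \<A> 0")
      case True
      then show ?thesis using x ideal.I_l_closed[OF ideal _ ac] by (auto simp: Q_def comp_mult_zero)
    next
      case False
      then have a1: "a \<in> \<A> 1" using a by blast
      then have aI: "a \<in> ?I" unfolding irrelevant_ideal_eq using ac by (auto simp: deg.comp_homogeneous)
      show ?thesis
      proof (cases m)
        case 0
        then show ?thesis using a1 xc ac by (simp add: pow comp_mult_one)
      next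
        case (Suc l)
        have "deg.comp x l \<otimes> a \<in> ?I [^]\<^bsub>ideals_set R\<^esub> Suc l"
          unfolding pow by (rule ideal_prod.prod) (use x aI in \<open>auto simp: Q_def\<close>)
        then show ?thesis using Suc a1 xc ac by (simp add: comp_mult_one m_comm deg.comp_carrier)
      qed
    qed
    then show "a \<otimes> x \<in> Q" unfolding Q_def using ac xc by auto
  qed
  have "\<one> \<in> Q"
    unfolding Q_def using additive_subgroup.zero_closed[OF as] by (auto simp: deg.comp_homogeneous[OF one_degree_zero] pow)
  then have Q1: "Q = carrier R" using ideal.one_imp_carrier[OF Q] by blast
  show ?thesis
  proof
    fix a assume a: "a \<in> \<A> n"
    then have "a \<in> Q" using Q1 deg.piece_carrier by blast
    then have "deg.comp a n \<in> ?I [^]\<^bsub>ideals_set R\<^esub> n" unfolding Q_def by blast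
    then show "a \<in> ?I [^]\<^bsub>ideals_set R\<^esub> n" using a by (simp add: deg.comp_homogeneous)
  qed
qed

end

sublocale graded_module \<subseteq> mdeg: graded_group M \<M>
  by unfold_locales (rule module_direct_sum)

context graded_module
begin

lemma comp_smult_homogeneous:
  assumes "x \<in> \<M> e" "b \<in> carrier R"
  shows "mdeg.comp (b \<odot>\<^bsub>M\<^esub> x) (int n + e) = deg.comp b n \<odot>\<^bsub>M\<^esub> x"
proof -
  have "x \<in> carrier M" using assms mdeg.piece_carrier by blast
  then show ?thesis
    using deg.comp_hom(1)[OF mdeg.graded_group_axioms, of "\<lambda>b. b \<odot>\<^bsub>M\<^esub> x" "\<lambda>n. int n + e" b n] assms smult_degree
    by (auto simp: smult_l_distr inj_def)
qed

lemma comp_homogeneous_smult: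
  assumes "a \<in> \<A> d" "x \<in> carrier M"
  shows "mdeg.comp (a \<odot>\<^bsub>M\<^esub> x) (int d + n) = a \<odot>\<^bsub>M\<^esub> mdeg.comp x n"
proof -
  have "a \<in> carrier R" using assms deg.piece_carrier by blast
  then show ?thesis
    using mdeg.comp_hom(1)[OF mdeg.graded_group_axioms, of "\<lambda>x. a \<odot>\<^bsub>M\<^esub> x" "\<lambda>n. int d + n" x n] assms smult_degree
    by (auto simp: smult_r_distr inj_def)
qed

end

locale std_graded_module = std_graded_ring R \<A> + graded_module R \<A> M \<M>
  for R :: "('a, 'r) ring_scheme" (structure) and \<A> and M :: "('a, 'm) module" (structure) and \<M>
begin

text \<open>Nakayama's lemma for the module \<open>R\<^sub>n x\<close> over the degree-zero ring. A maximal proper submodule of it is taken in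
  the form of an ideal of R between \<open>U\<close>, the kernel of \<open>y \<mapsto> y\<^sub>n x\<close>, and \<open>order_ge n\<close>.\<close>

lemma annihilated_if_multiples_in_maximal:
  assumes loc: "is_local_ring (degree_zero_ring R \<A>) \<mm>" and S: "S \<subseteq> \<A> 0" "S \<subseteq> \<mm>"
    and x: "x \<in> \<M> e" and ax: "\<And>a. a \<in> \<A> n \<Longrightarrow> \<exists>b \<in> Idl S. a \<odot>\<^bsub>M\<^esub> x = b \<odot>\<^bsub>M\<^esub> x" and a: "a \<in> \<A> n"
  shows "a \<odot>\<^bsub>M\<^esub> x = \<zero>\<^bsub>M\<^esub>"
proof -
  have xc: "x \<in> carrier M" using x mdeg.piece_carrier by blast
  have Acar: "\<And>a n. a \<in> \<A> n \<Longrightarrow> a \<in> carrier R" by (rule deg.piece_carrier)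
  have Sc: "S \<subseteq> carrier R" using S Acar by blast
  define J where "J = Idl S"
  have J: "ideal J R" unfolding J_def by (rule genideal_ideal[OF Sc])
  interpret J: ideal J R by (rule J)
  have SJ: "S \<subseteq> J" unfolding J_def by (rule genideal_self[OF Sc])
  let ?L = "order_ge n"
  interpret L: ideal ?L R by (rule ideal_order_ge)
  define U where "U = {y \<in> ?L. deg.comp y n \<odot>\<^bsub>M\<^esub> x = \<zero>\<^bsub>M\<^esub>}"
  have Lc: "\<And>y. y \<in> ?L \<Longrightarrow> y \<in> carrier R" by (rule order_ge_carrier)
  have cc: "\<And>y m. y \<in> ?L \<Longrightarrow> deg.comp y m \<in> carrier R" using deg.comp_carrier Lc by blast
  have LU: "order_ge (Suc n) \<subseteq> U"
    unfolding U_def order_ge_def using xc by auto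
  have U: "ideal U R"
  proof (rule subset_ideal_if[OF std])
    show "additive_subgroup U R"
      by (rule additive_subgroupI)
        (use xc Lc cc L.zero_closed L.a_closed additive_subgroup.a_inv_closed[OF order_ge_add]
         in \<open>auto simp: U_def deg.comp_zero deg.comp_add deg.comp_inv smult_l_distr smult_l_minus\<close>)
    fix b y assume b: "b \<in> \<A> 0 \<union> \<A> 1" and y: "y \<in> U"
    have yL: "y \<in> ?L" using y unfolding U_def by blast
    show "b \<otimes> y \<in> U"
    proof (cases "b \<in> \<A> 0")
      case True
      then show ?thesis using y yL Lc cc Acar[OF True] xc L.I_l_closed[of y b] unfolding U_def
        by (auto simp: comp_mult_zero smult_assoc1)
    next
      case False
      then have "b \<in> \<A> 1" using b by blast
      then show ?thesis using order_ge_mult_one[OF _ yL] LU by blast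
    qed
  qed
  have "?L \<subseteq> U"
  proof (rule ccontr)
    assume nLU: "\<not> ?L \<subseteq> U"
    define \<F> where "\<F> = {I. ideal I R \<and> U \<subseteq> I \<and> I \<subset> ?L}"
    have "U \<in> \<F>" using U nLU unfolding \<F>_def U_def by blast
    then have F: "\<F> \<subseteq> {J. ideal J R}" "\<F> \<noteq> {}" unfolding \<F>_def by auto
    obtain I where I': "I \<in> \<F>" "\<And>J. J \<in> \<F> \<Longrightarrow> I \<subseteq> J \<Longrightarrow> J = I"
      by (rule exists_maximal_ideal_in[OF F]) auto
    have I: "ideal I R" "U \<subseteq> I" "I \<subset> ?L" using I'(1) unfolding \<F>_def by auto
    interpret I: ideal I R by (rule I(1))
    obtain y where y: "y \<in> ?L" "y \<notin> I" using I(3) by blast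
    have yc: "y \<in> carrier R" using y Lc by blast
    define I2 where "I2 = I <+>\<^bsub>R\<^esub> PIdl y"
    have I2: "ideal I2 R" unfolding I2_def by (rule add_ideals[OF I(1) cgenideal_ideal[OF yc]])
    have I2mem: "z \<in> I2 \<longleftrightarrow> (\<exists>i\<in>I. \<exists>q\<in>carrier R. z = i \<oplus> q \<otimes> y)" for z
      unfolding I2_def set_add_def' cgenideal_def by blast
    have II2: "I \<subseteq> I2"
    proof
      fix i assume i: "i \<in> I"
      then have "i = i \<oplus> \<zero> \<otimes> y" using yc I.Icarr by simp
      then show "i \<in> I2" using I2mem i by blast
    qed
    have "\<zero> \<oplus> \<one> \<otimes> y \<in> I2" using I2mem I.zero_closed by blast
    then have yI2: "y \<in> I2" using yc by simp
    have I2L: "I2 \<subseteq> ?L"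
    proof
      fix z assume "z \<in> I2"
      then obtain i q where "i \<in> I" "q \<in> carrier R" "z = i \<oplus> q \<otimes> y" using I2mem by blast
      then show "z \<in> ?L" using I(3) y(1) L.I_l_closed L.a_closed by auto
    qed
    \<comment> \<open>By maximality of \<open>I\<close>, the single element \<open>y\<close>
      generates the truncation modulo \<open>I\<close>.\<close>
    have I2eq: "I2 = ?L"
    proof (rule ccontr)
      assume "I2 \<noteq> ?L"
      then have "I2 \<in> \<F>" unfolding \<F>_def using I2 I2L II2 I(2) by blast
      then show False using I'(2) II2 yI2 y(2) by blast
    qed
    \<comment> \<open>K = I + J y. It will contain the degree-n components of all elements of
      \<open>J\<close>: these are sums of products of elements of \<open>S\<close> and R_n, and R_n
      lies in I + R y.\<close>
    define K where "K = {i \<oplus> c \<otimes> y |i c. i \<in> I \<and> c \<in> J}"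
    have Jc: "c \<in> carrier R" if "c \<in> J" for c using that by (rule J.Icarr)
    have KI: "i \<oplus> c \<otimes> y \<in> K" if "i \<in> I" "c \<in> J" for i c using that unfolding K_def by blast
    have K: "additive_subgroup K R"
    proof (rule additive_subgroupI)
      show "K \<subseteq> carrier R" unfolding K_def using I.Icarr Jc yc by auto
      show "\<zero> \<in> K" using KI[OF I.zero_closed J.zero_closed] yc by simp
    next
      fix u v assume "u \<in> K" "v \<in> K"
      then obtain i c i' c' where *: "u = i \<oplus> c \<otimes> y" "v = i' \<oplus> c' \<otimes> y" "i \<in> I" "c \<in> J" "i' \<in> I" "c' \<in> J"
        unfolding K_def by blast
      have "u \<oplus> v = (i \<oplus> i') \<oplus> (c \<oplus> c') \<otimes> y"
        using * I.Icarr Jc yc by (simp add: l_distr ring_a_ac)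
      then show "u \<oplus> v \<in> K" using KI[of "i \<oplus> i'" "c \<oplus> c'"] * by simp
    next
      fix u assume "u \<in> K"
      then obtain i c where *: "u = i \<oplus> c \<otimes> y" "i \<in> I" "c \<in> J"
        unfolding K_def by blast
      have "\<ominus> u = \<ominus> i \<oplus> (\<ominus> c) \<otimes> y"
        using * I.Icarr Jc yc by (simp add: l_minus ring_minus_add)
      then show "\<ominus> u \<in> K" using KI[of "\<ominus> i" "\<ominus> c"] * additive_subgroup.a_inv_closed[OF I.additive_subgroup_axioms]
        additive_subgroup.a_inv_closed[OF J.additive_subgroup_axioms] by simp
    qed
    interpret K: additive_subgroup K R by (rule K)
    \<comment> \<open>Quantifying over all multiples makes \<open>P\<close> an ideal, so that it
      contains \<open>J\<close> as soon as it contains \<open>S\<close>.\<close>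
    define P where "P = {b \<in> carrier R. \<forall>q\<in>carrier R. deg.comp (q \<otimes> b) n \<in> K}"
    have "ideal P R"
    proof (rule subset_ideal_if[OF std])
      show "additive_subgroup P R"
        by (rule additive_subgroupI)
          (auto simp: P_def r_distr r_minus deg.comp_zero deg.comp_add deg.comp_inv)
      fix b z assume "b \<in> \<A> 0 \<union> \<A> 1" "z \<in> P"
      moreover from this have "b \<in> carrier R" using Acar by blast
      ultimately show "b \<otimes> z \<in> P" unfolding P_def by (auto simp: m_assoc[symmetric])
    qed
    moreover have "S \<subseteq> P"
    proof
      fix s assume s: "s \<in> S"
      have s0: "s \<in> \<A> 0" and sc: "s \<in> carrier R" and sJ: "s \<in> J" using s S Sc SJ by auto
      have "deg.comp (q \<otimes> s) n \<in> K" if q: "q \<in> carrier R" for q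
      proof -
        have "deg.comp q n \<in> I2" unfolding I2eq by (rule degree_order_ge[OF deg.comp_props(1)[OF q]])
        then obtain i p where ip: "i \<in> I" "p \<in> carrier R" "deg.comp q n = i \<oplus> p \<otimes> y" using I2mem by blast
        have "deg.comp (q \<otimes> s) n = s \<otimes> deg.comp q n"
          using comp_mult_zero[OF s0 q] q sc by (simp add: m_comm)
        also have "\<dots> = s \<otimes> i \<oplus> (s \<otimes> p) \<otimes> y"
          using ip I.Icarr sc yc by (simp add: r_distr m_assoc)
        also have "\<dots> \<in> K" using KI[OF I.I_l_closed[OF ip(1) sc] J.I_r_closed[OF sJ ip(2)]] .
        finally show ?thesis .
      qed
      then show "s \<in> P" unfolding P_def using sc by blast
    qed
    ultimately have JP: "J \<subseteq> P" unfolding J_def by (rule genideal_minimal)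
    define yn where "yn = deg.comp y n"
    have yn: "yn \<in> \<A> n" "yn \<in> carrier R" unfolding yn_def using deg.comp_props(1)[OF yc] deg.comp_carrier[OF yc] by auto
    \<comment> \<open>The hypothesis, applied to \<open>yn\<close>. Comparing components of degree n
      + e allows \<open>b\<close> to be replaced by its component of degree \<open>n\<close>, which
      lies in \<open>K\<close>.\<close>
    obtain b where b: "b \<in> J" "yn \<odot>\<^bsub>M\<^esub> x = b \<odot>\<^bsub>M\<^esub> x" using ax[OF yn(1)] unfolding J_def by blast
    define bn where "bn = deg.comp b n"
    have bn: "bn \<in> \<A> n" "bn \<in> carrier R" unfolding bn_def using deg.comp_props(1)[OF Jc[OF b(1)]] deg.comp_carrier[OF Jc[OF b(1)]] by auto
    have bnx: "yn \<odot>\<^bsub>M\<^esub> x = bn \<odot>\<^bsub>M\<^esub> x"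
      using comp_smult_homogeneous[OF x Jc[OF b(1)], of n] comp_smult_homogeneous[OF x yn(2), of n] b(2)
      by (simp add: bn_def deg.comp_homogeneous[OF yn(1)])
    have "deg.comp (\<one> \<otimes> b) n \<in> K" using JP b(1) unfolding P_def by blast
    then obtain i c where ic: "bn = i \<oplus> c \<otimes> y" "i \<in> I" "c \<in> J" unfolding K_def bn_def using Jc[OF b(1)] by auto
    have ccar: "c \<in> carrier R" using Jc ic by blast
    have ybU: "y \<ominus> bn \<in> U"
    proof -
      have "y \<ominus> bn \<in> ?L"
        unfolding ring_minus_eq using y(1) degree_order_ge[OF bn(1)] L.a_closed
          additive_subgroup.a_inv_closed[OF order_ge_add] by blast
      moreover have "deg.comp (y \<ominus> bn) n = yn \<oplus> \<ominus> bn"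
        unfolding ring_minus_eq yn_def using yc bn by (simp add: deg.comp_add deg.comp_inv deg.comp_homogeneous[OF bn(1)])
      ultimately show ?thesis unfolding U_def using bnx xc yn bn
        by (simp add: smult_l_distr smult_l_minus M.r_neg)
    qed
    define c0 where "c0 = deg.comp c 0"
    have c0: "c0 \<in> \<A> 0" "c0 \<in> carrier R" unfolding c0_def using deg.comp_props(1)[OF ccar] deg.comp_carrier[OF ccar] by auto
    have "c \<ominus> c0 \<in> irrelevant_ideal R \<A>"
      unfolding irrelevant_ideal_eq ring_minus_eq using ccar c0
      by (simp add: deg.comp_add deg.comp_inv deg.comp_homogeneous[OF c0(1)]) (simp add: c0_def ring_r_neg deg.comp_carrier)
    \<comment> \<open>R_+ moves \<open>y\<close> into the next truncation and hence into
      \<open>U\<close>; modulo \<open>I\<close> the coefficient \<open>c\<close> therefore acts on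
      \<open>y\<close> like \<open>c0\<close>.\<close>
    then have ccU: "(c \<ominus> c0) \<otimes> y \<in> U"
      using irrelevant_mult_order_ge[OF _ y(1)] LU by blast
    \<comment> \<open>Thus \<open>y\<close> is congruent to \<open>c0\<close> times \<open>y\<close>
      modulo \<open>I\<close>. As \<open>c0\<close> lies in the maximal ideal, 1 - c0 is a unit of
      R_0 and \<open>y\<close> falls into \<open>I\<close>, a contradiction.\<close>
    have "(\<one> \<ominus> c0) \<otimes> y = ((y \<ominus> bn) \<oplus> i) \<oplus> (c \<ominus> c0) \<otimes> y"
      unfolding ic(1) using yc I.Icarr[OF ic(2)] ccar c0(2) by algebra
    moreover have "\<dots> \<in> I"
      using ybU ccU I(2) ic(2) by (auto intro!: I.a_closed)
    ultimately have mem: "(\<one> \<ominus> c0) \<otimes> y \<in> I" by simp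
    have "\<one> \<ominus> c0 \<notin> \<mm>"
    proof
      assume 1: "\<one> \<ominus> c0 \<in> \<mm>"
      let ?R0 = "degree_zero_ring R \<A>"
      have R0: "carrier ?R0 = \<A> 0" "add ?R0 = add R" "monoid.mult ?R0 = monoid.mult R" "\<one>\<^bsub>?R0\<^esub> = \<one>" "\<zero>\<^bsub>?R0\<^esub> = \<zero>"
        by (auto simp: degree_zero_ring_def)
      interpret mm: maximalideal \<mm> ?R0 using loc unfolding is_local_ring_def by blast
      have mmA: "z \<in> \<mm> \<Longrightarrow> z \<in> \<A> 0" for z using mm.Icarr by (simp add: R0)
      have "additive_subgroup \<mm> R"
      proof (rule additive_subgroupI)
        show "\<mm> \<subseteq> carrier R" using mmA Acar by blast
        show "\<zero> \<in> \<mm>" using additive_subgroup.zero_closed[OF mm.additive_subgroup_axioms] by (simp add: R0)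
        show "u \<oplus> v \<in> \<mm>" if "u \<in> \<mm>" "v \<in> \<mm>" for u v
          using additive_subgroup.a_closed[OF mm.additive_subgroup_axioms that] by (simp add: R0)
        fix u assume u: "u \<in> \<mm>"
        have "(\<ominus> \<one>) \<otimes>\<^bsub>?R0\<^esub> u \<in> \<mm>"
          by (rule mm.I_l_closed[OF u]) (use deg.piece_inv[OF one_degree_zero] in \<open>simp add: R0\<close>)
        then show "\<ominus> u \<in> \<mm>" using Acar[OF mmA[OF u]] by (simp add: R0 l_minus)
      qed
      then interpret mR: additive_subgroup \<mm> R .
      have "ideal {c \<in> carrier R. deg.comp c 0 \<in> \<mm>} R"
      proof (rule subset_ideal_if[OF std])
        show "additive_subgroup {c \<in> carrier R. deg.comp c 0 \<in> \<mm>} R"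
          by (rule additive_subgroupI) (auto simp: deg.comp_zero deg.comp_add deg.comp_inv)
        fix b z assume "b \<in> \<A> 0 \<union> \<A> 1" "z \<in> {c \<in> carrier R. deg.comp c 0 \<in> \<mm>}"
        then show "b \<otimes> z \<in> {c \<in> carrier R. deg.comp c 0 \<in> \<mm>}"
          using mm.I_l_closed[of "deg.comp z 0" b] Acar by (auto simp: comp_mult_zero comp_mult_one R0)
      qed
      moreover have "S \<subseteq> {c \<in> carrier R. deg.comp c 0 \<in> \<mm>}"
        using S Sc by (auto simp: deg.comp_homogeneous subset_iff)
      ultimately have "J \<subseteq> {c \<in> carrier R. deg.comp c 0 \<in> \<mm>}" unfolding J_def by (rule genideal_minimal)
      then have "c0 \<in> \<mm>" unfolding c0_def using ic(3) by blast
      then have "(\<one> \<ominus> c0) \<oplus> c0 \<in> \<mm>" using 1 mR.a_closed by blast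
      moreover have "(\<one> \<ominus> c0) \<oplus> c0 = \<one>" using c0(2) by algebra
      ultimately have "\<one> \<in> \<mm>" by simp
      then show False using mm.one_imp_carrier mm.I_notcarr by (simp add: R0)
    qed
    moreover have "\<one> \<ominus> c0 \<in> \<A> 0"
      unfolding ring_minus_eq using deg.piece_add one_degree_zero deg.piece_inv c0(1) by blast
    ultimately obtain u where u: "u \<in> \<A> 0" "u \<otimes> (\<one> \<ominus> c0) = \<one>"
      using unit_if_not_in_maximal[OF loc] by blast
    have "u \<otimes> ((\<one> \<ominus> c0) \<otimes> y) \<in> I" using I.I_l_closed[OF mem] Acar u(1) by blast
    moreover have "u \<otimes> ((\<one> \<ominus> c0) \<otimes> y) = (u \<otimes> (\<one> \<ominus> c0)) \<otimes> y"
      using yc c0(2) Acar[OF u(1)] by (simp add: m_assoc)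
    ultimately show False using u(2) y(2) yc by simp
  qed
  then have "a \<in> U" using degree_order_ge[OF a] by blast
  then show ?thesis unfolding U_def using a by (simp add: deg.comp_homogeneous)
qed

end

section \<open>Torsion with respect to a pair of ideals\<close>

lemma (in cring) ideal_power_add:
  assumes I: "ideal I R"
  shows "I [^]\<^bsub>ideals_set R\<^esub> (m + n :: nat) = (I [^]\<^bsub>ideals_set R\<^esub> m) \<cdot> (I [^]\<^bsub>ideals_set R\<^esub> n)"
proof -
  note P = ideal_power[OF I]
  have pow: "I [^]\<^bsub>ideals_set R\<^esub> (0::nat) = carrier R"
    "I [^]\<^bsub>ideals_set R\<^esub> Suc m = (I [^]\<^bsub>ideals_set R\<^esub> m) \<cdot> I" for m :: nat
    by (simp_all add: nat_pow_def ideals_set_def)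
  show ?thesis
  proof (induction n)
    case 0 show ?case unfolding pow(1) using ideal_prod_one[OF P[of m]] by simp
  next
    case (Suc n) show ?case
      unfolding add_Suc_right pow(2) Suc ideal_prod_assoc[OF P P I] ..
  qed
qed

text \<open>A copy of \<open>module\<close> to carry the general lemmas, interpreted over R as well
  as over its degree-zero ring.\<close>

locale plain_module = module R M for R :: "('a, 'r) ring_scheme" (structure) and M :: "('a, 'm) module" (structure)
begin

lemma pair_torsion_iff:
  "x \<in> pair_torsion R I J M \<longleftrightarrow> x \<in> carrier M \<and>
     (\<exists>n\<ge>1. \<forall>a\<in>I [^]\<^bsub>ideals_set R\<^esub> (n::nat). \<exists>b\<in>J. a \<odot>\<^bsub>M\<^esub> x = b \<odot>\<^bsub>M\<^esub> x)"
  unfolding pair_torsion_def by (auto simp: image_subset_iff)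

text \<open>The delicate point is closure under sums: the multipliers in \<open>J\<close> found for
  \<open>x\<close> and for \<open>y\<close> differ, and one multiplier has to serve both. The
  exponent \<open>n + m\<close> leaves room for this.\<close>

lemma pair_torsion_submodule:
  assumes I: "ideal I R" and J: "ideal J R"
  shows "submodule (pair_torsion R I J M) R M"
proof -
  interpret J: ideal J R by fact
  let ?P = "\<lambda>n. I [^]\<^bsub>ideals_set R\<^esub> (n::nat)"
  have P: "ideal (?P n) R" for n by (rule R.ideal_power[OF I])
  have smult: "a \<odot>\<^bsub>M\<^esub> x \<in> pair_torsion R I J M" if a: "a \<in> carrier R" and x: "x \<in> pair_torsion R I J M" for a x
  proof -
    obtain n where n: "x \<in> carrier M" "n \<ge> 1" "\<And>c. c \<in> ?P n \<Longrightarrow> \<exists>b\<in>J. c \<odot>\<^bsub>M\<^esub> x = b \<odot>\<^bsub>M\<^esub> x"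
      using x unfolding pair_torsion_iff by blast
    have "\<exists>b\<in>J. c \<odot>\<^bsub>M\<^esub> (a \<odot>\<^bsub>M\<^esub> x) = b \<odot>\<^bsub>M\<^esub> (a \<odot>\<^bsub>M\<^esub> x)" if c: "c \<in> ?P n" for c
    proof -
      obtain b where b: "b \<in> J" "c \<odot>\<^bsub>M\<^esub> x = b \<odot>\<^bsub>M\<^esub> x" using n(3)[OF c] by blast
      have cc: "c \<in> carrier R" "b \<in> carrier R" using ideal.Icarr[OF P c] J.Icarr b by auto
      have "c \<odot>\<^bsub>M\<^esub> (a \<odot>\<^bsub>M\<^esub> x) = a \<odot>\<^bsub>M\<^esub> (c \<odot>\<^bsub>M\<^esub> x)"
        using a n cc by (simp add: smult_assoc1[symmetric] R.m_comm)
      also have "\<dots> = b \<odot>\<^bsub>M\<^esub> (a \<odot>\<^bsub>M\<^esub> x)"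
        unfolding b(2) using a n cc by (simp add: smult_assoc1[symmetric] R.m_comm)
      finally show ?thesis using b(1) by blast
    qed
    then show ?thesis unfolding pair_torsion_iff using n a by auto
  qed
  have zero: "\<zero>\<^bsub>M\<^esub> \<in> pair_torsion R I J M"
    unfolding pair_torsion_iff
    by (intro conjI exI[of _ "1::nat"] ballI bexI[of _ "\<zero>"])
      (use additive_subgroup.zero_closed[OF J.additive_subgroup_axioms] in \<open>simp_all add: ideal.Icarr[OF P[of 1]] del: One_nat_def nat_pow_Suc\<close>)
  have add: "x \<oplus>\<^bsub>M\<^esub> y \<in> pair_torsion R I J M"
    if x: "x \<in> pair_torsion R I J M" and y: "y \<in> pair_torsion R I J M" for x y
  proof -
    obtain n where n: "x \<in> carrier M" "n \<ge> 1" "\<And>c. c \<in> ?P n \<Longrightarrow> \<exists>b\<in>J. c \<odot>\<^bsub>M\<^esub> x = b \<odot>\<^bsub>M\<^esub> x"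
      using x unfolding pair_torsion_iff by blast
    obtain m where m: "y \<in> carrier M" "m \<ge> 1" "\<And>c. c \<in> ?P m \<Longrightarrow> \<exists>b\<in>J. c \<odot>\<^bsub>M\<^esub> y = b \<odot>\<^bsub>M\<^esub> y"
      using y unfolding pair_torsion_iff by blast
    have "\<exists>b\<in>J. c \<odot>\<^bsub>M\<^esub> x = b \<odot>\<^bsub>M\<^esub> x \<and> c \<odot>\<^bsub>M\<^esub> y = b \<odot>\<^bsub>M\<^esub> y" if "c \<in> ?P (n + m)" for c
      using that unfolding R.ideal_power_add[OF I]
    proof induction
      case (prod u v)
      obtain b where b: "b \<in> J" "u \<odot>\<^bsub>M\<^esub> x = b \<odot>\<^bsub>M\<^esub> x" using n(3)[OF prod(1)] by blast
      obtain b' where b': "b' \<in> J" "v \<odot>\<^bsub>M\<^esub> y = b' \<odot>\<^bsub>M\<^esub> y" using m(3)[OF prod(2)] by blast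
      have c: "u \<in> carrier R" "v \<in> carrier R" "b \<in> carrier R" "b' \<in> carrier R"
        using ideal.Icarr[OF P] prod J.Icarr b b' by auto
      \<comment> \<open>Chosen such that u v - w = (u - b)(v - b'). The first factor kills
        \<open>x\<close> and the second kills \<open>y\<close>, so \<open>w\<close> acts like u v on
        both.\<close>
      define w where "w = (u \<otimes> b' \<oplus> b \<otimes> v) \<oplus> \<ominus> (b \<otimes> b')"
      have wJ: "w \<in> J" unfolding w_def
        using b b' c J.I_l_closed J.I_r_closed additive_subgroup.a_inv_closed[OF J.additive_subgroup_axioms] by simp
      have "(v \<otimes> b) \<odot>\<^bsub>M\<^esub> x = (v \<otimes> u) \<odot>\<^bsub>M\<^esub> x" "(b' \<otimes> b) \<odot>\<^bsub>M\<^esub> x = (b' \<otimes> u) \<odot>\<^bsub>M\<^esub> x"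
        using c n b(2) by (simp_all add: smult_assoc1)
      moreover have "w = v \<otimes> b \<oplus> (b' \<otimes> u \<oplus> \<ominus> (b' \<otimes> b))" unfolding w_def using c by algebra
      ultimately have "w \<odot>\<^bsub>M\<^esub> x = (v \<otimes> u) \<odot>\<^bsub>M\<^esub> x"
        using c n by (simp add: smult_l_distr smult_l_minus M.r_neg)
      moreover have "(u \<otimes> b') \<odot>\<^bsub>M\<^esub> y = (u \<otimes> v) \<odot>\<^bsub>M\<^esub> y" "(b \<otimes> b') \<odot>\<^bsub>M\<^esub> y = (b \<otimes> v) \<odot>\<^bsub>M\<^esub> y"
        using c m b'(2) by (simp_all add: smult_assoc1)
      then have "w \<odot>\<^bsub>M\<^esub> y = (u \<otimes> v) \<odot>\<^bsub>M\<^esub> y"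
        unfolding w_def using c m by (simp add: smult_l_distr smult_l_minus M.a_assoc M.r_neg)
      ultimately show ?case using wJ c by (intro bexI[of _ w]) (auto simp: R.m_comm)
    next
      case (sum s1 s2)
      then obtain b1 b2 where "b1 \<in> J" "b2 \<in> J" "s1 \<odot>\<^bsub>M\<^esub> x = b1 \<odot>\<^bsub>M\<^esub> x" "s1 \<odot>\<^bsub>M\<^esub> y = b1 \<odot>\<^bsub>M\<^esub> y"
        "s2 \<odot>\<^bsub>M\<^esub> x = b2 \<odot>\<^bsub>M\<^esub> x" "s2 \<odot>\<^bsub>M\<^esub> y = b2 \<odot>\<^bsub>M\<^esub> y" by blast
      moreover have "s1 \<in> carrier R" "s2 \<in> carrier R"
        using sum(1,2) R.ideal_prod_in_carrier[OF P P] by blast+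
      ultimately show ?case using n(1) m(1) J.Icarr
        by (intro bexI[of _ "b1 \<oplus> b2"]) (auto simp: smult_l_distr)
    qed
    then have "\<exists>b\<in>J. c \<odot>\<^bsub>M\<^esub> (x \<oplus>\<^bsub>M\<^esub> y) = b \<odot>\<^bsub>M\<^esub> (x \<oplus>\<^bsub>M\<^esub> y)" if "c \<in> ?P (n + m)" for c
      using that n(1) m(1) J.Icarr ideal.Icarr[OF P that] by (metis smult_r_distr)
    moreover have "n + m \<ge> 1" using n by simp
    ultimately show ?thesis unfolding pair_torsion_iff using n(1) m(1) by blast
  qed
  show ?thesis
  proof (rule submoduleI)
    fix a assume a: "a \<in> pair_torsion R I J M"
    then have "a \<in> carrier M" unfolding pair_torsion_iff by blast
    then show "\<ominus>\<^bsub>M\<^esub> a \<in> pair_torsion R I J M"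
      using smult[of "\<ominus> \<one>" a] a by (simp add: smult_l_minus)
  qed (use zero add smult in \<open>auto simp: pair_torsion_iff\<close>)
qed

lemma pair_torsion_one:
  assumes I: "ideal I R" and "J = carrier R"
  shows "pair_torsion R I J M = carrier M"
proof -
  have "I [^]\<^bsub>ideals_set R\<^esub> (1::nat) \<subseteq> carrier R"
    using ideal.Icarr[OF R.ideal_power[OF I]] by blast
  then show ?thesis using assms(2) unfolding pair_torsion_def by (auto intro!: exI[of _ 1])
qed

lemma smult_pow: "a \<in> carrier R \<Longrightarrow> x \<in> carrier M \<Longrightarrow> ((\<lambda>y. a \<odot>\<^bsub>M\<^esub> y) ^^ m) x = (a [^] m) \<odot>\<^bsub>M\<^esub> x"
  by (induction m) (auto simp: smult_assoc1[symmetric] R.m_comm)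

end

sublocale graded_module \<subseteq> plain_module R M ..

context std_graded_module
begin

lemma power_degree: "a \<in> \<A> 1 \<Longrightarrow> a [^] (m::nat) \<in> \<A> m"
  using mult_degree[of _ _ a 1] by (induction m) (auto simp: one_degree_zero)

text \<open>R_n lies in the \<open>n\<close>-th power of R_+, so R_n x is contained in J x and
  vanishes by Nakayama's lemma; the power f^n belongs to R_n.\<close>

lemma pair_torsion_homogeneous_nilpotent:
  assumes loc: "is_local_ring (degree_zero_ring R \<A>) \<mm>" and S: "S \<subseteq> \<A> 0" "S \<subseteq> \<mm>"
    and x: "x \<in> \<M> e" "x \<in> pair_torsion R (irrelevant_ideal R \<A>) (Idl S) M" and f: "f \<in> \<A> 1"
  shows "\<exists>m::nat. (f [^] m) \<odot>\<^bsub>M\<^esub> x = \<zero>\<^bsub>M\<^esub>"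
proof -
  obtain n where n: "\<And>a. a \<in> irrelevant_ideal R \<A> [^]\<^bsub>ideals_set R\<^esub> (n::nat) \<Longrightarrow> \<exists>b\<in>Idl S. a \<odot>\<^bsub>M\<^esub> x = b \<odot>\<^bsub>M\<^esub> x"
    using x(2) unfolding pair_torsion_iff by blast
  have "(f [^] n) \<odot>\<^bsub>M\<^esub> x = \<zero>\<^bsub>M\<^esub>"
    by (rule annihilated_if_multiples_in_maximal[OF loc S x(1) _ power_degree[OF f]])
      (use n degree_in_irrelevant_power in blast)
  then show ?thesis by blast
qed

text \<open>The pigeonhole principle for products of N + 1 generators, as an induction on
  \<open>N\<close>: passing from \<open>x\<close> to f_i x lowers the exponent \<open>m i\<close> by
  one, and if \<open>m i\<close> is already zero then \<open>x\<close> is zero.\<close>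

lemma irrelevant_power_annihilates:
  assumes gen: "generates_degree_one f r"
  shows "x \<in> carrier M \<Longrightarrow> (\<And>i. i < r \<Longrightarrow> (f i [^] m i) \<odot>\<^bsub>M\<^esub> x = \<zero>\<^bsub>M\<^esub>) \<Longrightarrow> (\<Sum>i<r. m i) \<le> N \<Longrightarrow>
    a \<in> irrelevant_ideal R \<A> [^]\<^bsub>ideals_set R\<^esub> Suc N \<Longrightarrow> a \<odot>\<^bsub>M\<^esub> x = \<zero>\<^bsub>M\<^esub>"
proof (induction N arbitrary: x m a)
  have f: "f i \<in> carrier R" for i using gen deg.piece_carrier unfolding generates_degree_one_def by blast
  \<comment> \<open>R_+ is generated by the f_i, so it is enough that the \<open>N\<close>-th power
    kills every f_i x.\<close>
  have step: "a \<odot>\<^bsub>M\<^esub> x = \<zero>\<^bsub>M\<^esub>"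
    if x: "x \<in> carrier M" and kill: "\<And>i b. i < r \<Longrightarrow> b \<in> irrelevant_ideal R \<A> [^]\<^bsub>ideals_set R\<^esub> N \<Longrightarrow> b \<odot>\<^bsub>M\<^esub> (f i \<odot>\<^bsub>M\<^esub> x) = \<zero>\<^bsub>M\<^esub>"
      and a: "a \<in> irrelevant_ideal R \<A> [^]\<^bsub>ideals_set R\<^esub> Suc N" for x N a
  proof -
    let ?P = "irrelevant_ideal R \<A> [^]\<^bsub>ideals_set R\<^esub> N"
    interpret P: ideal ?P R by (rule ideal_irrelevant_power)
    have "a \<in> ?P \<cdot> irrelevant_ideal R \<A>" using a by (simp add: nat_pow_def ideals_set_def)
    then show ?thesis
    proof induction
      case (prod p z)
      define K where "K = {z \<in> carrier R. \<forall>b\<in>?P. (b \<otimes> z) \<odot>\<^bsub>M\<^esub> x = \<zero>\<^bsub>M\<^esub>}"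
      have "additive_subgroup K R"
        by (rule additive_subgroupI) (use x P.Icarr in \<open>auto simp: K_def r_distr r_minus smult_l_distr smult_l_minus\<close>)
      then have "ideal K R"
      proof (rule subset_ideal_if[OF std])
        fix c z assume "c \<in> \<A> 0 \<union> \<A> 1" "z \<in> K"
        moreover from this have c: "c \<in> carrier R" using deg.piece_carrier by blast
        moreover have "b \<otimes> (c \<otimes> z) = (b \<otimes> c) \<otimes> z" if "b \<in> ?P" for b
          using that P.Icarr c \<open>z \<in> K\<close> by (simp add: m_assoc K_def)
        ultimately show "c \<otimes> z \<in> K" using P.I_r_closed unfolding K_def by auto
      qed
      moreover have "f i \<in> K" if "i < r" for i
        using kill[OF that] f x P.Icarr unfolding K_def by (auto simp: smult_assoc1)
      ultimately have "irrelevant_ideal R \<A> \<subseteq> K" by (rule irrelevant_ideal_subset[OF gen])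
      then show ?case using prod unfolding K_def by blast
    next
      case (sum s1 s2)
      moreover have "s1 \<in> carrier R" "s2 \<in> carrier R"
        using sum(1,2) ideal_prod_in_carrier[OF P.ideal_axioms ideal_irrelevant] by blast+
      ultimately show ?case using x by (simp add: smult_l_distr)
    qed
  qed
  {
    case 0
    have "x = \<zero>\<^bsub>M\<^esub>" if i: "i < r" for i
    proof -
      have "m i = 0" using 0(3) i by (simp add: sum_eq_0_iff)
      then show ?thesis using 0(2)[OF i] 0(1) by simp
    qed
    then show ?case
    proof (intro step[OF 0(1) _ 0(4)])
      fix i b assume "i < r" and b: "b \<in> irrelevant_ideal R \<A> [^]\<^bsub>ideals_set R\<^esub> (0::nat)"
      then have "x = \<zero>\<^bsub>M\<^esub>" using \<open>\<And>i. i < r \<Longrightarrow> x = \<zero>\<^bsub>M\<^esub>\<close> by blast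
      then show "b \<odot>\<^bsub>M\<^esub> (f i \<odot>\<^bsub>M\<^esub> x) = \<zero>\<^bsub>M\<^esub>"
        using ideal.Icarr[OF ideal_irrelevant_power b] f by simp
    qed
  next
    case (Suc N)
    show ?case
    proof (rule step[OF Suc.prems(1) _ Suc.prems(4)])
      fix i b assume i: "i < r" and b: "b \<in> irrelevant_ideal R \<A> [^]\<^bsub>ideals_set R\<^esub> Suc N"
      show "b \<odot>\<^bsub>M\<^esub> (f i \<odot>\<^bsub>M\<^esub> x) = \<zero>\<^bsub>M\<^esub>"
      proof (cases "m i")
        case 0
        then have "x = \<zero>\<^bsub>M\<^esub>" using Suc.prems(1) Suc.prems(2)[OF i] by simp
        then show ?thesis using f ideal.Icarr[OF ideal_irrelevant_power b] by simp
      next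
        case (Suc l)
        show ?thesis
        proof (rule Suc.IH[where m = "m(i := l)"])
          show "f i \<odot>\<^bsub>M\<^esub> x \<in> carrier M" using f Suc.prems(1) by simp
          show "(f j [^] (m(i := l)) j) \<odot>\<^bsub>M\<^esub> (f i \<odot>\<^bsub>M\<^esub> x) = \<zero>\<^bsub>M\<^esub>" if j: "j < r" for j
          proof (cases "j = i")
            case True
            then show ?thesis using Suc.prems(2)[OF i] Suc f Suc.prems(1) by (simp add: smult_assoc1[symmetric])
          next
            case False
            have "(f j [^] m j) \<odot>\<^bsub>M\<^esub> (f i \<odot>\<^bsub>M\<^esub> x) = f i \<odot>\<^bsub>M\<^esub> ((f j [^] m j) \<odot>\<^bsub>M\<^esub> x)"
              using f Suc.prems(1) by (simp add: smult_assoc1[symmetric] m_comm)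
            then show ?thesis using False Suc.prems(2)[OF j] f by simp
          qed
          have "(\<Sum>j<r. (m(i := l)) j) + 1 = (\<Sum>j<r. m j)"
            using i Suc by (simp add: sum.remove[of "{..<r}" i])
          then show "(\<Sum>j<r. (m(i := l)) j) \<le> N" using Suc.prems(3) by simp
        qed (rule b)
      qed
    qed
  }
qed

lemma pair_torsion_if_nilpotent:
  assumes gen: "generates_degree_one f r" and x: "x \<in> carrier M" and J: "\<zero> \<in> J"
    and nil: "\<And>i. i < r \<Longrightarrow> \<exists>m::nat. (f i [^] m) \<odot>\<^bsub>M\<^esub> x = \<zero>\<^bsub>M\<^esub>"
  shows "x \<in> pair_torsion R (irrelevant_ideal R \<A>) J M"
proof -
  obtain m :: "nat \<Rightarrow> nat" where "\<And>i. i < r \<Longrightarrow> (f i [^] m i) \<odot>\<^bsub>M\<^esub> x = \<zero>\<^bsub>M\<^esub>" using nil by metis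
  from irrelevant_power_annihilates[OF gen x this order_refl]
  show ?thesis unfolding pair_torsion_iff using x J
    by (intro conjI exI[of _ "Suc (\<Sum>i<r. m i)"] ballI bexI[of _ "\<zero>"]) (simp_all del: nat_pow_Suc)
qed

end

section \<open>Baer extension from homogeneous ideals\<close>

text \<open>The ideal as a module on a copy of itself in \<open>'a + 'e\<close>, the type over which
  \<open>graded_injective\<close> quantifies.\<close>

definition shifted_ideal :: "('a, 'r) ring_scheme \<Rightarrow> 'a set \<Rightarrow> ('a, 'a + 'e) module" where
  "shifted_ideal R C = \<lparr>carrier = Inl ` C, monoid.mult = undefined, one = undefined, ring.zero = Inl \<zero>\<^bsub>R\<^esub>,
     ring.add = (\<lambda>u v. Inl (projl u \<oplus>\<^bsub>R\<^esub> projl v)), smult = (\<lambda>a u. Inl (a \<otimes>\<^bsub>R\<^esub> projl u))\<rparr>"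

text \<open>Ring degree \<open>d\<close> becomes module degree d + e. For the whole ring this is
  R(-e), with the unit in degree \<open>e\<close>.\<close>

definition shifted_grading :: "('a, 'r) ring_scheme \<Rightarrow> (nat \<Rightarrow> 'a set) \<Rightarrow> 'a set \<Rightarrow> int \<Rightarrow> int \<Rightarrow> ('a + 'e) set" where
  "shifted_grading R \<A> C e j = (if e \<le> j then Inl ` (C \<inter> \<A> (nat (j - e))) else {Inl \<zero>\<^bsub>R\<^esub>})"

lemma shifted_ideal_simps [simp]:
  "carrier (shifted_ideal R C) = Inl ` C" "\<zero>\<^bsub>shifted_ideal R C\<^esub> = Inl \<zero>\<^bsub>R\<^esub>"
  "Inl a \<oplus>\<^bsub>shifted_ideal R C\<^esub> Inl b = Inl (a \<oplus>\<^bsub>R\<^esub> b)" "c \<odot>\<^bsub>shifted_ideal R C\<^esub> Inl a = Inl (c \<otimes>\<^bsub>R\<^esub> a)"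
  by (auto simp: shifted_ideal_def)

context graded_ring
begin

lemma shifted_ideal_module:
  assumes C: "ideal C R"
  shows "module R (shifted_ideal R C :: ('a, 'a + 'e) module)"
proof -
  interpret C: ideal C R by fact
  let ?M = "shifted_ideal R C :: ('a, 'a + 'e) module"
  have Cc: "c \<in> C \<Longrightarrow> c \<in> carrier R" for c by (rule C.Icarr)
  have Cinv: "c \<in> C \<Longrightarrow> \<ominus> c \<in> C" for c by (rule additive_subgroup.a_inv_closed[OF C.additive_subgroup_axioms])
  show ?thesis
  proof (rule moduleI)
    show "abelian_group ?M"
    proof (rule abelian_groupI)
      fix x assume "x \<in> carrier ?M"
      then obtain c where c: "x = Inl c" "c \<in> C" by auto
      have "Inl (\<ominus> c) \<oplus>\<^bsub>?M\<^esub> x = \<zero>\<^bsub>?M\<^esub>" using c Cc by (simp add: l_neg)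
      then show "\<exists>y\<in>carrier ?M. y \<oplus>\<^bsub>?M\<^esub> x = \<zero>\<^bsub>?M\<^esub>" using c Cinv by auto
    qed (use C.a_closed C.zero_closed Cc in \<open>auto simp: a_ac\<close>)
  qed (use is_cring C.I_l_closed Cc in \<open>auto simp: l_distr r_distr m_assoc\<close>)
qed

lemma shifted_finsum:
  assumes C: "ideal C R" and F: "finite F" "c \<in> F \<rightarrow> C"
  shows "(\<Oplus>\<^bsub>shifted_ideal R C\<^esub> i\<in>F. Inl (c i)) = (Inl (\<Oplus>i\<in>F. c i) :: 'a + 'e)"
proof -
  interpret S: module R "shifted_ideal R C :: ('a, 'a + 'e) module" by (rule shifted_ideal_module[OF C])
  have Cc: "x \<in> C \<Longrightarrow> x \<in> carrier R" for x by (rule ideal.Icarr[OF C])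
  show ?thesis using F
  proof (induction F)
    case empty show ?case by simp
  next
    case (insert a F)
    then have *: "c \<in> F \<rightarrow> carrier R" "c a \<in> carrier R" "(\<lambda>i. Inl (c i) :: 'a + 'e) \<in> F \<rightarrow> carrier (shifted_ideal R C)"
      using Cc by auto
    have "(\<Oplus>\<^bsub>shifted_ideal R C\<^esub> i\<in>insert a F. Inl (c i)) = Inl (c a) \<oplus>\<^bsub>shifted_ideal R C\<^esub> ((\<Oplus>\<^bsub>shifted_ideal R C\<^esub> i\<in>F. Inl (c i)) :: 'a + 'e)"
      by (rule S.M.finsum_insert) (use insert * in auto)
    also have "\<dots> = Inl (c a \<oplus> (\<Oplus>i\<in>F. c i))" using insert by simp
    also have "\<dots> = Inl (\<Oplus>i\<in>insert a F. c i)" using insert * by (simp add: finsum_insert)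
    finally show ?case .
  qed
qed

lemma shifted_ideal_graded:
  assumes C: "ideal C R" and hom: "\<And>c d. c \<in> C \<Longrightarrow> deg.comp c d \<in> C"
  shows "graded_module R \<A> (shifted_ideal R C :: ('a, 'a + 'e) module) (shifted_grading R \<A> C e)"
proof -
  interpret C: ideal C R by fact
  let ?M = "shifted_ideal R C :: ('a, 'a + 'e) module"
  let ?G = "shifted_grading R \<A> C e :: int \<Rightarrow> ('a + 'e) set"
  interpret S: module R ?M by (rule shifted_ideal_module[OF C])
  have Cc: "c \<in> C \<Longrightarrow> c \<in> carrier R" for c by (rule C.Icarr)
  have Cinv: "c \<in> C \<Longrightarrow> \<ominus> c \<in> C" for c by (rule additive_subgroup.a_inv_closed[OF C.additive_subgroup_axioms])
  have Minv: "\<ominus>\<^bsub>?M\<^esub> Inl c = Inl (\<ominus> c)" if "c \<in> C" for c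
    by (rule S.M.minus_equality) (use that Cc Cinv in \<open>auto simp: l_neg\<close>)
  have zero_in: "Inl \<zero> \<in> ?G j" for j
    using C.zero_closed deg.piece_zero by (auto simp: shifted_grading_def)
  have Gsub: "?G j \<subseteq> Inl ` C" for j
    using C.zero_closed by (auto simp: shifted_grading_def)
  have "additive_subgroup (?G j) ?M" for j
  proof (intro additive_subgroup.intro S.M.add.subgroupI)
    show "?G j \<subseteq> carrier ?M" using Gsub by simp
    show "?G j \<noteq> {}" using zero_in by blast
    show "\<ominus>\<^bsub>?M\<^esub> x \<in> ?G j" if x: "x \<in> ?G j" for x
    proof -
      obtain c where c: "x = Inl c" "c \<in> C" using x Gsub by blast
      have "\<ominus>\<^bsub>?M\<^esub> x = Inl (\<ominus> c)" using Minv[OF c(2)] c(1) by simp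
      then show ?thesis using x c Cinv deg.piece_inv by (auto simp: shifted_grading_def split: if_splits)
    qed
    show "x \<oplus>\<^bsub>?M\<^esub> y \<in> ?G j" if "x \<in> ?G j" "y \<in> ?G j" for x y
      using that C.a_closed deg.piece_add by (auto simp: shifted_grading_def split: if_splits)
  qed
  moreover have "\<exists>!c. (\<forall>n. c n \<in> ?G n) \<and> finite {n. c n \<noteq> \<zero>\<^bsub>?M\<^esub>} \<and> x = (\<Oplus>\<^bsub>?M\<^esub> n \<in> {n. c n \<noteq> \<zero>\<^bsub>?M\<^esub>}. c n)"
    if x: "x \<in> carrier ?M" for x
  proof -
    obtain a where a: "x = Inl a" "a \<in> C" using x by auto
    have ac: "a \<in> carrier R" using a Cc by blast
    define c0 :: "int \<Rightarrow> 'a + 'e" where "c0 j = (if e \<le> j then Inl (deg.comp a (nat (j - e))) else Inl \<zero>)" for j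
    define D where "D = {n. deg.comp a n \<noteq> \<zero>}"
    have D: "finite D" unfolding D_def by (rule deg.comp_props(2)[OF ac])
    have inj: "inj_on (\<lambda>d. int d + e) X" for X by (auto simp: inj_on_def)
    have supp: "{j. c0 j \<noteq> \<zero>\<^bsub>?M\<^esub>} = (\<lambda>d. int d + e) ` D"
    proof (intro equalityI subsetI)
      fix j assume "j \<in> {j. c0 j \<noteq> \<zero>\<^bsub>?M\<^esub>}"
      then show "j \<in> (\<lambda>d. int d + e) ` D"
        by (intro image_eqI[of _ _ "nat (j - e)"]) (auto simp: c0_def D_def split: if_splits)
    qed (auto simp: c0_def D_def)
    show ?thesis
    proof (rule ex1I[of _ c0], intro conjI allI)
      show "c0 n \<in> ?G n" for n
        using hom[OF a(2)] deg.comp_props(1)[OF ac] by (auto simp: c0_def shifted_grading_def)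
      show "finite {j. c0 j \<noteq> \<zero>\<^bsub>?M\<^esub>}" unfolding supp using D by simp
      have "(\<Oplus>\<^bsub>?M\<^esub> n \<in> {n. c0 n \<noteq> \<zero>\<^bsub>?M\<^esub>}. c0 n) = (\<Oplus>\<^bsub>?M\<^esub> d \<in> D. c0 (int d + e))"
        unfolding supp by (rule S.M.finsum_reindex[OF _ inj]) (use hom[OF a(2)] C.zero_closed in \<open>auto simp: c0_def\<close>)
      also have "\<dots> = (\<Oplus>\<^bsub>?M\<^esub> d \<in> D. Inl (deg.comp a d))" by (simp add: c0_def)
      also have "\<dots> = Inl (\<Oplus>d\<in>D. deg.comp a d)" by (rule shifted_finsum[OF C D]) (use hom[OF a(2)] in auto)
      also have "(\<Oplus>d\<in>D. deg.comp a d) = a" using deg.comp_props(3)[OF ac] unfolding D_def by simp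
      finally show "x = (\<Oplus>\<^bsub>?M\<^esub> n \<in> {n. c0 n \<noteq> \<zero>\<^bsub>?M\<^esub>}. c0 n)" using a by simp
    next
      fix c assume c: "(\<forall>n. c n \<in> ?G n) \<and> finite {n. c n \<noteq> \<zero>\<^bsub>?M\<^esub>} \<and> x = (\<Oplus>\<^bsub>?M\<^esub> n \<in> {n. c n \<noteq> \<zero>\<^bsub>?M\<^esub>}. c n)"
      define c' where "c' d = projl (c (int d + e))" for d :: nat
      have cG: "c n \<in> ?G n" for n using c by blast
      have c'1: "c (int d + e) = Inl (c' d)" "c' d \<in> C \<inter> \<A> d" for d
        using cG[of "int d + e"] unfolding c'_def shifted_grading_def by auto
      define D' where "D' = {d. c' d \<noteq> \<zero>}"
      have supp': "{n. c n \<noteq> \<zero>\<^bsub>?M\<^esub>} = (\<lambda>d. int d + e) ` D'"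
      proof (intro equalityI subsetI)
        fix j assume j: "j \<in> {n. c n \<noteq> \<zero>\<^bsub>?M\<^esub>}"
        have ej: "e \<le> j" using j cG[of j] by (auto simp: shifted_grading_def split: if_splits)
        then have "j = int (nat (j - e)) + e" by simp
        moreover from this have "nat (j - e) \<in> D'" using j c'1(1)[of "nat (j - e)"] unfolding D'_def by auto
        ultimately show "j \<in> (\<lambda>d. int d + e) ` D'" by blast
      qed (auto simp: c'1 D'_def)
      have D': "finite D'" using c finite_imageD[OF _ inj] unfolding supp' by blast
      have "x = (\<Oplus>\<^bsub>?M\<^esub> n \<in> {n. c n \<noteq> \<zero>\<^bsub>?M\<^esub>}. c n)" using c by blast
      also have "\<dots> = (\<Oplus>\<^bsub>?M\<^esub> d \<in> D'. c (int d + e))"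
        unfolding supp' by (rule S.M.finsum_reindex[OF _ inj]) (use c'1 in auto)
      also have "\<dots> = (\<Oplus>\<^bsub>?M\<^esub> d \<in> D'. Inl (c' d))" by (simp add: c'1)
      also have "\<dots> = Inl (\<Oplus>d\<in>D'. c' d)" by (rule shifted_finsum[OF C D']) (use c'1 in auto)
      finally have "a = (\<Oplus>d\<in>D'. c' d)" using a by simp
      then have cmp: "deg.comp a = c'"
        by (intro deg.comp_unique[OF D']) (use c'1 in \<open>auto simp: D'_def\<close>)
      show "c = c0"
      proof
        fix j show "c j = c0 j"
        proof (cases "e \<le> j")
          case True
          then show ?thesis using c'1(1)[of "nat (j - e)"] by (simp add: c0_def cmp)
        next
          case False
          then show ?thesis using cG[of j] by (simp add: c0_def shifted_grading_def)
        qed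
      qed
    qed
  qed
  ultimately have ids: "internal_direct_sum ?M ?G" unfolding internal_direct_sum_def by blast
  have smd: "a \<odot>\<^bsub>?M\<^esub> x \<in> ?G (int d + n)" if a: "a \<in> \<A> d" and x: "x \<in> ?G n" for a d x n
  proof (cases "e \<le> n")
    case True
    then obtain c where c: "x = Inl c" "c \<in> C" "c \<in> \<A> (nat (n - e))" using x by (auto simp: shifted_grading_def)
    have "a \<otimes> c \<in> \<A> (d + nat (n - e))" "a \<otimes> c \<in> C" using mult_degree[OF a c(3)] C.I_l_closed[OF c(2) deg.piece_carrier[OF a]] by auto
    moreover have "d + nat (n - e) = nat (int d + n - e)" using True by simp
    ultimately show ?thesis using True c by (auto simp: shifted_grading_def)
  next
    case False
    then have "x = Inl \<zero>" using x by (auto simp: shifted_grading_def)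
    then show ?thesis using zero_in deg.piece_carrier[OF a] by simp
  qed
  show ?thesis
    by (intro graded_module.intro graded_module_axioms.intro graded_ring_axioms S.module_axioms ids smd)
qed

text \<open>A homomorphism of degree \<open>e\<close> on a homogeneous ideal has degree zero on the
  shifted ideal, hence extends to the shifted ring; the image of the unit is the multiplier
  \<open>y\<close>.\<close>

lemma graded_injective_extend:
  fixes E :: "('a, 'e) module"
  assumes inj: "graded_injective R \<A> E \<E>" and C: "ideal C R" and hom: "\<And>c d. c \<in> C \<Longrightarrow> deg.comp c d \<in> C"
    and add: "\<And>a b. a \<in> C \<Longrightarrow> b \<in> C \<Longrightarrow> \<phi> (a \<oplus> b) = \<phi> a \<oplus>\<^bsub>E\<^esub> \<phi> b"
    and smult: "\<And>a b. a \<in> carrier R \<Longrightarrow> b \<in> C \<Longrightarrow> \<phi> (a \<otimes> b) = a \<odot>\<^bsub>E\<^esub> \<phi> b"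
    and phi: "\<And>c. c \<in> C \<Longrightarrow> \<phi> c \<in> carrier E"
    and degree: "\<And>c d. c \<in> C \<Longrightarrow> c \<in> \<A> d \<Longrightarrow> \<phi> c \<in> \<E> (int d + e)"
  shows "\<exists>y\<in>\<E> e. \<forall>c\<in>C. \<phi> c = c \<odot>\<^bsub>E\<^esub> y"
proof -
  interpret C: ideal C R by fact
  interpret E: graded_module R \<A> E \<E> using inj unfolding graded_injective_def by blast
  let ?A = "shifted_ideal R C :: ('a, 'a + 'e) module" and ?B = "shifted_ideal R (carrier R) :: ('a, 'a + 'e) module"
  let ?G = "shifted_grading R \<A> C e" and ?H = "shifted_grading R \<A> (carrier R) e"
  have Cc: "c \<in> C \<Longrightarrow> c \<in> carrier R" for c by (rule C.Icarr)
  have A: "graded_module R \<A> ?A ?G" by (rule shifted_ideal_graded[OF C hom])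
  have B: "graded_module R \<A> ?B ?H" by (rule shifted_ideal_graded[OF oneideal]) (simp add: deg.comp_carrier)
  have f: "(\<lambda>x. x) \<in> graded_linear_maps R ?A ?G ?B ?H"
    using Cc by (auto simp: graded_linear_maps_def linear_maps_def shifted_grading_def)
  have phi0: "\<phi> \<zero> = \<zero>\<^bsub>E\<^esub>"
    using smult[of \<zero> \<zero>] C.zero_closed phi by simp
  have g: "(\<lambda>x. \<phi> (projl x)) \<in> graded_linear_maps R ?A ?G E \<E>"
    unfolding graded_linear_maps_def linear_maps_def
    using add smult phi
  proof (auto, goal_cases)
    case (1 n x)
    then show ?case
    proof (cases "e \<le> n")
      case True
      then obtain c where c: "x = Inl c" "c \<in> C" "c \<in> \<A> (nat (n - e))" using 1 by (auto simp: shifted_grading_def)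
      then show ?thesis using degree[OF c(2,3)] True by simp
    next
      case False
      then have "x = Inl \<zero>" using 1 by (auto simp: shifted_grading_def)
      then show ?thesis using phi0 E.mdeg.piece_zero by simp
    qed
  qed
  have "\<exists>h\<in>graded_linear_maps R ?B ?H E \<E>. \<forall>x\<in>carrier ?A. h x = \<phi> (projl x)"
    by (rule inj[unfolded graded_injective_def, THEN conjunct2, rule_format, OF A B f _ g]) (simp add: inj_on_def)
  then obtain h where h: "h \<in> graded_linear_maps R ?B ?H E \<E>" "\<And>x. x \<in> carrier ?A \<Longrightarrow> h x = \<phi> (projl x)"
    by blast
  define y where "y = h (Inl \<one>)"
  have "Inl \<one> \<in> ?H e" using one_degree_zero by (auto simp: shifted_grading_def)
  then have "y \<in> \<E> e" using h(1) unfolding y_def graded_linear_maps_def by blast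
  moreover have "\<phi> c = c \<odot>\<^bsub>E\<^esub> y" if c: "c \<in> C" for c
  proof -
    have "h (c \<odot>\<^bsub>?B\<^esub> Inl \<one>) = c \<odot>\<^bsub>E\<^esub> y"
      using h(1) Cc[OF c] unfolding graded_linear_maps_def linear_maps_def y_def by (simp del: shifted_ideal_simps(4))
    then show ?thesis using h(2)[of "Inl c"] c Cc[OF c] by simp
  qed
  ultimately show ?thesis by blast
qed

end

section \<open>Divisibility of graded injectives modulo torsion\<close>

context std_graded_module
begin

text \<open>This is the colon ideal (b : u).\<close>

lemma mult_annihilator_ideal:
  assumes b: "ideal b R" and u: "u \<in> carrier R"
  shows "ideal {r \<in> carrier R. u \<otimes> r \<in> b} R"
proof (rule subset_ideal_if[OF std])
  interpret b: ideal b R by fact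
  show "additive_subgroup {r \<in> carrier R. u \<otimes> r \<in> b} R"
    by (rule additive_subgroupI) (use u additive_subgroup.a_inv_closed[OF b.additive_subgroup_axioms] in \<open>auto simp: r_distr r_minus\<close>)
  fix c r assume "c \<in> \<A> 0 \<union> \<A> 1" "r \<in> {r \<in> carrier R. u \<otimes> r \<in> b}"
  moreover from this have c: "c \<in> carrier R" using deg.piece_carrier by blast
  moreover have "u \<otimes> (c \<otimes> r) = c \<otimes> (u \<otimes> r)" if "r \<in> carrier R" for r using u c that by (simp add: m_lcomm)
  ultimately show "c \<otimes> r \<in> {r \<in> carrier R. u \<otimes> r \<in> b}" using b.I_l_closed by auto
qed

text \<open>The colon ideals of \<open>b\<close> by the powers of \<open>g\<close> ascend, so they
  become stationary.\<close>

lemma colon_powers_stable: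
  assumes b: "ideal b R" and g: "g \<in> carrier R"
  obtains q :: nat where "\<And>p r. p \<ge> q \<Longrightarrow> r \<in> carrier R \<Longrightarrow> (g [^] p) \<otimes> r \<in> b \<Longrightarrow> (g [^] q) \<otimes> r \<in> b"
proof -
  interpret b: ideal b R by fact
  have "ideal {r \<in> carrier R. (g [^] p) \<otimes> r \<in> b} R" for p :: nat
    by (rule mult_annihilator_ideal[OF b]) (use g in simp)
  moreover have "{r \<in> carrier R. (g [^] p) \<otimes> r \<in> b} \<subseteq> {r \<in> carrier R. (g [^] Suc p) \<otimes> r \<in> b}" for p :: nat
  proof
    fix r assume r: "r \<in> {r \<in> carrier R. (g [^] p) \<otimes> r \<in> b}"
    then have "(g [^] Suc p) \<otimes> r = g \<otimes> ((g [^] p) \<otimes> r)" using g by (simp add: m_ac)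
    then show "r \<in> {r \<in> carrier R. (g [^] Suc p) \<otimes> r \<in> b}" using b.I_l_closed[of "(g [^] p) \<otimes> r" g] r g by simp
  qed
  ultimately obtain q :: nat where q: "\<And>p. p \<ge> q \<Longrightarrow> {r \<in> carrier R. (g [^] p) \<otimes> r \<in> b} = {r \<in> carrier R. (g [^] q) \<otimes> r \<in> b}"
    by (rule ideal_sequence_stable) blast
  show ?thesis by (rule that[of q]) (use q in blast)
qed

text \<open>An ideal \<open>b\<close> that is maximal such that \<open>f\<^bsup>q+1\<^esup> r \<in> b\<close> forces \<open>f\<^bsup>q\<^esup> r\<close> to annihilate \<open>x\<close> contains
  a power of every element nilpotent on \<open>x\<close>; this replaces the Artin-Rees lemma.\<close>

lemma exists_separating_ideal:
  assumes f: "f \<in> carrier R" and x: "x \<in> carrier M"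
  obtains b and q :: nat where "ideal b R"
    "\<And>r. r \<in> carrier R \<Longrightarrow> (f [^] Suc q) \<otimes> r \<in> b \<Longrightarrow> ((f [^] q) \<otimes> r) \<odot>\<^bsub>M\<^esub> x = \<zero>\<^bsub>M\<^esub>"
    "\<And>g s. g \<in> carrier R \<Longrightarrow> (g [^] (s::nat)) \<odot>\<^bsub>M\<^esub> x = \<zero>\<^bsub>M\<^esub> \<Longrightarrow> \<exists>p::nat. g [^] p \<in> b"
proof -
  \<comment> \<open>The annihilators of the powers of \<open>f\<close> are stationary from
    \<open>q\<close> on. So F r = 0 forces h r = 0 for F = f^(q+1) and h = f^q, which makes the
    family of candidate ideals nonempty.\<close>
  obtain q :: nat where q: "\<And>p r. p \<ge> q \<Longrightarrow> r \<in> carrier R \<Longrightarrow> (f [^] p) \<otimes> r \<in> {\<zero>} \<Longrightarrow> (f [^] q) \<otimes> r \<in> {\<zero>}"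
    using colon_powers_stable[OF zeroideal f] by blast
  define F where "F = f [^] Suc q"
  define h where "h = f [^] q"
  have Fh: "F \<in> carrier R" "h \<in> carrier R" unfolding F_def h_def using f by auto
  have kill: "h \<otimes> r = \<zero>" if "r \<in> carrier R" "F \<otimes> r = \<zero>" for r
    using q[of "Suc q" r] that unfolding F_def h_def by (simp del: nat_pow_Suc)
  define Ann where "Ann = {r \<in> carrier R. r \<odot>\<^bsub>M\<^esub> x = \<zero>\<^bsub>M\<^esub>}"
  have Ann: "r \<in> Ann \<Longrightarrow> r \<in> carrier R" "r \<in> Ann \<Longrightarrow> r \<odot>\<^bsub>M\<^esub> x = \<zero>\<^bsub>M\<^esub>" for r unfolding Ann_def by auto
  define \<F> where "\<F> = {b. ideal b R \<and> (\<forall>r\<in>Ann. F \<otimes> r \<in> b) \<and> (\<forall>r\<in>carrier R. F \<otimes> r \<in> b \<longrightarrow> (h \<otimes> r) \<odot>\<^bsub>M\<^esub> x = \<zero>\<^bsub>M\<^esub>)}"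
  \<comment> \<open>The smallest candidate, F times the annihilator of \<open>x\<close>: if F r = F
    s with \<open>s\<close> annihilating \<open>x\<close>, then h r = h s, which kills
    \<open>x\<close>.\<close>
  define b0 where "b0 = {F \<otimes> r |r. r \<in> Ann}"
  have b0I: "F \<otimes> r \<in> b0" if "r \<in> Ann" for r using that unfolding b0_def by blast
  have Ann_add: "r \<oplus> r' \<in> Ann" if "r \<in> Ann" "r' \<in> Ann" for r r' using that x by (simp add: Ann_def smult_l_distr)
  have Ann_inv: "\<ominus> r \<in> Ann" if "r \<in> Ann" for r using that x by (simp add: Ann_def smult_l_minus)
  have Ann_mult: "c \<otimes> r \<in> Ann" if "c \<in> carrier R" "r \<in> Ann" for c r using that x by (simp add: Ann_def smult_assoc1)
  have "additive_subgroup b0 R"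
  proof (rule additive_subgroupI)
    show "b0 \<subseteq> carrier R" unfolding b0_def using Fh Ann by auto
    have "\<zero> \<in> Ann" using x by (simp add: Ann_def)
    then show "\<zero> \<in> b0" using b0I[of \<zero>] Fh by simp
  next
    fix u v assume "u \<in> b0" "v \<in> b0"
    then obtain r s where *: "u = F \<otimes> r" "v = F \<otimes> s" "r \<in> Ann" "s \<in> Ann" unfolding b0_def by blast
    then show "u \<oplus> v \<in> b0" using b0I[OF Ann_add[OF *(3,4)]] Fh Ann by (simp add: r_distr)
  next
    fix u assume "u \<in> b0"
    then obtain r where *: "u = F \<otimes> r" "r \<in> Ann" unfolding b0_def by blast
    then show "\<ominus> u \<in> b0" using b0I[OF Ann_inv[OF *(2)]] Fh Ann by (simp add: r_minus)
  qed
  then have b0: "ideal b0 R"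
  proof (rule subset_ideal_if[OF std])
    fix c u assume c: "c \<in> \<A> 0 \<union> \<A> 1" and u: "u \<in> b0"
    then obtain r where *: "u = F \<otimes> r" "r \<in> Ann" unfolding b0_def by blast
    have cc: "c \<in> carrier R" using c deg.piece_carrier by blast
    have "c \<otimes> u = F \<otimes> (c \<otimes> r)" using * Ann Fh cc by (simp add: m_lcomm)
    then show "c \<otimes> u \<in> b0" using b0I[OF Ann_mult[OF cc *(2)]] by simp
  qed
  have "(h \<otimes> r) \<odot>\<^bsub>M\<^esub> x = \<zero>\<^bsub>M\<^esub>" if r: "r \<in> carrier R" "F \<otimes> r \<in> b0" for r
  proof -
    obtain s where s: "F \<otimes> r = F \<otimes> s" "s \<in> Ann" using r(2) unfolding b0_def by blast
    have sc: "s \<in> carrier R" using s Ann by blast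
    have "F \<otimes> (r \<ominus> s) = \<zero>" using s r sc Fh by (simp add: ring_minus_eq r_distr r_minus ring_r_neg)
    then have hz: "h \<otimes> (r \<ominus> s) = \<zero>" using kill r sc by simp
    have "h \<otimes> r = h \<otimes> (r \<ominus> s) \<oplus> h \<otimes> s" using r sc Fh by algebra
    then have "h \<otimes> r = h \<otimes> s" using hz sc Fh by simp
    then show ?thesis using s Ann Fh sc x by (simp add: smult_assoc1)
  qed
  then have "b0 \<in> \<F>" unfolding \<F>_def using b0 b0I by blast
  then have FF: "\<F> \<subseteq> {I. ideal I R}" "\<F> \<noteq> {}" unfolding \<F>_def by auto
  obtain b where b': "b \<in> \<F>" "\<And>J. J \<in> \<F> \<Longrightarrow> b \<subseteq> J \<Longrightarrow> J = b"
    by (rule exists_maximal_ideal_in[OF FF]) auto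
  have b: "ideal b R" "\<And>r. r \<in> Ann \<Longrightarrow> F \<otimes> r \<in> b" "\<And>r. r \<in> carrier R \<Longrightarrow> F \<otimes> r \<in> b \<Longrightarrow> (h \<otimes> r) \<odot>\<^bsub>M\<^esub> x = \<zero>\<^bsub>M\<^esub>"
    using b'(1) unfolding \<F>_def by auto
  interpret b: ideal b R by (rule b(1))
  show ?thesis
  proof (rule that[of b q])
    show "ideal b R" by (rule b(1))
    show "\<And>r. r \<in> carrier R \<Longrightarrow> (f [^] Suc q) \<otimes> r \<in> b \<Longrightarrow> ((f [^] q) \<otimes> r) \<odot>\<^bsub>M\<^esub> x = \<zero>\<^bsub>M\<^esub>"
      using b(3) unfolding F_def h_def .
    fix g and s :: nat assume g: "g \<in> carrier R" and s: "(g [^] s) \<odot>\<^bsub>M\<^esub> x = \<zero>\<^bsub>M\<^esub>"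
    obtain p0 :: nat where p0: "\<And>p r. p \<ge> p0 \<Longrightarrow> r \<in> carrier R \<Longrightarrow> (g [^] p) \<otimes> r \<in> b \<Longrightarrow> (g [^] p0) \<otimes> r \<in> b"
      using colon_powers_stable[OF b(1) g] by blast
    \<comment> \<open>The summand \<open>s\<close> makes g^p annihilate \<open>x\<close>; the
      summand \<open>p0\<close> lets G r be in \<open>b\<close> whenever G^2 r is.\<close>
    define p where "p = p0 + s"
    define G where "G = g [^] p"
    have Gc: "G \<in> carrier R" unfolding G_def using g by simp
    have "G = (g [^] p0) \<otimes> (g [^] s)" unfolding G_def p_def using g by (simp add: nat_pow_mult)
    then have Gx: "G \<in> Ann" using s g x by (simp add: Ann_def smult_assoc1)
    have GG: "G \<otimes> r \<in> b" if r: "r \<in> carrier R" "G \<otimes> (G \<otimes> r) \<in> b" for r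
    proof -
      have "G \<otimes> (G \<otimes> r) = (g [^] (p + p)) \<otimes> r" unfolding G_def using g r by (simp add: nat_pow_mult[symmetric] m_assoc)
      then have *: "(g [^] p0) \<otimes> r \<in> b" using p0[of "p + p" r] r unfolding p_def by simp
      have "G \<otimes> r = (g [^] s) \<otimes> ((g [^] p0) \<otimes> r)"
        unfolding G_def p_def using g r by (simp add: nat_pow_mult[symmetric] m_ac)
      then show ?thesis using b.I_l_closed[OF *] g by simp
    qed
    define b2 where "b2 = b <+>\<^bsub>R\<^esub> PIdl G"
    have b2: "ideal b2 R" unfolding b2_def by (rule add_ideals[OF b(1) cgenideal_ideal[OF Gc]])
    have b2mem: "z \<in> b2 \<longleftrightarrow> (\<exists>y\<in>b. \<exists>w\<in>carrier R. z = y \<oplus> w \<otimes> G)" for z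
      unfolding b2_def set_add_def' cgenideal_def by blast
    have bb2: "b \<subseteq> b2"
    proof
      fix y assume y: "y \<in> b"
      then have "y = y \<oplus> \<zero> \<otimes> G" using Gc b.Icarr by simp
      then show "y \<in> b2" using b2mem y by blast
    qed
    have "\<zero> \<oplus> \<one> \<otimes> G \<in> b2" using b2mem b.zero_closed by blast
    then have Gb2: "G \<in> b2" using Gc by simp
    \<comment> \<open>Adding G to \<open>b\<close> gives another candidate, so maximality puts G
      into \<open>b\<close>: if F r = y + w G, then G^2 w = F (r G) - G y is in \<open>b\<close>,
      hence also G w and F r.\<close>
    have "(h \<otimes> r) \<odot>\<^bsub>M\<^esub> x = \<zero>\<^bsub>M\<^esub>" if r: "r \<in> carrier R" "F \<otimes> r \<in> b2" for r
    proof -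
      obtain y w where yw: "y \<in> b" "w \<in> carrier R" "F \<otimes> r = y \<oplus> w \<otimes> G" using r b2mem by blast
      have yc: "y \<in> carrier R" using yw b.Icarr by blast
      have "r \<otimes> G \<in> Ann" using Ann_mult[OF r(1) Gx] .
      then have 1: "F \<otimes> (r \<otimes> G) \<in> b" by (rule b(2))
      have "G \<otimes> (G \<otimes> w) = F \<otimes> (r \<otimes> G) \<oplus> \<ominus> (G \<otimes> y)"
      proof -
        have "F \<otimes> (r \<otimes> G) = G \<otimes> (F \<otimes> r)" using r Fh Gc by (simp add: m_ac)
        then have "F \<otimes> (r \<otimes> G) = G \<otimes> (y \<oplus> w \<otimes> G)" using yw(3) by simp
        then show ?thesis using yc yw(2) Gc by (simp only:) algebra
      qed
      also have "\<dots> \<in> b" using 1 b.I_l_closed[OF yw(1) Gc] additive_subgroup.a_inv_closed[OF b.additive_subgroup_axioms] by (simp add: b.a_closed)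
      finally have "G \<otimes> w \<in> b" using GG yw(2) by blast
      then have "F \<otimes> r \<in> b" unfolding yw(3) using yw Gc by (simp add: m_comm)
      then show ?thesis by (rule b(3)[OF r(1)])
    qed
    then have "b2 \<in> \<F>" unfolding \<F>_def using b2 bb2 b(2) by blast
    then have "b2 = b" by (rule b'(2)[OF _ bb2])
    then have "G \<in> b" using Gb2 by simp
    then show "\<exists>p::nat. g [^] p \<in> b" unfolding G_def by blast
  qed
qed

text \<open>With F = f^(q+1) and h = f^q, sending s + r F to h r x is well defined on the ideal
  generated by F and the homogeneous part of a separating ideal. By Baer extension it is
  multiplication by some \<open>y\<close>. Then F y = h x, that is f^q (x - f y) = 0, and
  \<open>y\<close> is killed by the separating part, which contains powers of all elements of
  \<open>T\<close>.\<close>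

lemma torsion_divisible:
  assumes inj: "graded_injective R \<A> M \<M>" and f: "f \<in> \<A> 1" and x: "x \<in> \<M> n"
    and T: "T \<subseteq> \<A> 1" "\<And>g. g \<in> T \<Longrightarrow> \<exists>m::nat. (g [^] m) \<odot>\<^bsub>M\<^esub> x = \<zero>\<^bsub>M\<^esub>"
  shows "\<exists>y\<in>\<M> (n - 1). (\<forall>g\<in>T. \<exists>m::nat. (g [^] m) \<odot>\<^bsub>M\<^esub> y = \<zero>\<^bsub>M\<^esub>) \<and>
    (\<exists>m::nat. (f [^] m) \<odot>\<^bsub>M\<^esub> (x \<ominus>\<^bsub>M\<^esub> f \<odot>\<^bsub>M\<^esub> y) = \<zero>\<^bsub>M\<^esub>)"
proof -
  have fc: "f \<in> carrier R" and xc: "x \<in> carrier M" using f x deg.piece_carrier mdeg.piece_carrier by blast+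
  obtain b and q :: nat where b: "ideal b R"
    "\<And>r. r \<in> carrier R \<Longrightarrow> (f [^] Suc q) \<otimes> r \<in> b \<Longrightarrow> ((f [^] q) \<otimes> r) \<odot>\<^bsub>M\<^esub> x = \<zero>\<^bsub>M\<^esub>"
    "\<And>g s. g \<in> carrier R \<Longrightarrow> (g [^] (s::nat)) \<odot>\<^bsub>M\<^esub> x = \<zero>\<^bsub>M\<^esub> \<Longrightarrow> \<exists>p::nat. g [^] p \<in> b"
    by (rule exists_separating_ideal[OF fc xc]) blast
  interpret b: ideal b R by (rule b(1))
  define F where "F = f [^] Suc q"
  define h where "h = f [^] q"
  have Fh: "F \<in> carrier R" "h \<in> carrier R" "F \<in> \<A> (Suc q)" "h \<in> \<A> q"
    unfolding F_def h_def using fc power_degree[OF f, of "Suc q"] power_degree[OF f, of q] by auto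
  have sep: "(h \<otimes> r) \<odot>\<^bsub>M\<^esub> x = \<zero>\<^bsub>M\<^esub>" if "r \<in> carrier R" "r \<otimes> F \<in> b" for r
    using b(2)[OF that(1)] that fc unfolding F_def h_def by (simp add: m_comm del: nat_pow_Suc)
  \<comment> \<open>The largest homogeneous ideal inside \<open>b\<close>; powers of elements of
    \<open>T\<close> that lie in \<open>b\<close> are homogeneous and so remain in it.\<close>
  define b' where "b' = {c \<in> b. \<forall>d. deg.comp c d \<in> b}"
  have b'c: "c \<in> b' \<Longrightarrow> c \<in> carrier R" "c \<in> b' \<Longrightarrow> c \<in> b" for c unfolding b'_def using b.Icarr by auto
  have "additive_subgroup b' R"
    by (rule additive_subgroupI)
      (use b.Icarr additive_subgroup.a_inv_closed[OF b.additive_subgroup_axioms] in \<open>auto simp: b'_def deg.comp_zero deg.comp_add deg.comp_inv\<close>)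
  then have b': "ideal b' R"
  proof (rule subset_ideal_if[OF std])
    fix c y assume c: "c \<in> \<A> 0 \<union> \<A> 1" and y: "y \<in> b'"
    have cc: "c \<in> carrier R" using c deg.piece_carrier by blast
    have "deg.comp (c \<otimes> y) d \<in> b" for d
    proof (cases "c \<in> \<A> 0")
      case True
      then show ?thesis using y cc b'c[OF y] b.I_l_closed by (auto simp: b'_def comp_mult_zero)
    next
      case False
      then have "c \<in> \<A> 1" using c by blast
      then show ?thesis using y cc b'c[OF y] b.I_l_closed
        by (cases d) (auto simp: b'_def comp_mult_one)
    qed
    then show "c \<otimes> y \<in> b'" using y cc b.I_l_closed by (auto simp: b'_def)
  qed
  interpret b': ideal b' R by (rule b')
  have b'comp: "deg.comp c d \<in> b'" if c: "c \<in> b'" for c d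
    using deg.comp_homogeneous[OF deg.comp_props(1)[OF b'c(1)[OF c], of d]] c
    by (auto simp: b'_def)
  have b'hom: "c \<in> b'" if "c \<in> b" "c \<in> \<A> d" for c d
    using that by (auto simp: b'_def deg.comp_homogeneous)
  define C where "C = b' <+>\<^bsub>R\<^esub> PIdl F"
  have C: "ideal C R" unfolding C_def by (rule add_ideals[OF b' cgenideal_ideal[OF Fh(1)]])
  have Cmem: "c \<in> C \<longleftrightarrow> (\<exists>s\<in>b'. \<exists>r\<in>carrier R. c = s \<oplus> r \<otimes> F)" for c
    unfolding C_def set_add_def' cgenideal_def by blast
  \<comment> \<open>The coefficient of F is not unique, but two choices \<open>r\<close> and
    \<open>r'\<close> satisfy (r - r') F in \<open>b\<close>, and \<open>sep\<close> shows that the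
    value does not change.\<close>
  define \<phi> where "\<phi> c = (h \<otimes> (SOME r. r \<in> carrier R \<and> (\<exists>s\<in>b'. c = s \<oplus> r \<otimes> F))) \<odot>\<^bsub>M\<^esub> x" for c
  have phi: "\<phi> (s \<oplus> r \<otimes> F) = (h \<otimes> r) \<odot>\<^bsub>M\<^esub> x" if s: "s \<in> b'" and r: "r \<in> carrier R" for s r
  proof -
    define r' where "r' = (SOME r'. r' \<in> carrier R \<and> (\<exists>s'\<in>b'. s \<oplus> r \<otimes> F = s' \<oplus> r' \<otimes> F))"
    have "r' \<in> carrier R \<and> (\<exists>s'\<in>b'. s \<oplus> r \<otimes> F = s' \<oplus> r' \<otimes> F)"
      unfolding r'_def by (rule someI[of _ r]) (use s r in blast)
    then obtain s' where s': "r' \<in> carrier R" "s' \<in> b'" "s \<oplus> r \<otimes> F = s' \<oplus> r' \<otimes> F" by blast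
    have cs: "s \<in> carrier R" "s' \<in> carrier R" using s s' b'c by auto
    have "(r \<ominus> r') \<otimes> F = (s \<oplus> r \<otimes> F) \<ominus> (s \<oplus> r' \<otimes> F)" using cs r s'(1) Fh by algebra
    also have "\<dots> = (s' \<oplus> r' \<otimes> F) \<ominus> (s \<oplus> r' \<otimes> F)" using s'(3) by simp
    also have "\<dots> = s' \<oplus> \<ominus> s" using cs r s'(1) Fh by algebra
    also have "\<dots> \<in> b" using s s' b'c additive_subgroup.a_inv_closed[OF b.additive_subgroup_axioms] by (simp add: b.a_closed)
    finally have "(h \<otimes> (r \<ominus> r')) \<odot>\<^bsub>M\<^esub> x = \<zero>\<^bsub>M\<^esub>" using sep r s'(1) by simp
    moreover have "h \<otimes> r = h \<otimes> (r \<ominus> r') \<oplus> h \<otimes> r'" using r s'(1) Fh by algebra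
    ultimately have "(h \<otimes> r) \<odot>\<^bsub>M\<^esub> x = (h \<otimes> r') \<odot>\<^bsub>M\<^esub> x"
      using r s'(1) Fh xc by (simp add: smult_l_distr)
    then show ?thesis unfolding \<phi>_def r'_def[symmetric] by simp
  qed
  \<comment> \<open>F has degree q + 1 and h has degree q, which gives the map degree n - 1. Below
    degree q + 1 the multiple of F has no component, and its coefficient is taken to be
    zero.\<close>
  have compC: "\<exists>s\<in>b'. \<exists>r\<in>carrier R. deg.comp c d = s \<oplus> r \<otimes> F \<and> (h \<otimes> r) \<odot>\<^bsub>M\<^esub> x \<in> \<M> (int d + (n - 1))"
    if c: "c \<in> C" for c d
  proof -
    obtain s r where sr: "s \<in> b'" "r \<in> carrier R" "c = s \<oplus> r \<otimes> F" using c Cmem by blast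
    have e: "deg.comp c d = deg.comp s d \<oplus> deg.comp (F \<otimes> r) d"
      using sr Fh b'c by (simp add: deg.comp_add m_comm)
    show ?thesis
    proof (cases "d < Suc q")
      case True
      then have "deg.comp c d = deg.comp s d \<oplus> \<zero> \<otimes> F"
        using e comp_mult(2)[OF Fh(3) sr(2) True] Fh by simp
      moreover have "(h \<otimes> \<zero>) \<odot>\<^bsub>M\<^esub> x \<in> \<M> (int d + (n - 1))" using mdeg.piece_zero Fh xc by simp
      ultimately show ?thesis using b'comp[OF sr(1)] by blast
    next
      case False
      then obtain l where l: "d = Suc q + l" by (metis le_add_diff_inverse not_less)
      have rl: "deg.comp r l \<in> \<A> l" "deg.comp r l \<in> carrier R" using deg.comp_props(1)[OF sr(2)] deg.comp_carrier[OF sr(2)] by auto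
      have "deg.comp c d = deg.comp s d \<oplus> deg.comp r l \<otimes> F"
        using e comp_mult(1)[OF Fh(3) sr(2), of l] rl Fh l by (simp add: m_comm)
      moreover have "(h \<otimes> deg.comp r l) \<odot>\<^bsub>M\<^esub> x \<in> \<M> (int (q + l) + n)"
        by (rule smult_degree[OF mult_degree[OF Fh(4) rl(1)] x])
      then have "(h \<otimes> deg.comp r l) \<odot>\<^bsub>M\<^esub> x \<in> \<M> (int d + (n - 1))" using l by (simp add: algebra_simps)
      ultimately show ?thesis using b'comp[OF sr(1)] rl by blast
    qed
  qed
  have "\<exists>y\<in>\<M> (n - 1). \<forall>c\<in>C. \<phi> c = c \<odot>\<^bsub>M\<^esub> y"
  proof (rule graded_injective_extend[OF inj C])
    show "deg.comp c d \<in> C" if "c \<in> C" for c d using compC[OF that, of d] Cmem by blast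
    show "\<phi> c \<in> \<M> (int d + (n - 1))" if c: "c \<in> C" "c \<in> \<A> d" for c d
    proof -
      obtain s r where "s \<in> b'" "r \<in> carrier R" "deg.comp c d = s \<oplus> r \<otimes> F" "(h \<otimes> r) \<odot>\<^bsub>M\<^esub> x \<in> \<M> (int d + (n - 1))"
        using compC[OF c(1), of d] by blast
      then show ?thesis using phi by (simp add: deg.comp_homogeneous[OF c(2)])
    qed
    show "\<phi> c \<in> carrier M" if cC: "c \<in> C" for c
    proof -
      obtain s r where "s \<in> b'" "r \<in> carrier R" "c = s \<oplus> r \<otimes> F" using cC Cmem by blast
      then show ?thesis using phi Fh xc by simp
    qed
  next
    fix c c' assume cC: "c \<in> C" "c' \<in> C"
    obtain s r where c: "s \<in> b'" "r \<in> carrier R" "c = s \<oplus> r \<otimes> F" using cC(1) Cmem by blast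
    obtain s' r' where c': "s' \<in> b'" "r' \<in> carrier R" "c' = s' \<oplus> r' \<otimes> F" using cC(2) Cmem by blast
    note sc = b'c(1)[OF c(1)] b'c(1)[OF c'(1)]
    have "c \<oplus> c' = (s \<oplus> s') \<oplus> (r \<oplus> r') \<otimes> F"
      unfolding c(3) c'(3) using c(2) c'(2) Fh(1) sc by algebra
    moreover have "r \<oplus> r' \<in> carrier R" "s \<oplus> s' \<in> b'" using c(1,2) c'(1,2) by simp_all
    ultimately have "\<phi> (c \<oplus> c') = (h \<otimes> (r \<oplus> r')) \<odot>\<^bsub>M\<^esub> x"
      using phi[of "s \<oplus> s'" "r \<oplus> r'"] by simp
    then show "\<phi> (c \<oplus> c') = \<phi> c \<oplus>\<^bsub>M\<^esub> \<phi> c'"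
      using phi[OF c(1,2)] phi[OF c'(1,2)] c c' Fh xc by (simp add: r_distr smult_l_distr)
  next
    fix a c assume a: "a \<in> carrier R" and cC: "c \<in> C"
    obtain s r where c: "s \<in> b'" "r \<in> carrier R" "c = s \<oplus> r \<otimes> F" using cC Cmem by blast
    have "a \<otimes> c = a \<otimes> s \<oplus> (a \<otimes> r) \<otimes> F"
      unfolding c(3) using c(2) a Fh(1) b'c(1)[OF c(1)] by algebra
    then have "\<phi> (a \<otimes> c) = (h \<otimes> (a \<otimes> r)) \<odot>\<^bsub>M\<^esub> x"
      using phi[OF b'.I_l_closed[OF c(1) a] m_closed[OF a c(2)]] by simp
    also have "h \<otimes> (a \<otimes> r) = a \<otimes> (h \<otimes> r)" using c(2) a Fh by (simp add: m_lcomm)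
    finally show "\<phi> (a \<otimes> c) = a \<odot>\<^bsub>M\<^esub> \<phi> c"
      using phi[OF c(1,2)] c a Fh xc by (simp add: smult_assoc1)
  qed
  then obtain y where y: "y \<in> \<M> (n - 1)" "\<And>c. c \<in> C \<Longrightarrow> \<phi> c = c \<odot>\<^bsub>M\<^esub> y" by blast
  have yc: "y \<in> carrier M" using y mdeg.piece_carrier by blast
  have "\<exists>m::nat. (g [^] m) \<odot>\<^bsub>M\<^esub> y = \<zero>\<^bsub>M\<^esub>" if g: "g \<in> T" for g
  proof -
    have g1: "g \<in> \<A> 1" using g T by blast
    obtain p :: nat where p: "g [^] p \<in> b" using b(3)[OF deg.piece_carrier[OF g1]] T(2)[OF g] by blast
    have gp: "g [^] p \<in> b'" by (rule b'hom[OF p power_degree[OF g1]])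
    have e: "g [^] p = g [^] p \<oplus> \<zero> \<otimes> F" using b'c(1)[OF gp] Fh by simp
    then have "g [^] p \<in> C" using Cmem gp by blast
    then have "(g [^] p) \<odot>\<^bsub>M\<^esub> y = \<phi> (g [^] p \<oplus> \<zero> \<otimes> F)" using y(2) e by metis
    also have "\<dots> = \<zero>\<^bsub>M\<^esub>" using phi[OF gp, of \<zero>] Fh xc by simp
    finally show ?thesis by blast
  qed
  moreover have "(f [^] q) \<odot>\<^bsub>M\<^esub> (x \<ominus>\<^bsub>M\<^esub> f \<odot>\<^bsub>M\<^esub> y) = \<zero>\<^bsub>M\<^esub>"
  proof -
    have e: "F = \<zero> \<oplus> \<one> \<otimes> F" using Fh by simp
    then have "F \<in> C" using Cmem b'.zero_closed by blast
    then have "F \<odot>\<^bsub>M\<^esub> y = \<phi> (\<zero> \<oplus> \<one> \<otimes> F)" using y(2) e by metis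
    also have "\<dots> = h \<odot>\<^bsub>M\<^esub> x" using phi[OF b'.zero_closed, of \<one>] Fh by simp
    finally have "F \<odot>\<^bsub>M\<^esub> y = h \<odot>\<^bsub>M\<^esub> x" .
    moreover have "F \<odot>\<^bsub>M\<^esub> y = h \<odot>\<^bsub>M\<^esub> (f \<odot>\<^bsub>M\<^esub> y)" unfolding F_def h_def using fc yc by (simp add: smult_assoc1)
    ultimately have "h \<odot>\<^bsub>M\<^esub> (x \<ominus>\<^bsub>M\<^esub> f \<odot>\<^bsub>M\<^esub> y) = \<zero>\<^bsub>M\<^esub>"
      using Fh fc xc yc by (simp add: M.minus_eq smult_r_distr smult_r_minus M.r_neg)
    then show ?thesis unfolding h_def .
  qed
  ultimately show ?thesis using y(1) by blast
qed

end

section \<open>Noetherian modules\<close>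

context plain_module
begin

definition lspan :: "'m set \<Rightarrow> 'm set" where
  "lspan F = {(\<Oplus>\<^bsub>M\<^esub> s \<in> F. a s \<odot>\<^bsub>M\<^esub> s) |a. a \<in> F \<rightarrow> carrier R}"

lemma lspan_empty: "lspan {} = {\<zero>\<^bsub>M\<^esub>}"
  by (auto simp: lspan_def)

lemma lspan_insert:
  assumes F: "finite F" "insert s F \<subseteq> carrier M" "s \<notin> F"
  shows "lspan (insert s F) = {a \<odot>\<^bsub>M\<^esub> s \<oplus>\<^bsub>M\<^esub> y |a y. a \<in> carrier R \<and> y \<in> lspan F}"
proof (intro equalityI subsetI)
  have sum: "(\<Oplus>\<^bsub>M\<^esub> u \<in> insert s F. a u \<odot>\<^bsub>M\<^esub> u) = a s \<odot>\<^bsub>M\<^esub> s \<oplus>\<^bsub>M\<^esub> (\<Oplus>\<^bsub>M\<^esub> u \<in> F. a u \<odot>\<^bsub>M\<^esub> u)"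
    if a: "a \<in> insert s F \<rightarrow> carrier R" for a
    by (rule M.finsum_insert) (use F a in \<open>auto simp: Pi_def subset_iff\<close>)
  {
    fix x assume "x \<in> lspan (insert s F)"
    then obtain a where a: "a \<in> insert s F \<rightarrow> carrier R" "x = (\<Oplus>\<^bsub>M\<^esub> u \<in> insert s F. a u \<odot>\<^bsub>M\<^esub> u)"
      unfolding lspan_def by blast
    have "(\<Oplus>\<^bsub>M\<^esub> u \<in> F. a u \<odot>\<^bsub>M\<^esub> u) \<in> lspan F" using a(1) unfolding lspan_def by blast
    then show "x \<in> {a \<odot>\<^bsub>M\<^esub> s \<oplus>\<^bsub>M\<^esub> y |a y. a \<in> carrier R \<and> y \<in> lspan F}"
      using a sum[OF a(1)] by blast
  next
    fix x assume "x \<in> {a \<odot>\<^bsub>M\<^esub> s \<oplus>\<^bsub>M\<^esub> y |a y. a \<in> carrier R \<and> y \<in> lspan F}"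
    then obtain a c where a: "a \<in> carrier R" "c \<in> F \<rightarrow> carrier R"
      "x = a \<odot>\<^bsub>M\<^esub> s \<oplus>\<^bsub>M\<^esub> (\<Oplus>\<^bsub>M\<^esub> u \<in> F. c u \<odot>\<^bsub>M\<^esub> u)"
      unfolding lspan_def by blast
    define c' where "c' = c(s := a)"
    have c': "c' \<in> insert s F \<rightarrow> carrier R" using a unfolding c'_def by auto
    have "(\<Oplus>\<^bsub>M\<^esub> u \<in> F. c' u \<odot>\<^bsub>M\<^esub> u) = (\<Oplus>\<^bsub>M\<^esub> u \<in> F. c u \<odot>\<^bsub>M\<^esub> u)"
      by (rule M.finsum_cong') (use a F in \<open>auto simp: c'_def\<close>)
    then have "x = (\<Oplus>\<^bsub>M\<^esub> u \<in> insert s F. c' u \<odot>\<^bsub>M\<^esub> u)"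
      using sum[OF c'] a(3) by (simp add: c'_def)
    then show "x \<in> lspan (insert s F)" unfolding lspan_def using c' by blast
  }
qed

lemma lspan_submodule:
  assumes "finite F" "F \<subseteq> carrier M"
  shows "submodule (lspan F) R M"
  using assms
proof (induction F)
  case empty
  show ?case unfolding lspan_empty by (rule submoduleI) auto
next
  case (insert s F)
  then have F: "submodule (lspan F) R M" by blast
  have s: "s \<in> carrier M" using insert by blast
  note FE = submoduleE[OF F]
  have Fc: "y \<in> lspan F \<Longrightarrow> y \<in> carrier M" for y using FE(1) by blast
  have z: "\<zero>\<^bsub>M\<^esub> \<in> lspan F" using FE(2,3,5) Fc by (metis M.r_neg ex_in_conv)
  note eq = lspan_insert[OF insert(1,4,2)]
  have I: "a \<odot>\<^bsub>M\<^esub> s \<oplus>\<^bsub>M\<^esub> y \<in> lspan (insert s F)" if "a \<in> carrier R" "y \<in> lspan F" for a y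
    unfolding eq using that by blast
  show ?case
  proof (rule submoduleI)
    show "lspan (insert s F) \<subseteq> carrier M" unfolding eq using s Fc by auto
    show "\<zero>\<^bsub>M\<^esub> \<in> lspan (insert s F)" using I[OF R.zero_closed z] s by simp
  next
    fix u assume "u \<in> lspan (insert s F)"
    then obtain a y where u: "u = a \<odot>\<^bsub>M\<^esub> s \<oplus>\<^bsub>M\<^esub> y" "a \<in> carrier R" "y \<in> lspan F" unfolding eq by blast
    have "\<ominus>\<^bsub>M\<^esub> u = (\<ominus> a) \<odot>\<^bsub>M\<^esub> s \<oplus>\<^bsub>M\<^esub> \<ominus>\<^bsub>M\<^esub> y" using u s Fc by (simp add: M.minus_add smult_l_minus)
    then show "\<ominus>\<^bsub>M\<^esub> u \<in> lspan (insert s F)" using I[of "\<ominus> a" "\<ominus>\<^bsub>M\<^esub> y"] u FE(3) by simp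
  next
    fix u v assume uv: "u \<in> lspan (insert s F)" "v \<in> lspan (insert s F)"
    obtain a y where u: "u = a \<odot>\<^bsub>M\<^esub> s \<oplus>\<^bsub>M\<^esub> y" "a \<in> carrier R" "y \<in> lspan F" using uv(1) unfolding eq by blast
    obtain b z where v: "v = b \<odot>\<^bsub>M\<^esub> s \<oplus>\<^bsub>M\<^esub> z" "b \<in> carrier R" "z \<in> lspan F" using uv(2) unfolding eq by blast
    have "u \<oplus>\<^bsub>M\<^esub> v = (a \<oplus> b) \<odot>\<^bsub>M\<^esub> s \<oplus>\<^bsub>M\<^esub> (y \<oplus>\<^bsub>M\<^esub> z)"
      using u v s Fc[OF u(3)] Fc[OF v(3)] by (simp add: smult_l_distr M.a_ac)
    then show "u \<oplus>\<^bsub>M\<^esub> v \<in> lspan (insert s F)" using I[of "a \<oplus> b" "y \<oplus>\<^bsub>M\<^esub> z"] u v FE(5) by simp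
  next
    fix c u assume c: "c \<in> carrier R" and cu: "u \<in> lspan (insert s F)"
    obtain a y where u: "u = a \<odot>\<^bsub>M\<^esub> s \<oplus>\<^bsub>M\<^esub> y" "a \<in> carrier R" "y \<in> lspan F" using cu unfolding eq by blast
    have "c \<odot>\<^bsub>M\<^esub> u = (c \<otimes> a) \<odot>\<^bsub>M\<^esub> s \<oplus>\<^bsub>M\<^esub> c \<odot>\<^bsub>M\<^esub> y" using u c s Fc[OF u(3)] by (simp add: smult_r_distr smult_assoc1)
    then show "c \<odot>\<^bsub>M\<^esub> u \<in> lspan (insert s F)" using I[of "c \<otimes> a" "c \<odot>\<^bsub>M\<^esub> y"] u c FE(4) by simp
  qed
qed

lemma submodule_zero: "submodule H R M \<Longrightarrow> \<zero>\<^bsub>M\<^esub> \<in> H"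
  by (metis M.r_neg ex_in_conv submoduleE(1,2,3,5) subsetD)

lemma submodule_diff: "submodule H R M \<Longrightarrow> x \<in> H \<Longrightarrow> y \<in> H \<Longrightarrow> x \<ominus>\<^bsub>M\<^esub> y \<in> H"
  unfolding M.minus_eq using submoduleE(3,5) by blast

text \<open>Induction on the number of generators. For a new generator, the chain of its coefficient
  ideals stops by the Noetherian property of R, and elements with equal coefficients differ by an
  element of the span of the old generators.\<close>

lemma submodule_sequence_stable:
  assumes noeth: "noetherian_ring R" and fg: "finitely_generated_module R M"
    and N: "\<And>p::nat. submodule (N p) R M" and mono: "\<And>p. N p \<subseteq> N (Suc p)"
  obtains q where "\<And>p. p \<ge> q \<Longrightarrow> N p \<subseteq> N q"
proof -
  interpret noetherian_ring R by fact
  have mono': "N p \<subseteq> N q" if "p \<le> q" for p q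
    by (rule lift_Suc_mono_le[of N, OF mono that])
  have claim: "\<exists>q. \<forall>p\<ge>q. N p \<inter> lspan F \<subseteq> N q" if "finite F" "F \<subseteq> carrier M" for F
    using that
  proof (induction F)
    case empty
    show ?case unfolding lspan_empty using submodule_zero[OF N] by (intro exI[of _ 0]) auto
  next
    case (insert s F)
    then have F: "submodule (lspan F) R M" using lspan_submodule by blast
    have s: "s \<in> carrier M" using insert by blast
    note eq = lspan_insert[OF insert(1,4,2)]
    note FE = submoduleE[OF F]
    have Fc: "y \<in> lspan F \<Longrightarrow> y \<in> carrier M" for y using FE(1) by blast
    \<comment> \<open>The coefficients at \<open>s\<close> of those elements of \<open>N p\<close>
      that lie in the enlarged span.\<close>
    define I where "I p = {a \<in> carrier R. \<exists>y\<in>lspan F. a \<odot>\<^bsub>M\<^esub> s \<oplus>\<^bsub>M\<^esub> y \<in> N p}" for p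
    have II: "a \<in> I p" if "a \<in> carrier R" "y \<in> lspan F" "a \<odot>\<^bsub>M\<^esub> s \<oplus>\<^bsub>M\<^esub> y \<in> N p" for a y p
      unfolding I_def using that by blast
    have ideal: "ideal (I p) R" for p
    proof (rule idealI[OF R.ring_axioms R.add.subgroupI])
      show "I p \<subseteq> carrier R" unfolding I_def by blast
      have "\<zero> \<in> I p" by (rule II[of _ "\<zero>\<^bsub>M\<^esub>"]) (use s submodule_zero[OF F] submodule_zero[OF N] in auto)
      then show "I p \<noteq> {}" by blast
    next
      fix a assume "a \<in> I p"
      then obtain y where a: "a \<in> carrier R" "y \<in> lspan F" "a \<odot>\<^bsub>M\<^esub> s \<oplus>\<^bsub>M\<^esub> y \<in> N p" unfolding I_def by blast
      have "(\<ominus> a) \<odot>\<^bsub>M\<^esub> s \<oplus>\<^bsub>M\<^esub> \<ominus>\<^bsub>M\<^esub> y = \<ominus>\<^bsub>M\<^esub> (a \<odot>\<^bsub>M\<^esub> s \<oplus>\<^bsub>M\<^esub> y)" using a s Fc by (simp add: M.minus_add smult_l_minus)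
      then show "\<ominus> a \<in> I p" using II[of "\<ominus> a" "\<ominus>\<^bsub>M\<^esub> y"] a FE(3) submoduleE(3)[OF N] by simp
    next
      fix a b assume ab: "a \<in> I p" "b \<in> I p"
      obtain y where a: "a \<in> carrier R" "y \<in> lspan F" "a \<odot>\<^bsub>M\<^esub> s \<oplus>\<^bsub>M\<^esub> y \<in> N p" using ab(1) unfolding I_def by blast
      obtain z where b: "b \<in> carrier R" "z \<in> lspan F" "b \<odot>\<^bsub>M\<^esub> s \<oplus>\<^bsub>M\<^esub> z \<in> N p" using ab(2) unfolding I_def by blast
      have "(a \<oplus> b) \<odot>\<^bsub>M\<^esub> s \<oplus>\<^bsub>M\<^esub> (y \<oplus>\<^bsub>M\<^esub> z) = (a \<odot>\<^bsub>M\<^esub> s \<oplus>\<^bsub>M\<^esub> y) \<oplus>\<^bsub>M\<^esub> (b \<odot>\<^bsub>M\<^esub> s \<oplus>\<^bsub>M\<^esub> z)"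
        using a b s Fc[OF a(2)] Fc[OF b(2)] by (simp add: smult_l_distr M.a_ac)
      then show "a \<oplus> b \<in> I p" using II[of "a \<oplus> b" "y \<oplus>\<^bsub>M\<^esub> z"] a b FE(5) submoduleE(5)[OF N] by simp
    next
      fix a c assume aI: "a \<in> I p" and c: "c \<in> carrier R"
      obtain y where a: "a \<in> carrier R" "y \<in> lspan F" "a \<odot>\<^bsub>M\<^esub> s \<oplus>\<^bsub>M\<^esub> y \<in> N p" using aI unfolding I_def by blast
      have "(c \<otimes> a) \<odot>\<^bsub>M\<^esub> s \<oplus>\<^bsub>M\<^esub> c \<odot>\<^bsub>M\<^esub> y = c \<odot>\<^bsub>M\<^esub> (a \<odot>\<^bsub>M\<^esub> s \<oplus>\<^bsub>M\<^esub> y)"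
        using a c s Fc[OF a(2)] by (simp add: smult_r_distr smult_assoc1)
      then show "c \<otimes> a \<in> I p" using II[of "c \<otimes> a" "c \<odot>\<^bsub>M\<^esub> y"] a c FE(4) submoduleE(4)[OF N] by simp
      then show "a \<otimes> c \<in> I p" using a c by (simp add: R.m_comm)
    qed
    have "I p \<subseteq> I (Suc p)" for p unfolding I_def using mono[of p] by blast
    then obtain q1 where q1: "\<And>p. p \<ge> q1 \<Longrightarrow> I p = I q1"
      using ideal_sequence_stable[of I, OF ideal] by blast
    obtain q2 where q2: "\<And>p. p \<ge> q2 \<Longrightarrow> N p \<inter> lspan F \<subseteq> N q2" using insert by blast
    define q where "q = max q1 q2"
    have "N p \<inter> lspan (insert s F) \<subseteq> N q" if p: "p \<ge> q" for p
    proof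
      fix x assume x: "x \<in> N p \<inter> lspan (insert s F)"
      then obtain a y where a: "x = a \<odot>\<^bsub>M\<^esub> s \<oplus>\<^bsub>M\<^esub> y" "a \<in> carrier R" "y \<in> lspan F" unfolding eq by blast
      have "a \<in> I p" using II[OF a(2,3)] x a(1) by blast
      then have "a \<in> I q1" using q1[of p] p unfolding q_def by simp
      then obtain z where z: "z \<in> lspan F" "a \<odot>\<^bsub>M\<^esub> s \<oplus>\<^bsub>M\<^esub> z \<in> N q1" unfolding I_def by blast
      have zq: "a \<odot>\<^bsub>M\<^esub> s \<oplus>\<^bsub>M\<^esub> z \<in> N q" using z(2) mono'[of q1 q] unfolding q_def by auto
      have zp: "a \<odot>\<^bsub>M\<^esub> s \<oplus>\<^bsub>M\<^esub> z \<in> N p" using zq mono'[OF p] by blast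
      have cc: "y \<in> carrier M" "z \<in> carrier M" using Fc a z by auto
      have d: "y \<ominus>\<^bsub>M\<^esub> z = x \<ominus>\<^bsub>M\<^esub> (a \<odot>\<^bsub>M\<^esub> s \<oplus>\<^bsub>M\<^esub> z)"
      proof -
        have "x \<ominus>\<^bsub>M\<^esub> (a \<odot>\<^bsub>M\<^esub> s \<oplus>\<^bsub>M\<^esub> z) = (y \<oplus>\<^bsub>M\<^esub> a \<odot>\<^bsub>M\<^esub> s) \<oplus>\<^bsub>M\<^esub> (\<ominus>\<^bsub>M\<^esub> (a \<odot>\<^bsub>M\<^esub> s) \<oplus>\<^bsub>M\<^esub> \<ominus>\<^bsub>M\<^esub> z)"
          unfolding a(1) using a(2) s cc by (simp add: M.minus_eq M.minus_add M.a_comm)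
        also have "\<dots> = y \<ominus>\<^bsub>M\<^esub> z" using a(2) s cc by (simp add: M.minus_eq M.a_assoc M.r_neg2)
        finally show ?thesis ..
      qed
      have "y \<ominus>\<^bsub>M\<^esub> z \<in> N p \<inter> lspan F"
        using submodule_diff[OF N _ zp, of x] x submodule_diff[OF F a(3) z(1)] unfolding d by auto
      then have "y \<ominus>\<^bsub>M\<^esub> z \<in> N q" using q2[of p] p mono'[of q2 q] unfolding q_def by auto
      then have "(y \<ominus>\<^bsub>M\<^esub> z) \<oplus>\<^bsub>M\<^esub> (a \<odot>\<^bsub>M\<^esub> s \<oplus>\<^bsub>M\<^esub> z) \<in> N q" using submoduleE(5)[OF N _ zq] by blast
      moreover have "(y \<ominus>\<^bsub>M\<^esub> z) \<oplus>\<^bsub>M\<^esub> (a \<odot>\<^bsub>M\<^esub> s \<oplus>\<^bsub>M\<^esub> z) = x"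
      proof -
        have "x \<in> carrier M" "a \<odot>\<^bsub>M\<^esub> s \<oplus>\<^bsub>M\<^esub> z \<in> carrier M" using zp x submoduleE(1)[OF N] by blast+
        then show ?thesis unfolding d by (simp only: M.minus_eq M.a_assoc M.a_inv_closed M.l_neg M.r_zero)
      qed
      ultimately show "x \<in> N q" by simp
    qed
    then show ?case by blast
  qed
  obtain F where F: "finite F" "F \<subseteq> carrier M" "carrier M = lspan F"
  proof -
    obtain F where F: "finite F" "F \<subseteq> carrier M" "\<And>x. x \<in> carrier M \<Longrightarrow> \<exists>a \<in> F \<rightarrow> carrier R. x = (\<Oplus>\<^bsub>M\<^esub> s \<in> F. a s \<odot>\<^bsub>M\<^esub> s)"
      using fg unfolding finitely_generated_module_def by blast
    have "lspan F \<subseteq> carrier M" using submoduleE(1)[OF lspan_submodule[OF F(1,2)]] .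
    moreover have "carrier M \<subseteq> lspan F" using F(3) unfolding lspan_def by blast
    ultimately show ?thesis using that F by blast
  qed
  obtain q where q: "\<forall>p\<ge>q. N p \<inter> lspan F \<subseteq> N q" using claim[OF F(1,2)] by blast
  have "N p \<subseteq> N q" if "p \<ge> q" for p
    using q that submoduleE(1)[OF N, of p] F(3) by blast
  then show ?thesis by (rule that)
qed

text \<open>If no finite set generates, one can keep choosing elements outside the span of those
  already chosen, and these spans ascend strictly.\<close>

lemma finitely_generated_if_sequences_stable:
  assumes stable: "\<And>N. (\<And>p::nat. submodule (N p) R M) \<Longrightarrow> (\<And>p. N p \<subseteq> N (Suc p)) \<Longrightarrow> \<exists>q. \<forall>p\<ge>q. N p \<subseteq> N q"
  shows "finitely_generated_module R M"
proof (rule ccontr)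
  assume nfg: "\<not> finitely_generated_module R M"
  have ex: "\<exists>x\<in>carrier M. x \<notin> lspan F" if F: "finite F" "F \<subseteq> carrier M" for F
  proof (rule ccontr)
    assume "\<not> (\<exists>x\<in>carrier M. x \<notin> lspan F)"
    then have "\<forall>x\<in>carrier M. \<exists>a\<in>F \<rightarrow> carrier R. x = (\<Oplus>\<^bsub>M\<^esub> s \<in> F. a s \<odot>\<^bsub>M\<^esub> s)" unfolding lspan_def by blast
    then show False using nfg F module_axioms unfolding finitely_generated_module_def by blast
  qed
  define nxt where "nxt F = insert (SOME x. x \<in> carrier M \<and> x \<notin> lspan F) F" for F
  define G where "G p = (nxt ^^ p) {}" for p
  have pick: "(SOME x. x \<in> carrier M \<and> x \<notin> lspan F) \<in> carrier M \<and> (SOME x. x \<in> carrier M \<and> x \<notin> lspan F) \<notin> lspan F"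
    if "finite F" "F \<subseteq> carrier M" for F
    using someI_ex[of "\<lambda>x. x \<in> carrier M \<and> x \<notin> lspan F"] ex[OF that] by blast
  have G: "finite (G p) \<and> G p \<subseteq> carrier M" for p
    by (induction p) (use pick in \<open>auto simp: G_def nxt_def\<close>)
  have step: "lspan (G p) \<subseteq> lspan (G (Suc p)) \<and> \<not> lspan (G (Suc p)) \<subseteq> lspan (G p)" for p
  proof -
    define x where "x = (SOME x. x \<in> carrier M \<and> x \<notin> lspan (G p))"
    have x: "x \<in> carrier M" "x \<notin> lspan (G p)" using pick[of "G p"] G[of p] unfolding x_def by auto
    have GS: "G (Suc p) = insert x (G p)" unfolding G_def nxt_def x_def by simp
    have sub: "submodule (lspan (G p)) R M" using lspan_submodule G by blast
    have Fc: "y \<in> carrier M" if "y \<in> lspan (G p)" for y using submoduleE(1)[OF sub] that by blast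
    have "x \<notin> G p"
    proof
      assume xG: "x \<in> G p"
      then have "insert x (G p - {x}) = G p" by blast
      moreover have "finite (G p - {x})" "insert x (G p - {x}) \<subseteq> carrier M" "x \<notin> G p - {x}" using G[of p] xG by auto
      ultimately have "lspan (G p) = {a \<odot>\<^bsub>M\<^esub> x \<oplus>\<^bsub>M\<^esub> y |a y. a \<in> carrier R \<and> y \<in> lspan (G p - {x})}"
        using lspan_insert[of "G p - {x}" x] by simp
      moreover have "\<zero>\<^bsub>M\<^esub> \<in> lspan (G p - {x})" by (rule submodule_zero[OF lspan_submodule]) (use G[of p] in auto)
      ultimately have "\<one> \<odot>\<^bsub>M\<^esub> x \<oplus>\<^bsub>M\<^esub> \<zero>\<^bsub>M\<^esub> \<in> lspan (G p)" by blast
      then show False using x by simp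
    qed
    then have eq: "lspan (G (Suc p)) = {a \<odot>\<^bsub>M\<^esub> x \<oplus>\<^bsub>M\<^esub> y |a y. a \<in> carrier R \<and> y \<in> lspan (G p)}"
      unfolding GS by (intro lspan_insert) (use G[of p] x in auto)
    have "\<one> \<odot>\<^bsub>M\<^esub> x \<oplus>\<^bsub>M\<^esub> \<zero>\<^bsub>M\<^esub> \<in> lspan (G (Suc p))" unfolding eq using submodule_zero[OF sub] by blast
    then have "x \<in> lspan (G (Suc p))" using x by simp
    moreover have "y \<in> lspan (G (Suc p))" if y: "y \<in> lspan (G p)" for y
    proof -
      have "\<zero> \<odot>\<^bsub>M\<^esub> x \<oplus>\<^bsub>M\<^esub> y \<in> lspan (G (Suc p))" unfolding eq using y by blast
      then show ?thesis using x Fc[OF y] by simp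
    qed
    ultimately show ?thesis using x(2) by blast
  qed
  have "\<exists>q. \<forall>p\<ge>q. lspan (G p) \<subseteq> lspan (G q)"
  proof (rule stable)
    show "submodule (lspan (G p)) R M" for p using lspan_submodule G by blast
    show "lspan (G p) \<subseteq> lspan (G (Suc p))" for p using step by blast
  qed
  then obtain q where "lspan (G (Suc q)) \<subseteq> lspan (G q)" by (meson le_SucI order_refl)
  then show False using step[of q] by blast
qed

end

section \<open>The complex of injectives as a graded complex\<close>

text \<open>The augmentation and M are left out: torsion and divisibility concern the complex of
  injectives alone. Exactness is supplied to the individual lemmas that use it.\<close>

locale injective_complex = std_graded_ring R \<A> for R :: "('a, 'r) ring_scheme" (structure) and \<A> +
  fixes E :: "nat \<Rightarrow> ('a, 'e) module" and \<E> :: "nat \<Rightarrow> int \<Rightarrow> 'e set" and \<delta> :: "nat \<Rightarrow> 'e \<Rightarrow> 'e"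
    and f :: "nat \<Rightarrow> 'a" and r :: nat
  assumes injective: "\<And>k. graded_injective R \<A> (E k) (\<E> k)"
    and differential: "\<And>k. \<delta> k \<in> graded_linear_maps R (E k) (\<E> k) (E (Suc k)) (\<E> (Suc k))"
    and differential_square: "\<And>k x. x \<in> carrier (E k) \<Longrightarrow> \<delta> (Suc k) (\<delta> k x) = \<zero>\<^bsub>E (Suc (Suc k))\<^esub>"
    and generators: "generates_degree_one f r"
begin

lemma term_module: "std_graded_module R \<A> (E k) (\<E> k)"
  using injective[of k] std_graded_ring_axioms unfolding graded_injective_def
  by (auto simp: std_graded_module_def)

sublocale E: std_graded_module R \<A> "E k" "\<E> k" for k
  by (rule term_module)

lemma diff_closed: "x \<in> carrier (E k) \<Longrightarrow> \<delta> k x \<in> carrier (E (Suc k))"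
  and diff_add: "x \<in> carrier (E k) \<Longrightarrow> y \<in> carrier (E k) \<Longrightarrow> \<delta> k (x \<oplus>\<^bsub>E k\<^esub> y) = \<delta> k x \<oplus>\<^bsub>E (Suc k)\<^esub> \<delta> k y"
  and diff_smult: "a \<in> carrier R \<Longrightarrow> x \<in> carrier (E k) \<Longrightarrow> \<delta> k (a \<odot>\<^bsub>E k\<^esub> x) = a \<odot>\<^bsub>E (Suc k)\<^esub> \<delta> k x"
  and diff_degree: "x \<in> \<E> k n \<Longrightarrow> \<delta> k x \<in> \<E> (Suc k) n"
  using differential[of k] unfolding graded_linear_maps_def linear_maps_def by blast+

lemma diff_zero: "\<delta> k \<zero>\<^bsub>E k\<^esub> = \<zero>\<^bsub>E (Suc k)\<^esub>"
  using diff_smult[of \<zero> "\<zero>\<^bsub>E k\<^esub>" k] diff_closed[of "\<zero>\<^bsub>E k\<^esub>" k] by simp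

lemma f_carrier: "f i \<in> carrier R" and f_degree: "f i \<in> \<A> 1"
  using generators deg.piece_carrier unfolding generates_degree_one_def by blast+

text \<open>The terms of the complex are presented as quotients of the free abelian group on all pairs \<open>(k, x)\<close>
  with x in the type of \<open>E k\<close>; \<open>ev k\<close> evaluates a formal sum in \<open>E k\<close>, discarding pairs of other index
  and pairs outside the carrier.\<close>

definition valid :: "nat \<times> 'e \<Rightarrow> bool" where
  "valid p \<longleftrightarrow> snd p \<in> carrier (E (fst p))"

text \<open>The locale \<open>graded_complex\<close> asks for additivity and commutation as
  equations on the whole type, not just modulo \<open>B\<close>. Linear extension to formal sums
  provides them; invalid pairs go to zero because module laws hold only inside the carriers.\<close>

definition lift_op :: "(nat \<times> 'e \<Rightarrow> nat \<times> 'e) \<Rightarrow> (nat \<times> 'e \<Rightarrow>\<^sub>0 int) \<Rightarrow> (nat \<times> 'e \<Rightarrow>\<^sub>0 int)" where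
  "lift_op h = frag_extend (\<lambda>p. if valid p then frag_of (h p) else 0)"

lemma lift_op_diff: "lift_op h (a - b) = lift_op h a - lift_op h b"
  by (simp add: lift_op_def frag_extend_diff)

lemma lift_op_of: "lift_op h (frag_of p) = (if valid p then frag_of (h p) else 0)"
  by (simp add: lift_op_def)

lemma lift_op_zero: "lift_op h 0 = 0"
  by (simp add: lift_op_def)

lemma frag_cases [case_names zero of diff]:
  assumes "P 0" "\<And>p. P (frag_of p)" "\<And>a b. P a \<Longrightarrow> P b \<Longrightarrow> P (a - b)"
  shows "P c"
  using frag_induction[of c UNIV P] assms by blast

lemma lift_op_comm:
  assumes "\<And>p. valid p \<Longrightarrow> valid (h p)" "\<And>p. valid p \<Longrightarrow> valid (h' p)" "\<And>p. valid p \<Longrightarrow> h (h' p) = h' (h p)"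
  shows "lift_op h (lift_op h' c) = lift_op h' (lift_op h c)"
  by (induction c rule: frag_cases) (auto simp: lift_op_diff lift_op_of lift_op_zero assms)

text \<open>The target is a group on a carrier set, whereas \<open>frag_extend\<close> maps into
  formal sums; hence the choice of a homomorphism from the universal property.\<close>

definition ev :: "nat \<Rightarrow> (nat \<times> 'e \<Rightarrow>\<^sub>0 int) \<Rightarrow> 'e" where
  "ev k = (SOME h. h \<in> hom (free_Abelian_group UNIV) (add_monoid (E k)) \<and>
     (\<forall>p. h (frag_of p) = (if fst p = k \<and> valid p then snd p else \<zero>\<^bsub>E k\<^esub>)))"

lemma ev_spec: "ev k \<in> hom (free_Abelian_group UNIV) (add_monoid (E k)) \<and>
     (\<forall>p. ev k (frag_of p) = (if fst p = k \<and> valid p then snd p else \<zero>\<^bsub>E k\<^esub>))"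
proof -
  have im: "(\<lambda>p. if fst p = k \<and> valid p then snd p else \<zero>\<^bsub>E k\<^esub>) ` UNIV \<subseteq> carrier (add_monoid (E k))"
    by (auto simp: valid_def)
  have "\<exists>h. h \<in> hom (free_Abelian_group UNIV) (add_monoid (E k)) \<and>
     (\<forall>p. h (frag_of p) = (if fst p = k \<and> valid p then snd p else \<zero>\<^bsub>E k\<^esub>))"
  proof (rule comm_group.free_Abelian_group_universal[OF E.M.a_comm_group im])
    fix h assume h: "h \<in> hom (free_Abelian_group UNIV) (add_monoid (E k))"
      "\<And>p. p \<in> UNIV \<Longrightarrow> h (frag_of p) = (if fst p = k \<and> valid p then snd p else \<zero>\<^bsub>E k\<^esub>)"
    show ?thesis by (rule exI[of _ h]) (use h in simp)
  qed
  then show ?thesis unfolding ev_def by (rule someI_ex)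
qed

lemma ev_carrier: "ev k c \<in> carrier (E k)"
  using hom_in_carrier[of "ev k" "free_Abelian_group UNIV" "add_monoid (E k)" c] ev_spec by simp

lemma ev_of: "ev k (frag_of p) = (if fst p = k \<and> valid p then snd p else \<zero>\<^bsub>E k\<^esub>)"
  using ev_spec by blast

lemma ev_add: "ev k (a + b) = ev k a \<oplus>\<^bsub>E k\<^esub> ev k b"
  using hom_mult[of "ev k" "free_Abelian_group UNIV" "add_monoid (E k)" a b] ev_spec by simp

lemma ev_zero: "ev k 0 = \<zero>\<^bsub>E k\<^esub>"
  using ev_add[of k 0 0] ev_carrier[of k 0] by (metis E.M.add.l_cancel_one' add_0)

lemma ev_diff: "ev k (a - b) = ev k a \<ominus>\<^bsub>E k\<^esub> ev k b"
proof -
  have "ev k (a - b) \<oplus>\<^bsub>E k\<^esub> ev k b = ev k a" using ev_add[of k "a - b" b] by simp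
  then show ?thesis using ev_carrier by (metis E.M.add.inv_solve_right' E.M.minus_eq)
qed

lemma ev_lift_op:
  assumes phi: "\<And>x y. x \<in> carrier (E k) \<Longrightarrow> y \<in> carrier (E k) \<Longrightarrow> \<phi> (x \<oplus>\<^bsub>E k\<^esub> y) = \<phi> x \<oplus>\<^bsub>E k'\<^esub> \<phi> y"
    "\<And>x. x \<in> carrier (E k) \<Longrightarrow> \<phi> x \<in> carrier (E k')"
    and h: "\<And>x. x \<in> carrier (E k) \<Longrightarrow> h (k, x) = (k', \<phi> x)" "\<And>l x. l \<noteq> k \<Longrightarrow> fst (h (l, x)) \<noteq> k'"
  shows "ev k' (lift_op h c) = \<phi> (ev k c)"
proof (induction c rule: frag_cases)
  have phi0: "\<phi> \<zero>\<^bsub>E k\<^esub> = \<zero>\<^bsub>E k'\<^esub>"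
    using phi(1)[of "\<zero>\<^bsub>E k\<^esub>" "\<zero>\<^bsub>E k\<^esub>"] phi(2)[of "\<zero>\<^bsub>E k\<^esub>"] by simp
  {
    case zero show ?case by (simp add: lift_op_zero ev_zero phi0)
  next
    case (of p)
    obtain l x where p: "p = (l, x)" by (cases p)
    show ?case
      using h(1)[of x] h(2)[of l x] phi(2)[of x]
      by (cases "l = k") (auto simp: p lift_op_of ev_of phi0 valid_def ev_zero)
  next
    case (diff a b)
    have "\<phi> (ev k a) = \<phi> (ev k (a - b)) \<oplus>\<^bsub>E k'\<^esub> \<phi> (ev k b)"
      using ev_add[of k "a - b" b] phi(1)[OF ev_carrier[of k "a - b"] ev_carrier[of k b]] by simp
    then have "\<phi> (ev k (a - b)) = \<phi> (ev k a) \<ominus>\<^bsub>E k'\<^esub> \<phi> (ev k b)"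
      using phi(2)[OF ev_carrier] by (metis E.M.add.inv_solve_right' E.M.minus_eq)
    then show ?case using diff by (simp add: lift_op_diff ev_diff)
  }
qed

text \<open>Sequences of formal sums are used because the cone construction interleaves pairs into
  sequences. The operators act on every entry.\<close>

definition D :: "(nat \<Rightarrow> (nat \<times> 'e \<Rightarrow>\<^sub>0 int)) \<Rightarrow> nat \<Rightarrow> (nat \<times> 'e \<Rightarrow>\<^sub>0 int)" where
  "D w = (\<lambda>i. lift_op (\<lambda>p. (Suc (fst p), \<delta> (fst p) (snd p))) (w i))"

text \<open>Outside the carrier of R the scalar acts as the identity on valid pairs, since the laws
  of \<open>sc a\<close> are required for every \<open>a\<close> of the type.\<close>

definition sc :: "'a \<Rightarrow> (nat \<Rightarrow> (nat \<times> 'e \<Rightarrow>\<^sub>0 int)) \<Rightarrow> nat \<Rightarrow> (nat \<times> 'e \<Rightarrow>\<^sub>0 int)" where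
  "sc a w = (\<lambda>i. lift_op (\<lambda>p. (fst p, if a \<in> carrier R then a \<odot>\<^bsub>E (fst p)\<^esub> snd p else snd p)) (w i))"

definition t :: "nat \<Rightarrow> (nat \<Rightarrow> (nat \<times> 'e \<Rightarrow>\<^sub>0 int)) \<Rightarrow> nat \<Rightarrow> (nat \<times> 'e \<Rightarrow>\<^sub>0 int)" where
  "t j = sc (f j)"

text \<open>Only entry zero is evaluated; sequences that agree there are equal modulo
  \<open>null\<close>.\<close>

definition EV :: "nat \<Rightarrow> (nat \<Rightarrow> (nat \<times> 'e \<Rightarrow>\<^sub>0 int)) \<Rightarrow> 'e" where
  "EV k w = ev k (w 0)"

definition inc :: "nat \<Rightarrow> 'e \<Rightarrow> nat \<Rightarrow> (nat \<times> 'e \<Rightarrow>\<^sub>0 int)" where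
  "inc k x = (\<lambda>_. frag_of (k, x))"

definition null :: "(nat \<Rightarrow> (nat \<times> 'e \<Rightarrow>\<^sub>0 int)) set" where
  "null = {w. \<forall>k. EV k w = \<zero>\<^bsub>E k\<^esub>}"

text \<open>For negative \<open>k\<close> this is just \<open>null\<close>: the complex is continued
  by zero to all integers, as the index \<open>k - 1\<close> in cones demands.\<close>

definition piece :: "int \<Rightarrow> int \<Rightarrow> (nat \<Rightarrow> (nat \<times> 'e \<Rightarrow>\<^sub>0 int)) set" where
  "piece k n = {w. \<forall>l. (int l = k \<longrightarrow> EV l w \<in> \<E> l n) \<and> (int l \<noteq> k \<longrightarrow> EV l w = \<zero>\<^bsub>E l\<^esub>)}"

lemma EV_carrier [simp]: "EV k w \<in> carrier (E k)"
  by (simp add: EV_def ev_carrier)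

lemma EV_diff [simp]: "EV k (w - w') = EV k w \<ominus>\<^bsub>E k\<^esub> EV k w'"
  by (simp add: EV_def ev_diff)

lemma EV_zero [simp]: "EV k 0 = \<zero>\<^bsub>E k\<^esub>"
  by (simp add: EV_def ev_zero)

lemma EV_sc: "a \<in> carrier R \<Longrightarrow> EV k (sc a w) = a \<odot>\<^bsub>E k\<^esub> EV k w"
  unfolding EV_def sc_def by (rule ev_lift_op) (auto simp: E.smult_r_distr)

lemma EV_t: "EV k (t j w) = f j \<odot>\<^bsub>E k\<^esub> EV k w"
  unfolding t_def by (rule EV_sc[OF f_carrier])

lemma EV_D_Suc: "EV (Suc k) (D w) = \<delta> k (EV k w)"
  unfolding EV_def D_def by (rule ev_lift_op) (auto simp: diff_add diff_closed)

lemma EV_D_0: "EV 0 (D w) = \<zero>\<^bsub>E 0\<^esub>"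
proof -
  have "ev 0 (lift_op (\<lambda>p. (Suc (fst p), \<delta> (fst p) (snd p))) c) = \<zero>\<^bsub>E 0\<^esub>" for c
    by (induction c rule: frag_cases) (auto simp: lift_op_zero lift_op_diff lift_op_of ev_zero ev_diff ev_of E.M.minus_eq)
  then show ?thesis unfolding EV_def D_def by simp
qed

lemma EV_inc: "x \<in> carrier (E k) \<Longrightarrow> EV l (inc k x) = (if l = k then x else \<zero>\<^bsub>E l\<^esub>)"
  by (auto simp: EV_def inc_def ev_of valid_def)

lemma EV_t_pow: "EV k ((t j ^^ m) w) = (f j [^] m) \<odot>\<^bsub>E k\<^esub> EV k w"
proof -
  have "EV k ((t j ^^ m) w) = ((\<lambda>y. f j \<odot>\<^bsub>E k\<^esub> y) ^^ m) (EV k w)"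
    by (induction m) (auto simp: EV_t)
  then show ?thesis by (simp add: E.smult_pow f_carrier)
qed

lemma addv_ops: "addv D" "addv (sc a)" "addv (t j)"
  unfolding addv_def t_def D_def sc_def by (auto simp: fun_eq_iff lift_op_diff)

lemma minus_in_piece: "x \<in> \<E> k n \<Longrightarrow> y \<in> \<E> k n \<Longrightarrow> x \<ominus>\<^bsub>E k\<^esub> y \<in> \<E> k n"
  unfolding E.M.minus_eq by (intro E.mdeg.piece_add E.mdeg.piece_inv)

lemma zero_minus_zero [simp]: "\<zero>\<^bsub>E k\<^esub> \<ominus>\<^bsub>E k\<^esub> \<zero>\<^bsub>E k\<^esub> = \<zero>\<^bsub>E k\<^esub>"
  by (simp add: E.M.minus_eq)

lemma pieceD: "w \<in> piece k n \<Longrightarrow> int l = k \<Longrightarrow> EV l w \<in> \<E> l n" "w \<in> piece k n \<Longrightarrow> int l \<noteq> k \<Longrightarrow> EV l w = \<zero>\<^bsub>E l\<^esub>"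
  by (auto simp: piece_def)

lemma pieceI: "(\<And>l. int l = k \<Longrightarrow> EV l w \<in> \<E> l n) \<Longrightarrow> (\<And>l. int l \<noteq> k \<Longrightarrow> EV l w = \<zero>\<^bsub>E l\<^esub>) \<Longrightarrow> w \<in> piece k n"
  by (auto simp: piece_def)

lemma sc_null: "a \<in> carrier R \<Longrightarrow> w \<in> null \<Longrightarrow> sc a w \<in> null"
  by (auto simp: null_def EV_sc)

lemma sc_piece: "a \<in> \<A> d \<Longrightarrow> w \<in> piece k n \<Longrightarrow> sc a w \<in> piece k (int d + n)"
  using deg.piece_carrier[of a d] by (intro pieceI) (auto simp: EV_sc pieceD E.smult_degree)

lemma D_null: "w \<in> null \<Longrightarrow> D w \<in> null"
proof -
  assume w: "w \<in> null"
  have "EV k (D w) = \<zero>\<^bsub>E k\<^esub>" for k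
    using w by (cases k) (auto simp: null_def EV_D_0 EV_D_Suc diff_zero)
  then show ?thesis unfolding null_def by blast
qed

lemma D_piece: "w \<in> piece k n \<Longrightarrow> D w \<in> piece (k + 1) n"
proof (rule pieceI)
  fix l assume w: "w \<in> piece k n"
  show "int l = k + 1 \<Longrightarrow> EV l (D w) \<in> \<E> l n"
    using pieceD[OF w] E.mdeg.piece_zero by (cases l) (auto simp: EV_D_0 EV_D_Suc diff_degree)
  show "int l \<noteq> k + 1 \<Longrightarrow> EV l (D w) = \<zero>\<^bsub>E l\<^esub>"
    using pieceD[OF w] by (cases l) (auto simp: EV_D_0 EV_D_Suc diff_zero)
qed

lemma D_square: "D (D w) \<in> null"
proof -
  have "EV k (D (D w)) = \<zero>\<^bsub>E k\<^esub>" for k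
  proof (cases k)
    case (Suc l)
    then show ?thesis by (cases l) (auto simp: EV_D_0 EV_D_Suc diff_zero differential_square)
  qed (simp add: EV_D_0)
  then show ?thesis unfolding null_def by blast
qed

lemma complex: "graded_complex D r t sc (\<A> 0) null piece"
proof
  show "addv D" "addv (sc a)" "addv (t j)" for a j by (rule addv_ops)+
  have comm_sc: "D (sc a x) = sc a (D x)" for a x
    unfolding D_def sc_def
    by (intro ext lift_op_comm) (auto simp: valid_def diff_closed diff_smult)
  then show "D (sc a x) = sc a (D x)" "D (t j x) = t j (D x)" for a j x by (simp_all add: t_def)
  have comm2: "sc a (sc b x) = sc b (sc a x)" for a b x
    unfolding sc_def
    by (intro ext lift_op_comm) (auto simp: valid_def E.smult_assoc1[symmetric] m_comm)
  then show "t i (t j x) = t j (t i x)" "t j (sc s x) = sc s (t j x)" for i j s x by (simp_all add: t_def)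
  show "subgp null" unfolding subgp_def null_def by simp
  show "subgp (piece k n)" for k n
    by (rule subgpI; rule pieceI) (auto simp: E.mdeg.piece_zero pieceD minus_in_piece)
  show "x \<in> null \<Longrightarrow> x \<in> piece k n" for x k n
    by (rule pieceI) (auto simp: null_def E.mdeg.piece_zero)
  show "x \<in> null \<Longrightarrow> D x \<in> null" for x by (rule D_null)
  show "x \<in> null \<Longrightarrow> t j x \<in> null" for x j unfolding t_def by (rule sc_null[OF f_carrier])
  show "s \<in> \<A> 0 \<Longrightarrow> x \<in> null \<Longrightarrow> sc s x \<in> null" for s x using sc_null deg.piece_carrier by blast
  show "x \<in> piece k n \<Longrightarrow> D x \<in> piece (k + 1) n" for x k n by (rule D_piece)
  show "x \<in> piece k n \<Longrightarrow> t j x \<in> piece k (n + 1)" for x k n j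
    using sc_piece[OF f_degree, of x k n j] unfolding t_def by (simp add: algebra_simps)
  show "s \<in> \<A> 0 \<Longrightarrow> x \<in> piece k n \<Longrightarrow> sc s x \<in> piece k n" for s x k n
    using sc_piece[of s 0 x k n] by simp
  show "D (D x) \<in> null" for x by (rule D_square)
qed

sublocale C: graded_complex D r t sc "\<A> 0" null piece
  by (rule complex)

lemma null_iff_in_piece:
  assumes w: "w \<in> piece (int k) n"
  shows "w \<in> null \<longleftrightarrow> EV k w = \<zero>\<^bsub>E k\<^esub>"
proof
  assume z: "EV k w = \<zero>\<^bsub>E k\<^esub>"
  have "EV l w = \<zero>\<^bsub>E l\<^esub>" for l
    using z pieceD(2)[OF w, of l] by (cases "l = k") auto
  then show "w \<in> null" unfolding null_def by blast
qed (simp add: null_def)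

lemma inc_piece: "x \<in> \<E> k n \<Longrightarrow> inc k x \<in> piece (int k) n"
  using E.mdeg.piece_carrier[of x k n] by (intro pieceI) (auto simp: EV_inc)

lemma tor_iff:
  assumes J: "J \<subseteq> {..<r}"
  shows "w \<in> C.tor J (int k) n \<longleftrightarrow> w \<in> piece (int k) n \<and> (\<forall>j\<in>J. \<exists>m::nat. (f j [^] m) \<odot>\<^bsub>E k\<^esub> EV k w = \<zero>\<^bsub>E k\<^esub>)"
proof -
  have pow: "(t j ^^ m) w \<in> piece (int k) (n + int m)" if "w \<in> piece (int k) n" "j \<in> J" for j m
  proof (induction m)
    case (Suc m)
    then show ?case using C.A_stable(2)[of j _ "int k" "n + int m"] J that by (auto simp: algebra_simps)
  qed (use that in simp)
  have "(t j ^^ m) w \<in> null \<longleftrightarrow> (f j [^] m) \<odot>\<^bsub>E k\<^esub> EV k w = \<zero>\<^bsub>E k\<^esub>" if "w \<in> piece (int k) n" "j \<in> J" for j m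
    using null_iff_in_piece[OF pow[OF that]] by (simp add: EV_t_pow)
  then show ?thesis unfolding C.tor_def by auto
qed

text \<open>Torsion divisibility of the injective terms, with the generators before \<open>i\<close>
  as the set \<open>T\<close>; in negative cohomological degrees there is nothing to divide.\<close>

lemma divisible: "i < r \<Longrightarrow> C.divisible i"
  unfolding C.divisible_def
proof (intro allI ballI)
  fix k n w assume i: "i < r" and w: "w \<in> C.tor {..<i} k n"
  have J: "{..<i} \<subseteq> {..<r}" using i by auto
  show "\<exists>y\<in>C.tor {..<i} k (n - 1). \<exists>m. (t i ^^ m) (w - t i y) \<in> null"
  proof (cases "k < 0")
    case True
    have "w \<in> piece k n" using w by (simp add: C.tor_def)
    then have "w \<in> null" using True pieceD(2)[of w k n] by (simp add: null_def)
    moreover have "0 \<in> C.tor {..<i} k (n - 1)" by (rule subgp_zero[OF C.tor_sub[OF J]])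
    ultimately show ?thesis
      by (intro bexI[of _ 0] exI[of _ 0]) (simp_all add: addv_zero[OF addv_ops(3)])
  next
    case False
    define l where "l = nat k"
    have k: "k = int l" using False unfolding l_def by simp
    have wp: "w \<in> piece (int l) n" and tors: "\<And>j. j < i \<Longrightarrow> \<exists>m::nat. (f j [^] m) \<odot>\<^bsub>E l\<^esub> EV l w = \<zero>\<^bsub>E l\<^esub>"
      using w tor_iff[OF J, of w l n] unfolding k by auto
    have x: "EV l w \<in> \<E> l n" using pieceD(1)[OF wp] by simp
    have "\<exists>y\<in>\<E> l (n - 1). (\<forall>g\<in>f ` {..<i}. \<exists>m::nat. (g [^] m) \<odot>\<^bsub>E l\<^esub> y = \<zero>\<^bsub>E l\<^esub>) \<and>
      (\<exists>m::nat. (f i [^] m) \<odot>\<^bsub>E l\<^esub> (EV l w \<ominus>\<^bsub>E l\<^esub> f i \<odot>\<^bsub>E l\<^esub> y) = \<zero>\<^bsub>E l\<^esub>)"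
      by (rule E.torsion_divisible[OF injective f_degree x]) (use tors f_degree in auto)
    then obtain y and m :: nat where y: "y \<in> \<E> l (n - 1)" "\<And>j. j < i \<Longrightarrow> \<exists>m::nat. (f j [^] m) \<odot>\<^bsub>E l\<^esub> y = \<zero>\<^bsub>E l\<^esub>"
      "(f i [^] m) \<odot>\<^bsub>E l\<^esub> (EV l w \<ominus>\<^bsub>E l\<^esub> f i \<odot>\<^bsub>E l\<^esub> y) = \<zero>\<^bsub>E l\<^esub>" by auto
    have yc: "y \<in> carrier (E l)" using y(1) by (rule E.mdeg.piece_carrier)
    have yp: "inc l y \<in> piece (int l) (n - 1)" by (rule inc_piece[OF y(1)])
    then have "inc l y \<in> C.tor {..<i} k (n - 1)"
      unfolding k tor_iff[OF J] using y(2) by (simp add: EV_inc yc)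
    moreover have "w - t i (inc l y) \<in> piece (int l) n"
      using subgp_diff[OF C.A_sub wp] C.A_stable(2)[OF i yp] by simp
    then have "w - t i (inc l y) \<in> C.tor {i} (int l) n"
      using tor_iff[of "{i}" "w - t i (inc l y)" l n] i y(3) by (auto simp: EV_t EV_inc yc)
    then have "\<exists>m. (t i ^^ m) (w - t i (inc l y)) \<in> null" unfolding C.tor_def by auto
    ultimately show ?thesis by blast
  qed
qed

end

context plain_module
begin

text \<open>Module laws pass to images. For classes of cocycles it then remains only to compute the
  coset operations on representatives.\<close>

lemma surjective_image_module:
  fixes Q :: "('a, 'q) module"
  assumes H: "submodule H R M" and carrier: "carrier Q = \<pi> ` H"
    and zero: "\<zero>\<^bsub>Q\<^esub> = \<pi> \<zero>\<^bsub>M\<^esub>"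
    and add: "\<And>x y. x \<in> H \<Longrightarrow> y \<in> H \<Longrightarrow> \<pi> x \<oplus>\<^bsub>Q\<^esub> \<pi> y = \<pi> (x \<oplus>\<^bsub>M\<^esub> y)"
    and smult: "\<And>a x. a \<in> carrier R \<Longrightarrow> x \<in> H \<Longrightarrow> a \<odot>\<^bsub>Q\<^esub> \<pi> x = \<pi> (a \<odot>\<^bsub>M\<^esub> x)"
  shows "module R Q"
proof (rule moduleI)
  note HE = submoduleE[OF H]
  have Hc: "x \<in> H \<Longrightarrow> x \<in> carrier M" for x using HE(1) by blast
  note H0 = submodule_zero[OF H]
  show "cring R" by (rule R.is_cring)
  show "abelian_group Q"
  proof (rule abelian_groupI)
    fix x assume "x \<in> carrier Q"
    then obtain u where u: "x = \<pi> u" "u \<in> H" unfolding carrier by blast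
    have "\<pi> (\<ominus>\<^bsub>M\<^esub> u) \<oplus>\<^bsub>Q\<^esub> x = \<zero>\<^bsub>Q\<^esub>"
      using u HE(3) Hc by (simp add: add zero M.l_neg)
    then show "\<exists>y\<in>carrier Q. y \<oplus>\<^bsub>Q\<^esub> x = \<zero>\<^bsub>Q\<^esub>" unfolding carrier using u(2) HE(3) by blast
  next
    fix x y z assume "x \<in> carrier Q" "y \<in> carrier Q" "z \<in> carrier Q"
    then obtain u v w where "x = \<pi> u" "u \<in> H" "y = \<pi> v" "v \<in> H" "z = \<pi> w" "w \<in> H" unfolding carrier by blast
    then show "x \<oplus>\<^bsub>Q\<^esub> y \<oplus>\<^bsub>Q\<^esub> z = x \<oplus>\<^bsub>Q\<^esub> (y \<oplus>\<^bsub>Q\<^esub> z)" by (simp add: add HE(5) Hc M.a_assoc)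
  qed (use HE(5) H0 Hc in \<open>auto simp: carrier zero add M.a_comm\<close>)
qed (use submoduleE(1,4,5)[OF H] in \<open>auto simp: carrier add smult smult_l_distr smult_r_distr smult_assoc1 subset_iff\<close>)

end

section \<open>The cohomology of the resolution is Noetherian\<close>

context injective_complex
begin

lemma tor_empty: "C.tor {..<0} = piece"
  by (intro ext) (auto simp: C.tor_def)

lemma cyc_subset_bnd:
  assumes exact: "\<delta> j ` carrier (E j) = a_kernel (E (Suc j)) (E (Suc (Suc j))) (\<delta> (Suc j))"
  shows "C.cyc (int (Suc j)) n \<subseteq> C.bnd (int (Suc j)) n"
proof
  fix w assume w: "w \<in> C.cyc (int (Suc j)) n"
  have wp: "w \<in> piece (int (Suc j)) n" and Dw: "D w \<in> null" using w by (auto simp: C.cyc_def)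
  define x where "x = EV (Suc j) w"
  have x: "x \<in> \<E> (Suc j) n" "x \<in> carrier (E (Suc j))" unfolding x_def using pieceD(1)[OF wp] by auto
  have "EV (Suc (Suc j)) (D w) = \<zero>\<^bsub>E (Suc (Suc j))\<^esub>" using Dw unfolding null_def by blast
  then have "\<delta> (Suc j) x = \<zero>\<^bsub>E (Suc (Suc j))\<^esub>" by (simp add: EV_D_Suc x_def)
  then have "x \<in> \<delta> j ` carrier (E j)" unfolding exact a_kernel_def' using x by simp
  then obtain y where y: "y \<in> carrier (E j)" "x = \<delta> j y" by blast
  \<comment> \<open>The preimage given by exactness need not be homogeneous. As the differential has
    degree zero, its component of degree \<open>n\<close> already maps to \<open>x\<close>.\<close>
  define yn where "yn = E.mdeg.comp j y n"
  have yn: "yn \<in> \<E> j n" unfolding yn_def by (rule E.mdeg.comp_props(1)[OF y(1)])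
  have "E.mdeg.comp (Suc j) (\<delta> j y) n = \<delta> j yn"
    unfolding yn_def
    by (rule E.mdeg.comp_hom(1)[OF E.mdeg.graded_group_axioms, where \<sigma> = "\<lambda>n. n"])
      (use y(1) diff_closed diff_add diff_degree in auto)
  then have dy: "\<delta> j yn = x" using E.mdeg.comp_homogeneous[OF x(1)] y(2) by simp
  have ic: "inc j yn \<in> piece (int (Suc j) - 1) n" using inc_piece[OF yn] by simp
  have "w - D (inc j yn) \<in> piece (int (Suc j)) n"
    using subgp_diff[OF C.A_sub wp] C.A_stable(1)[OF ic] by (simp only: diff_add_cancel)
  moreover have "EV (Suc j) (w - D (inc j yn)) = \<zero>\<^bsub>E (Suc j)\<^esub>"
    using dy x E.mdeg.piece_carrier[OF yn] by (simp add: EV_D_Suc EV_inc x_def[symmetric] E.M.minus_eq E.M.r_neg)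
  ultimately have "w - D (inc j yn) \<in> null" using null_iff_in_piece by blast
  then show "w \<in> C.bnd (int (Suc j)) n" by (rule C.bndI'[OF ic])
qed

lemma EV_add: "EV k (w + w') = EV k w \<oplus>\<^bsub>E k\<^esub> EV k w'"
  by (simp add: EV_def ev_add)

text \<open>The resolution has cohomology M in degree zero and none elsewhere. A graded chain in
  degree zero is translated into a chain of submodules of M, which stops because M is finitely
  generated over a Noetherian ring.\<close>

lemma noeth:
  fixes M :: "('a, 'm) module"
  assumes M: "graded_module R \<A> M \<M>" and fg: "finitely_generated_module R M"
    and aug: "\<epsilon> \<in> graded_linear_maps R M \<M> (E 0) (\<E> 0)" "inj_on \<epsilon> (carrier M)"
      "\<epsilon> ` carrier M = a_kernel (E 0) (E 1) (\<delta> 0)"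
    and exact: "\<And>k. \<delta> k ` carrier (E k) = a_kernel (E (Suc k)) (E (Suc (Suc k))) (\<delta> (Suc k))"
  shows "C.noeth"
proof -
  interpret Mo: graded_module R \<A> M \<M> by fact
  have eps: "\<And>x. x \<in> carrier M \<Longrightarrow> \<epsilon> x \<in> carrier (E 0)"
    "\<And>x y. x \<in> carrier M \<Longrightarrow> y \<in> carrier M \<Longrightarrow> \<epsilon> (x \<oplus>\<^bsub>M\<^esub> y) = \<epsilon> x \<oplus>\<^bsub>E 0\<^esub> \<epsilon> y"
    "\<And>a x. a \<in> carrier R \<Longrightarrow> x \<in> carrier M \<Longrightarrow> \<epsilon> (a \<odot>\<^bsub>M\<^esub> x) = a \<odot>\<^bsub>E 0\<^esub> \<epsilon> x"
    "\<And>x n. x \<in> \<M> n \<Longrightarrow> \<epsilon> x \<in> \<E> 0 n"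
    using aug(1) unfolding graded_linear_maps_def linear_maps_def by blast+
  have eps0: "\<epsilon> \<zero>\<^bsub>M\<^esub> = \<zero>\<^bsub>E 0\<^esub>"
    using eps(3)[of \<zero> "\<zero>\<^bsub>M\<^esub>"] eps(1)[of "\<zero>\<^bsub>M\<^esub>"] by simp
  have eps_comp: "E.mdeg.comp 0 (\<epsilon> m) n = \<epsilon> (Mo.mdeg.comp m n)" if "m \<in> carrier M" for m n
    by (rule Mo.mdeg.comp_hom(1)[OF E.mdeg.graded_group_axioms, where \<sigma> = "\<lambda>n. n"])
      (use that eps in auto)
  have acc0: "acc_chain (stable_families (\<lambda>n. n + 1) r t sc (\<A> 0) (C.bnd 0) (C.cyc 0))"
  proof (rule acc_chainI)
    fix N assume N: "\<And>p. N p \<in> stable_families (\<lambda>n. n + 1) r t sc (\<A> 0) (C.bnd 0) (C.cyc 0)"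
      and mono: "\<And>p i. N p i \<subseteq> N (Suc p) i"
    note ND = stable_familiesD[OF N]
    \<comment> \<open>The submodule of M with the given homogeneous parts: every component of
      \<open>m\<close> has to be represented in \<open>N p\<close>. Its chain condition stops all
      degrees at once.\<close>
    define P where "P p = {m \<in> carrier M. \<forall>n. \<exists>w\<in>N p n. EV 0 w = \<epsilon> (Mo.mdeg.comp m n)}" for p
    have Pc: "m \<in> carrier M" if "m \<in> P p" for m p using that unfolding P_def by blast
    have PI: "m \<in> P p" if "m \<in> carrier M" "\<And>n. \<exists>w\<in>N p n. EV 0 w = \<epsilon> (Mo.mdeg.comp m n)" for m p
      using that unfolding P_def by blast
    have PE: "\<exists>w\<in>N p n. EV 0 w = \<epsilon> (Mo.mdeg.comp m n)" if "m \<in> P p" for m p n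
      using that unfolding P_def by blast
    have P0: "\<zero>\<^bsub>M\<^esub> \<in> P p" for p
    proof (rule PI)
      show "\<exists>w\<in>N p n. EV 0 w = \<epsilon> (Mo.mdeg.comp \<zero>\<^bsub>M\<^esub> n)" for n
        by (rule bexI[of _ 0]) (auto simp: Mo.mdeg.comp_zero eps0 subgp_zero[OF ND(1)])
    qed simp
    have Padd: "m \<oplus>\<^bsub>M\<^esub> m' \<in> P p" if m: "m \<in> P p" "m' \<in> P p" for m m' p
    proof (rule PI)
      fix n
      obtain w where w: "w \<in> N p n" "EV 0 w = \<epsilon> (Mo.mdeg.comp m n)" using PE[OF m(1)] by blast
      obtain w' where w': "w' \<in> N p n" "EV 0 w' = \<epsilon> (Mo.mdeg.comp m' n)" using PE[OF m(2)] by blast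
      show "\<exists>w\<in>N p n. EV 0 w = \<epsilon> (Mo.mdeg.comp (m \<oplus>\<^bsub>M\<^esub> m') n)"
        by (rule bexI[of _ "w + w'"])
          (use w w' Pc m in \<open>auto simp: EV_add Mo.mdeg.comp_add eps Mo.mdeg.comp_carrier subgp_add[OF ND(1)]\<close>)
    qed (use Pc m in simp)
    have Psc: "a \<odot>\<^bsub>M\<^esub> m \<in> P p" if a: "a \<in> \<A> 0" and m: "m \<in> P p" for a m p
    proof (rule PI)
      fix n
      have ac: "a \<in> carrier R" using a deg.piece_carrier by blast
      obtain w where w: "w \<in> N p n" "EV 0 w = \<epsilon> (Mo.mdeg.comp m n)" using PE[OF m] by blast
      have "Mo.mdeg.comp (a \<odot>\<^bsub>M\<^esub> m) n = a \<odot>\<^bsub>M\<^esub> Mo.mdeg.comp m n"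
        using Mo.comp_homogeneous_smult[OF a Pc[OF m], of n] by simp
      then show "\<exists>w\<in>N p n. EV 0 w = \<epsilon> (Mo.mdeg.comp (a \<odot>\<^bsub>M\<^esub> m) n)"
        using w ac Pc[OF m] ND(4)[OF a w(1)] by (intro bexI[of _ "sc a w"]) (auto simp: EV_sc eps Mo.mdeg.comp_carrier)
    qed (use Pc m a deg.piece_carrier in blast)
    have Pinv: "\<ominus>\<^bsub>M\<^esub> m \<in> P p" if m: "m \<in> P p" for m p
      using Psc[OF deg.piece_inv[OF one_degree_zero] m] Pc[OF m] by (simp add: Mo.smult_l_minus)
    have Pt: "f j \<odot>\<^bsub>M\<^esub> m \<in> P p" if j: "j < r" and m: "m \<in> P p" for j m p
    proof (rule PI)
      fix n
      obtain w where w: "w \<in> N p (n - 1)" "EV 0 w = \<epsilon> (Mo.mdeg.comp m (n - 1))" using PE[OF m] by blast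
      have "Mo.mdeg.comp (f j \<odot>\<^bsub>M\<^esub> m) n = f j \<odot>\<^bsub>M\<^esub> Mo.mdeg.comp m (n - 1)"
        using Mo.comp_homogeneous_smult[OF f_degree Pc[OF m], of j "n - 1"] by simp
      then show "\<exists>w\<in>N p n. EV 0 w = \<epsilon> (Mo.mdeg.comp (f j \<odot>\<^bsub>M\<^esub> m) n)"
        using w f_carrier Pc[OF m] ND(5)[OF j w(1)] by (intro bexI[of _ "t j w"]) (auto simp: EV_t eps Mo.mdeg.comp_carrier)
    qed (use Pc m f_carrier in blast)
    have Psm: "a \<odot>\<^bsub>M\<^esub> m \<in> P p" if "a \<in> carrier R" "m \<in> P p" for a m p
      using std that
    proof (induction arbitrary: m rule: standard_induct)
      case (zero a) then show ?case using Psc by blast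
    next
      case (one a)
      \<comment> \<open>The scalars preserving \<open>P p\<close> form an R_0-stable subgroup. It
        contains the f_j, hence all of R_1.\<close>
      define W where "W = {b \<in> carrier R. \<forall>m\<in>P p. b \<odot>\<^bsub>M\<^esub> m \<in> P p}"
      have "additive_subgroup W R"
        by (rule additive_subgroupI)
          (use P0 Padd Pinv Pc in \<open>auto simp: W_def Mo.smult_l_distr Mo.smult_l_minus\<close>)
      moreover have "\<forall>b\<in>\<A> 0. \<forall>c\<in>W. b \<otimes> c \<in> W"
        using Psc Pc deg.piece_carrier by (auto simp: W_def Mo.smult_assoc1)
      moreover have "\<forall>i<r. f i \<in> W" using Pt f_carrier by (auto simp: W_def)
      ultimately have "\<A> 1 \<subseteq> W" using generators unfolding generates_degree_one_def by blast
      then show ?case using one unfolding W_def by blast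
    next
      case (add a b) then show ?case using Padd Pc by (simp add: Mo.smult_l_distr)
    next
      case (inv a) then show ?case using Pinv Pc by (simp add: Mo.smult_l_minus)
    next
      case (mult a b) then show ?case using Pc by (simp add: Mo.smult_assoc1)
    qed
    have Psub: "submodule (P p) R M" for p
      by (rule Mo.submoduleI) (use Pc P0 Padd Pinv Psm in auto)
    have Pmono: "P p \<subseteq> P (Suc p)" for p
      unfolding P_def using mono[of p] by blast
    obtain q where q: "\<And>p. p \<ge> q \<Longrightarrow> P p \<subseteq> P q"
      using Mo.submodule_sequence_stable[where N = P, OF noetherian_ring_axioms fg Psub Pmono] by blast
    have "N p n \<subseteq> N q n" if p: "p \<ge> q" for p n
    proof
      fix w assume w: "w \<in> N p n"
      have "w \<in> C.cyc (int 0) n" using ND(3)[OF w] by simp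
      then have wp: "w \<in> piece (int 0) n" and Dw: "D w \<in> null" unfolding C.cyc_def by auto
      have x: "EV 0 w \<in> \<E> 0 n" using pieceD(1)[OF wp] by simp
      have "\<delta> 0 (EV 0 w) = \<zero>\<^bsub>E (Suc 0)\<^esub>" using Dw EV_D_Suc[of 0 w] unfolding null_def by auto
      then have "EV 0 w \<in> \<epsilon> ` carrier M" unfolding aug(3) a_kernel_def' by simp
      then obtain m where m: "m \<in> carrier M" "EV 0 w = \<epsilon> m" by blast
      \<comment> \<open>Injectivity of the augmentation makes the preimage of a homogeneous element
        homogeneous.\<close>
      have mc: "Mo.mdeg.comp m n' = \<zero>\<^bsub>M\<^esub>" if n': "n' \<noteq> n" for n'
      proof -
        have "\<epsilon> (Mo.mdeg.comp m n') = \<epsilon> \<zero>\<^bsub>M\<^esub>"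
          using eps_comp[OF m(1), of n'] E.mdeg.comp_homogeneous[OF x] n' m(2) eps0 by simp
        then show ?thesis using aug(2) Mo.mdeg.comp_carrier[OF m(1)] by (auto dest: inj_onD)
      qed
      have mn: "Mo.mdeg.comp m n = m" using Mo.mdeg.homogeneousI(1)[OF m(1) mc] by simp
      have "m \<in> P p"
      proof (rule PI[OF m(1)])
        fix n' show "\<exists>w\<in>N p n'. EV 0 w = \<epsilon> (Mo.mdeg.comp m n')"
        proof (cases "n' = n")
          case True
          then show ?thesis using w m(2) mn by auto
        next
          case False
          then show ?thesis
            by (intro bexI[of _ 0]) (auto simp: mc eps0 subgp_zero[OF ND(1)])
        qed
      qed
      then have "m \<in> P q" using q[OF p] by blast
      then obtain w' where w': "w' \<in> N q n" "EV 0 w' = EV 0 w" using PE[of m q n] mn m(2) by auto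
      have "w' \<in> piece (int 0) n" using ND(3)[OF w'(1)] by (simp add: C.cyc_def)
      then have "w - w' \<in> piece (int 0) n" by (rule subgp_diff[OF C.A_sub wp])
      moreover have "EV 0 (w - w') = \<zero>\<^bsub>E 0\<^esub>" using w'(2) by (simp add: E.M.minus_eq E.M.r_neg)
      ultimately have "w - w' \<in> null" using null_iff_in_piece by blast
      then have "w - w' \<in> N q n" by (rule ND(2)[OF C.B_bnd])
      then show "w \<in> N q n" using subgp_add_cancel[OF ND(1) _ w'(1)] by blast
    qed
    then show "\<exists>q. \<forall>p\<ge>q. \<forall>i. N p i \<subseteq> N q i" by blast
  qed
  show ?thesis unfolding C.noeth_def
  proof
    fix k :: int
    have "k = int (Suc (nat (k - 1)))" if "k > 0" using that by simp
    then consider "k < 0" | "k = 0" | j where "k = int (Suc j)"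
      by (metis linorder_neqE)
    then show "acc_chain (stable_families (\<lambda>n. n + 1) r t sc (\<A> 0) (C.bnd k) (C.cyc k))"
    proof cases
      case 1
      have "w \<in> C.bnd k n" if w: "w \<in> C.cyc k n" for w n
      proof (rule C.B_bnd)
        have "w \<in> piece k n" using w by (simp add: C.cyc_def)
        then show "w \<in> null" using 1 pieceD(2)[of w k n] by (simp add: null_def)
      qed
      then show ?thesis by (rule acc_chain_trivial)
    next
      case 2 then show ?thesis using acc0 by simp
    next
      case (3 j)
      then show ?thesis using cyc_subset_bnd[OF exact] by (intro acc_chain_trivial) blast
    qed
  qed
qed

end

section \<open>Components of the cohomology\<close>

context injective_complex
begin

context
  fixes J :: "'a set" and i :: nat and n :: int
  assumes J: "ideal J R" and R0: "cring (degree_zero_ring R \<A>)"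
begin

abbreviation (input) torsion :: "nat \<Rightarrow> 'e set" where
  "torsion k \<equiv> pair_torsion R (irrelevant_ideal R \<A>) J (E k)"

abbreviation (input) cocycles :: "'e set" where
  "cocycles \<equiv> pair_cocycles R (irrelevant_ideal R \<A>) J E \<delta> (Suc i)"

abbreviation (input) coboundaries :: "'e set" where
  "coboundaries \<equiv> pair_coboundaries R (irrelevant_ideal R \<A>) J E \<delta> (Suc i)"

abbreviation (input) component :: "('a, 'e set) module" where
  "component \<equiv> pair_local_cohomology_component R (irrelevant_ideal R \<A>) J E \<E> \<delta> (Suc i) n"

abbreviation (input) cls :: "'e \<Rightarrow> 'e set" where
  "cls x \<equiv> coboundaries +>\<^bsub>E (Suc i)\<^esub> x"

lemma torsion_submodule: "submodule (torsion k) R (E k)"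
  by (rule E.pair_torsion_submodule[OF ideal_irrelevant J])

lemma torsion_carrier: "x \<in> torsion k \<Longrightarrow> x \<in> carrier (E k)"
  using E.submoduleE(1)[OF torsion_submodule] by blast

lemma coboundaries_eq: "coboundaries = \<delta> i ` torsion i"
  by (simp add: pair_coboundaries_def)

lemma diff_minus: "x \<in> carrier (E k) \<Longrightarrow> \<delta> k (\<ominus>\<^bsub>E k\<^esub> x) = \<ominus>\<^bsub>E (Suc k)\<^esub> \<delta> k x"
  using diff_smult[of "\<ominus> \<one>" x k] diff_closed by (simp add: E.smult_l_minus)

lemma coboundaries_submodule: "submodule coboundaries R (E (Suc i))"
  unfolding coboundaries_eq
proof (rule E.submoduleI)
  note T = E.submoduleE[OF torsion_submodule[of i]] and tc = torsion_carrier[of _ i]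
  show "\<delta> i ` torsion i \<subseteq> carrier (E (Suc i))" using tc diff_closed by blast
  have "\<delta> i \<zero>\<^bsub>E i\<^esub> \<in> \<delta> i ` torsion i" using E.submodule_zero[OF torsion_submodule] by blast
  then show "\<zero>\<^bsub>E (Suc i)\<^esub> \<in> \<delta> i ` torsion i" by (simp add: diff_zero)
next
  fix x assume "x \<in> \<delta> i ` torsion i"
  then obtain u where u: "u \<in> torsion i" "x = \<delta> i u" by blast
  have "\<delta> i (\<ominus>\<^bsub>E i\<^esub> u) \<in> \<delta> i ` torsion i" using E.submoduleE(3)[OF torsion_submodule u(1)] by blast
  then show "\<ominus>\<^bsub>E (Suc i)\<^esub> x \<in> \<delta> i ` torsion i" using u torsion_carrier by (simp add: diff_minus)
next
  fix x y assume xy: "x \<in> \<delta> i ` torsion i" "y \<in> \<delta> i ` torsion i"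
  obtain u where u: "u \<in> torsion i" "x = \<delta> i u" using xy(1) by blast
  obtain v where v: "v \<in> torsion i" "y = \<delta> i v" using xy(2) by blast
  have "\<delta> i (u \<oplus>\<^bsub>E i\<^esub> v) \<in> \<delta> i ` torsion i" using E.submoduleE(5)[OF torsion_submodule u(1) v(1)] by blast
  then show "x \<oplus>\<^bsub>E (Suc i)\<^esub> y \<in> \<delta> i ` torsion i" using u v torsion_carrier by (simp add: diff_add)
next
  fix a x assume a: "a \<in> carrier R" and x: "x \<in> \<delta> i ` torsion i"
  obtain u where u: "u \<in> torsion i" "x = \<delta> i u" using x by blast
  have "\<delta> i (a \<odot>\<^bsub>E i\<^esub> u) \<in> \<delta> i ` torsion i" using E.submoduleE(4)[OF torsion_submodule a u(1)] by blast
  then show "a \<odot>\<^bsub>E (Suc i)\<^esub> x \<in> \<delta> i ` torsion i" using u torsion_carrier a by (simp add: diff_smult)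
qed

lemma cocycle_iff: "x \<in> cocycles \<longleftrightarrow> x \<in> torsion (Suc i) \<and> \<delta> (Suc i) x = \<zero>\<^bsub>E (Suc (Suc i))\<^esub>"
  by (simp add: pair_cocycles_def)

lemma degree_zero_module: "module (degree_zero_ring R \<A>) (E k)"
proof (rule moduleI)
  fix a b x y assume "a \<in> carrier (degree_zero_ring R \<A>)" "b \<in> carrier (degree_zero_ring R \<A>)"
    and x: "x \<in> carrier (E k)"
  then have ab: "a \<in> carrier R" "b \<in> carrier R" using deg.piece_carrier[of _ 0] by (auto simp: degree_zero_ring_def)
  show "(a \<oplus>\<^bsub>degree_zero_ring R \<A>\<^esub> b) \<odot>\<^bsub>E k\<^esub> x = a \<odot>\<^bsub>E k\<^esub> x \<oplus>\<^bsub>E k\<^esub> b \<odot>\<^bsub>E k\<^esub> x"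
    "(a \<otimes>\<^bsub>degree_zero_ring R \<A>\<^esub> b) \<odot>\<^bsub>E k\<^esub> x = a \<odot>\<^bsub>E k\<^esub> (b \<odot>\<^bsub>E k\<^esub> x)"
    using ab x by (simp_all add: degree_zero_ring_def E.smult_l_distr E.smult_assoc1)
next
  show "abelian_group (E k)" by (rule E.M.abelian_group_axioms)
qed (use R0 deg.piece_carrier[of _ 0] in \<open>auto simp: degree_zero_ring_def E.smult_r_distr\<close>)

text \<open>Only scalars of degree zero preserve the degree \<open>n\<close>, hence the change of
  base ring.\<close>

lemma homogeneous_cocycles_submodule:
  "submodule (cocycles \<inter> \<E> (Suc i) n) (degree_zero_ring R \<A>) (E (Suc i))"
proof -
  interpret E0: module "degree_zero_ring R \<A>" "E (Suc i)" by (rule degree_zero_module)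
  note T = E.submoduleE[OF torsion_submodule[of "Suc i"]]
  have tc: "x \<in> cocycles \<Longrightarrow> x \<in> carrier (E (Suc i))" for x using torsion_carrier cocycle_iff by blast
  show ?thesis
  proof (rule E0.submoduleI)
    show "cocycles \<inter> \<E> (Suc i) n \<subseteq> carrier (E (Suc i))" using tc by blast
    show "\<zero>\<^bsub>E (Suc i)\<^esub> \<in> cocycles \<inter> \<E> (Suc i) n"
      by (simp add: cocycle_iff E.submodule_zero[OF torsion_submodule] diff_zero E.mdeg.piece_zero)
    show "\<ominus>\<^bsub>E (Suc i)\<^esub> x \<in> cocycles \<inter> \<E> (Suc i) n" if "x \<in> cocycles \<inter> \<E> (Suc i) n" for x
      using that tc T(3) by (auto simp: cocycle_iff diff_minus E.mdeg.piece_inv)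
    show "x \<oplus>\<^bsub>E (Suc i)\<^esub> y \<in> cocycles \<inter> \<E> (Suc i) n"
      if "x \<in> cocycles \<inter> \<E> (Suc i) n" "y \<in> cocycles \<inter> \<E> (Suc i) n" for x y
      using that tc T(5) by (auto simp: cocycle_iff diff_add E.mdeg.piece_add)
    fix a x assume "a \<in> carrier (degree_zero_ring R \<A>)" "x \<in> cocycles \<inter> \<E> (Suc i) n"
    moreover from this have "a \<in> \<A> 0" "a \<in> carrier R" using deg.piece_carrier[of _ 0] by (auto simp: degree_zero_ring_def)
    ultimately show "a \<odot>\<^bsub>E (Suc i)\<^esub> x \<in> cocycles \<inter> \<E> (Suc i) n"
      using tc T(4) E.smult_degree[of a 0 x "Suc i" n] by (auto simp: cocycle_iff diff_smult)
  qed
qed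

lemma coboundaries_abelian_subgroup: "abelian_subgroup coboundaries (E (Suc i))"
  by (intro abelian_subgroupI3 additive_subgroup.intro submodule.axioms(1)[OF coboundaries_submodule] E.M.abelian_group_axioms)

lemma component_carrier: "carrier component = cls ` (cocycles \<inter> \<E> (Suc i) n)"
  by (simp add: pair_local_cohomology_component_def)

lemma component_zero: "\<zero>\<^bsub>component\<^esub> = coboundaries"
  by (simp add: pair_local_cohomology_component_def pair_local_cohomology_def quotient_module_def)

lemma class_zero_iff: "x \<in> coboundaries \<Longrightarrow> cls x = coboundaries"
  using E.M.a_coset_join2[of x "Suc i"] submodule.axioms(1)[OF coboundaries_submodule]
    E.submoduleE(1)[OF coboundaries_submodule] by blast

lemma component_add:
  assumes "x \<in> carrier (E (Suc i))" "y \<in> carrier (E (Suc i))"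
  shows "cls x \<oplus>\<^bsub>component\<^esub> cls y = cls (x \<oplus>\<^bsub>E (Suc i)\<^esub> y)"
proof -
  have "X \<oplus>\<^bsub>component\<^esub> Y = X <+>\<^bsub>E (Suc i)\<^esub> Y" for X Y
    by (simp add: pair_local_cohomology_component_def pair_local_cohomology_def quotient_module_def set_add_def' )
  then show ?thesis using abelian_subgroup.a_rcos_sum[OF coboundaries_abelian_subgroup assms] by simp
qed

lemma component_smult:
  assumes a: "a \<in> carrier R" and x: "x \<in> carrier (E (Suc i))"
  shows "a \<odot>\<^bsub>component\<^esub> cls x = cls (a \<odot>\<^bsub>E (Suc i)\<^esub> x)"
proof -
  have 1: "a \<odot>\<^bsub>component\<^esub> C = (\<Union>y\<in>C. cls (a \<odot>\<^bsub>E (Suc i)\<^esub> y))" for C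
    by (simp add: pair_local_cohomology_component_def pair_local_cohomology_def quotient_module_def a_r_coset_def')
  \<comment> \<open>Coboundaries are stable under \<open>a\<close>, so the union that defines scalar
    multiplication runs over copies of one coset.\<close>
  have 2: "cls (a \<odot>\<^bsub>E (Suc i)\<^esub> y) = cls (a \<odot>\<^bsub>E (Suc i)\<^esub> x)" if y: "y \<in> cls x" for y
  proof -
    obtain b where b: "b \<in> coboundaries" "y = b \<oplus>\<^bsub>E (Suc i)\<^esub> x" using y unfolding a_r_coset_def' by blast
    have bc: "b \<in> carrier (E (Suc i))" using b E.submoduleE(1)[OF coboundaries_submodule] by blast
    have "a \<odot>\<^bsub>E (Suc i)\<^esub> y = a \<odot>\<^bsub>E (Suc i)\<^esub> b \<oplus>\<^bsub>E (Suc i)\<^esub> a \<odot>\<^bsub>E (Suc i)\<^esub> x"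
      using b bc a x by (simp add: E.smult_r_distr)
    moreover have "a \<odot>\<^bsub>E (Suc i)\<^esub> b \<in> coboundaries" using E.submoduleE(4)[OF coboundaries_submodule a b(1)] .
    ultimately have "a \<odot>\<^bsub>E (Suc i)\<^esub> y \<in> cls (a \<odot>\<^bsub>E (Suc i)\<^esub> x)" unfolding a_r_coset_def' by blast
    then show ?thesis
      using E.M.a_repr_independence[of "a \<odot>\<^bsub>E (Suc i)\<^esub> y" "Suc i"] a x submodule.axioms(1)[OF coboundaries_submodule] by auto
  qed
  have "x \<in> cls x" using abelian_subgroup.a_rcos_self[OF coboundaries_abelian_subgroup x] .
  then show ?thesis unfolding 1 using 2 by blast
qed

lemma component_module: "module (degree_zero_ring R \<A>) component"
proof -
  interpret E0: plain_module "degree_zero_ring R \<A>" "E (Suc i)"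
    unfolding plain_module_def by (rule degree_zero_module)
  note H = homogeneous_cocycles_submodule
  have Hc: "x \<in> cocycles \<inter> \<E> (Suc i) n \<Longrightarrow> x \<in> carrier (E (Suc i))" for x using E0.submoduleE(1)[OF H] by blast
  show ?thesis
  proof (rule E0.surjective_image_module[OF H component_carrier])
    show "\<zero>\<^bsub>component\<^esub> = cls \<zero>\<^bsub>E (Suc i)\<^esub>"
      using class_zero_iff[OF E.submodule_zero[OF coboundaries_submodule]] component_zero by simp
  qed (use Hc component_add component_smult deg.piece_carrier[of _ 0] in \<open>auto simp: degree_zero_ring_def\<close>)
qed

lemma component_fg_if_stable:
  assumes stable: "\<And>P. (\<And>p::nat. submodule (P p) (degree_zero_ring R \<A>) component) \<Longrightarrow> (\<And>p. P p \<subseteq> P (Suc p)) \<Longrightarrow>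
      \<exists>q. \<forall>p\<ge>q. P p \<subseteq> P q"
  shows "finitely_generated_module (degree_zero_ring R \<A>) component"
proof -
  interpret Q: plain_module "degree_zero_ring R \<A>" component
    unfolding plain_module_def by (rule component_module)
  show ?thesis by (rule Q.finitely_generated_if_sequences_stable[OF stable])
qed

text \<open>Everything is torsion in this case, so the torsion complex is the resolution itself,
  which is exact in positive degrees.\<close>

lemma component_fg_unit_ideal:
  assumes "J = carrier R"
    and exact: "\<delta> i ` carrier (E i) = a_kernel (E (Suc i)) (E (Suc (Suc i))) (\<delta> (Suc i))"
  shows "finitely_generated_module (degree_zero_ring R \<A>) component"
proof (rule component_fg_if_stable)
  interpret Q: plain_module "degree_zero_ring R \<A>" component
    unfolding plain_module_def by (rule component_module)
  have T: "torsion k = carrier (E k)" for k by (rule E.pair_torsion_one[OF ideal_irrelevant assms(1)])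
  have "cocycles \<subseteq> coboundaries"
    unfolding coboundaries_eq T exact a_kernel_def' by (auto simp: cocycle_iff T)
  then have "carrier component \<subseteq> {\<zero>\<^bsub>component\<^esub>}"
    unfolding component_carrier component_zero using class_zero_iff by blast
  moreover fix P :: "nat \<Rightarrow> 'e set set" assume P: "\<And>p. submodule (P p) (degree_zero_ring R \<A>) component"
  ultimately have "P p \<subseteq> P 0" for p
    using Q.submodule_zero[OF P[of 0]] Q.submoduleE(1)[OF P[of p]] by blast
  then show "\<exists>q. \<forall>p\<ge>q. P p \<subseteq> P q" by blast
qed

text \<open>On homogeneous elements, torsion for the pair means nilpotence of all f_j:
  \<open>torI\<close> is the direction from Nakayama's lemma, \<open>torE\<close> the converse. A
  chain of submodules of the component is pulled back to formal cocycles, where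
  \<open>degreewise_fin\<close> stops it.\<close>

lemma component_fg:
  assumes loc: "is_local_ring (degree_zero_ring R \<A>) \<mm>" and S: "S \<subseteq> \<A> 0" "S \<subseteq> \<mm>" and JS: "J = Idl S"
    and noeth: "C.noeth"
  shows "finitely_generated_module (degree_zero_ring R \<A>) component"
proof (rule component_fg_if_stable)
  interpret Q: plain_module "degree_zero_ring R \<A>" component
    unfolding plain_module_def by (rule component_module)
  interpret T: graded_complex D r t sc "\<A> 0" null "C.tor {..<r}" by (rule C.tor_complex) simp
  have r: "{..<r} \<subseteq> {..<r}" by simp
  \<comment> \<open>The start is \<open>j = 0\<close>: no torsion has been imposed yet, and the
    Noetherian complex is the resolution.\<close>
  have fin: "graded_complex.degreewise_fin D t sc (\<A> 0) null (C.tor {..<r})"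
    by (rule degreewise_fin_tor[OF complex, of 0]) (use divisible noeth in \<open>simp_all only: tor_empty\<close>)
  have torI: "inc k x \<in> C.tor {..<r} (int k) n" if x: "x \<in> \<E> k n" "x \<in> torsion k" for k x
    unfolding tor_iff[OF r]
  proof (intro conjI ballI inc_piece[OF x(1)])
    fix j
    show "\<exists>m::nat. (f j [^] m) \<odot>\<^bsub>E k\<^esub> EV k (inc k x) = \<zero>\<^bsub>E k\<^esub>"
      using E.pair_torsion_homogeneous_nilpotent[OF loc S x[unfolded JS] f_degree]
        E.mdeg.piece_carrier[OF x(1)] by (simp add: EV_inc)
  qed
  have torE: "EV k w \<in> torsion k" "EV k w \<in> \<E> k n" if w: "w \<in> C.tor {..<r} (int k) n" for k w
  proof -
    have "w \<in> piece (int k) n" "\<And>j. j < r \<Longrightarrow> \<exists>m::nat. (f j [^] m) \<odot>\<^bsub>E k\<^esub> EV k w = \<zero>\<^bsub>E k\<^esub>"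
      using w unfolding tor_iff[OF r] by auto
    then show "EV k w \<in> torsion k" "EV k w \<in> \<E> k n"
      using E.pair_torsion_if_nilpotent[OF generators EV_carrier additive_subgroup.zero_closed[OF ideal.axioms(1)[OF J]]]
        pieceD(1) by auto
  qed
  fix P :: "nat \<Rightarrow> 'e set set"
  assume P: "\<And>p. submodule (P p) (degree_zero_ring R \<A>) component" and mono: "\<And>p. P p \<subseteq> P (Suc p)"
  \<comment> \<open>The preimage of \<open>P p\<close> among the formal cocycles; coboundaries
    belong to it because their class is the zero of the component.\<close>
  define N where "N p (u::unit) = {w \<in> T.cyc (int (Suc i)) n. cls (EV (Suc i) w) \<in> P p}" for p u
  have cycE: "EV (Suc i) w \<in> cocycles \<inter> \<E> (Suc i) n" if w: "w \<in> T.cyc (int (Suc i)) n" for w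
  proof -
    have w': "w \<in> C.tor {..<r} (int (Suc i)) n" "D w \<in> null" using w by (auto simp: T.cyc_def)
    have "\<delta> (Suc i) (EV (Suc i) w) = \<zero>\<^bsub>E (Suc (Suc i))\<^esub>"
      using w'(2) EV_D_Suc[of "Suc i" w] unfolding null_def by auto
    then show ?thesis using torE[OF w'(1)] by (simp add: cocycle_iff)
  qed
  have bndE: "cls (EV (Suc i) w) = coboundaries" if w: "w \<in> T.bnd (int (Suc i)) n" for w
  proof -
    obtain y where y: "y \<in> C.tor {..<r} (int (Suc i) - 1) n" "w - D y \<in> null" using w by (rule T.bndE)
    have y': "EV i y \<in> torsion i" using y(1) by (intro torE) simp
    have "EV (Suc i) w \<ominus>\<^bsub>E (Suc i)\<^esub> \<delta> i (EV i y) = \<zero>\<^bsub>E (Suc i)\<^esub>"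
    proof -
      have "EV (Suc i) (w - D y) = \<zero>\<^bsub>E (Suc i)\<^esub>" using y(2) unfolding null_def by blast
      then show ?thesis by (simp add: EV_D_Suc)
    qed
    then have "EV (Suc i) w = \<zero>\<^bsub>E (Suc i)\<^esub> \<oplus>\<^bsub>E (Suc i)\<^esub> \<delta> i (EV i y)"
      using diff_closed[OF EV_carrier[of i y]] EV_carrier[of "Suc i" w]
      by (metis E.M.add.inv_solve_right E.M.minus_eq E.M.zero_closed)
    then have "EV (Suc i) w = \<delta> i (EV i y)" using diff_closed[OF EV_carrier] by simp
    then have "EV (Suc i) w \<in> coboundaries" using y' by (simp add: coboundaries_eq)
    then show ?thesis by (rule class_zero_iff)
  qed
  have zeroP: "coboundaries \<in> P p" for p using Q.submodule_zero[OF P] component_zero by simp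
  have class_diff: "cls (EV (Suc i) (w - w')) = cls (EV (Suc i) w) \<ominus>\<^bsub>component\<^esub> cls (EV (Suc i) w')"
    if w: "w \<in> T.cyc (int (Suc i)) n" "w' \<in> T.cyc (int (Suc i)) n" for w w'
  proof -
    have d: "w - w' \<in> T.cyc (int (Suc i)) n" by (rule subgp_diff[OF T.cyc_sub w])
    have cc: "cls (EV (Suc i) v) \<in> carrier component" if "v \<in> T.cyc (int (Suc i)) n" for v
      using cycE[OF that] component_carrier by blast
    have "cls (EV (Suc i) (w - w')) \<oplus>\<^bsub>component\<^esub> cls (EV (Suc i) w') = cls (EV (Suc i) w)"
      using component_add[of "EV (Suc i) (w - w')" "EV (Suc i) w'"] EV_add[of "Suc i" "w - w'" w'] by simp
    then show ?thesis using cc[OF d] cc[OF w(1)] cc[OF w(2)] by (metis Q.M.add.inv_solve_right' Q.M.minus_eq)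
  qed
  have "N p \<in> stable_families (\<lambda>u. u) 0 t sc (\<A> 0) (\<lambda>_. T.bnd (int (Suc i)) n) (\<lambda>_. T.cyc (int (Suc i)) n)" for p
  proof (rule stable_familiesI)
    fix u
    show "subgp (N p u)"
    proof (rule subgpI)
      have "cls (EV (Suc i) 0) \<in> P p" using bndE[OF subgp_zero[OF T.bnd_sub]] zeroP by simp
      then show "0 \<in> N p u" using subgp_zero[OF T.cyc_sub] by (simp add: N_def)
    next
      fix w w' assume w: "w \<in> N p u" "w' \<in> N p u"
      then show "w - w' \<in> N p u"
        using subgp_diff[OF T.cyc_sub, of w _ _ w'] class_diff[of w w'] Q.submodule_diff[OF P] by (auto simp: N_def)
    qed
    show "w \<in> N p u" if "w \<in> T.bnd (int (Suc i)) n" for w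
      using T.bnd_cyc[OF that] bndE[OF that] zeroP by (simp add: N_def)
    show "w \<in> T.cyc (int (Suc i)) n" if "w \<in> N p u" for w using that by (simp add: N_def)
    show "sc s w \<in> N p u" if s: "s \<in> \<A> 0" and w: "w \<in> N p u" for s w
    proof -
      have wc: "w \<in> T.cyc (int (Suc i)) n" "cls (EV (Suc i) w) \<in> P p" using w by (auto simp: N_def)
      have sR: "s \<in> carrier R" by (rule deg.piece_carrier[OF s])
      have "s \<odot>\<^bsub>component\<^esub> cls (EV (Suc i) w) \<in> P p"
        by (rule Q.submoduleE(4)[OF P _ wc(2)]) (use s in \<open>simp add: degree_zero_ring_def\<close>)
      then have "cls (EV (Suc i) (sc s w)) \<in> P p" by (simp add: EV_sc[OF sR] component_smult[OF sR])
      then show ?thesis using T.cyc_stable(2)[OF s wc(1)] by (simp add: N_def)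
    qed
  qed auto
  moreover have "N p u \<subseteq> N (Suc p) u" for p u using mono by (auto simp: N_def)
  moreover have "acc_chain (stable_families (\<lambda>u::unit. u) 0 t sc (\<A> 0) (\<lambda>_. T.bnd (int (Suc i)) n) (\<lambda>_. T.cyc (int (Suc i)) n))"
    using fin unfolding T.degreewise_fin_def by blast
  ultimately obtain q where q: "\<And>p u. p \<ge> q \<Longrightarrow> N p u \<subseteq> N q u"
    using acc_chainD[of _ N] by metis
  have "P p \<subseteq> P q" if p: "p \<ge> q" for p
  proof
    fix X assume X: "X \<in> P p"
    then have "X \<in> carrier component" using Q.submoduleE(1)[OF P] by blast
    then obtain x where x: "X = cls x" "x \<in> cocycles" "x \<in> \<E> (Suc i) n" unfolding component_carrier by blast
    have xc: "x \<in> carrier (E (Suc i))" by (rule E.mdeg.piece_carrier[OF x(3)])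
    have ix: "inc (Suc i) x \<in> C.tor {..<r} (int (Suc i)) n"
      using torI[OF x(3)] x(2) unfolding cocycle_iff by blast
    have Dp: "D (inc (Suc i) x) \<in> piece (int (Suc (Suc i))) n"
      using D_piece[OF inc_piece[OF x(3)]] by (simp add: algebra_simps)
    have "EV (Suc (Suc i)) (D (inc (Suc i) x)) = \<zero>\<^bsub>E (Suc (Suc i))\<^esub>"
      using x(2) xc unfolding cocycle_iff by (simp add: EV_D_Suc EV_inc)
    then have "D (inc (Suc i) x) \<in> null" using null_iff_in_piece[OF Dp] by simp
    then have "inc (Suc i) x \<in> N p ()"
      using ix X x(1) xc by (simp add: N_def T.cyc_def EV_inc)
    then have "inc (Suc i) x \<in> N q ()" using q[OF p] by blast
    then show "X \<in> P q" using x(1) xc by (simp add: N_def EV_inc)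
  qed
  then show "\<exists>q. \<forall>p\<ge>q. P p \<subseteq> P q" by blast
qed

end

end

theorem theorem5p4:
  fixes R :: "('a, 'r) ring_scheme" and \<A> :: "nat \<Rightarrow> 'a set"
    and \<mm>\<^sub>0 J :: "'a set"
    and M :: "('a, 'm) module" and \<M> :: "int \<Rightarrow> 'm set"
    and E :: "nat \<Rightarrow> ('a, 'e) module" and \<E> :: "nat \<Rightarrow> int \<Rightarrow> 'e set"
    and \<epsilon> :: "'m \<Rightarrow> 'e" and \<delta> :: "nat \<Rightarrow> 'e \<Rightarrow> 'e"
  assumes "graded_ring R \<A>"
    and "noetherian_ring R"
    and "standard_graded R \<A>"
    and "is_local_ring (degree_zero_ring R \<A>) \<mm>\<^sub>0"
    and "infinite (carrier (degree_zero_ring R \<A> Quot \<mm>\<^sub>0))"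
    and "graded_module R \<A> M \<M>"
    and "finitely_generated_module R M"
    and "\<exists>S \<subseteq> \<A> 0. J = Idl\<^bsub>R\<^esub> S"
    and "graded_injective_resolution R \<A> M \<M> E \<E> \<epsilon> \<delta>"
  shows "\<forall>i \<ge> 1. \<forall>n :: int.
           finitely_generated_module (degree_zero_ring R \<A>)
             (pair_local_cohomology_component R (irrelevant_ideal R \<A>) J E \<E> \<delta> i n)"
proof (intro allI impI)
  fix i :: nat and n :: int assume "i \<ge> 1"
  then obtain j where i: "i = Suc j" by (cases i) auto
  interpret R: std_graded_ring R \<A>
    by (intro std_graded_ring.intro std_graded_ring_axioms.intro assms(1-3))
  obtain f r where gen: "R.generates_degree_one f r" using R.exists_generators by blast
  obtain S where S: "S \<subseteq> \<A> 0" "J = Idl\<^bsub>R\<^esub> S" using assms(8) by blast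
  have Sc: "S \<subseteq> carrier R" using S(1) R.deg.piece_carrier by blast
  have J: "ideal J R" unfolding S(2) by (rule R.genideal_ideal[OF Sc])
  note res = assms(9)[unfolded graded_injective_resolution_def]
  have exact: "\<delta> k ` carrier (E k) = a_kernel (E (Suc k)) (E (Suc (Suc k))) (\<delta> (Suc k))" for k using res by blast
  interpret X: injective_complex R \<A> E \<E> \<delta> f r
  proof
    show "graded_injective R \<A> (E k) (\<E> k)" "\<delta> k \<in> graded_linear_maps R (E k) (\<E> k) (E (Suc k)) (\<E> (Suc k))" for k
      using res by blast+
    show "\<delta> (Suc k) (\<delta> k x) = \<zero>\<^bsub>E (Suc (Suc k))\<^esub>" if "x \<in> carrier (E k)" for k x
    proof -
      have "\<delta> k x \<in> a_kernel (E (Suc k)) (E (Suc (Suc k))) (\<delta> (Suc k))" using exact[of k] that by blast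
      then show ?thesis unfolding a_kernel_def' by blast
    qed
  qed (rule gen)
  have R0: "cring (degree_zero_ring R \<A>)" using assms(4) unfolding is_local_ring_def by blast
  have noeth: "X.C.noeth"
    by (rule X.noeth[OF assms(6,7) _ _ _ exact]) (use res in blast)+
  show "finitely_generated_module (degree_zero_ring R \<A>)
    (pair_local_cohomology_component R (irrelevant_ideal R \<A>) J E \<E> \<delta> i n)"
  proof (cases "S \<subseteq> \<mm>\<^sub>0")
    case True
    show ?thesis unfolding i by (rule X.component_fg[OF J R0 assms(4) S(1) True S(2) noeth])
  next
    case False
    then obtain s where s: "s \<in> S" "s \<notin> \<mm>\<^sub>0" by blast
    then obtain b where b: "b \<in> \<A> 0" "b \<otimes>\<^bsub>R\<^esub> s = \<one>\<^bsub>R\<^esub>"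
      using R.unit_if_not_in_maximal[OF assms(4)] S(1) by blast
    have "s \<in> J" unfolding S(2) using R.genideal_self[OF Sc] s(1) by blast
    then have "\<one>\<^bsub>R\<^esub> \<in> J" using ideal.I_l_closed[OF J _ R.deg.piece_carrier[OF b(1)], of s] b(2) by simp
    then have "J = carrier R" using ideal.one_imp_carrier[OF J] by blast
    then show ?thesis unfolding i by (rule X.component_fg_unit_ideal[OF J R0 _ exact])
  qed
qed

end
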